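(* Let $(\lambda_m)_{m\in\mathbb{N}}$ be a sequence of probability measures on $\mathbb{R}$, each having a log-concave density, and for every $n$ let $\mu_n=\lambda_1\otimes\cdots\otimes\lambda_n$ on $\mathbb{R}^n$. Let $N=N(n)>n$. For every $\varepsilon\in(0,1)$: if $N(n)\leqslant\exp\big((1-\varepsilon)\mathbb{E}\Lambda^\ast_{\mu_n}\big)$ for all $n$, then $\lim_{n\to\infty}\mathbb{E}\mu_n(K_N)=0$; if $N(n)\geqslant\exp\big((1+\varepsilon)\mathbb{E}\Lambda^\ast_{\mu_n}\big)$ for all $n$, then $\lim_{n\to\infty}\mathbb{E}\mu_n(K_N)=1$. Moreover, there is an absolute constant $C>0$ such that for every $\delta\in(0,1)$, for all sufficiently large $n$, \[ \frac{\varrho(\mu_n,\delta)}{\mathbb{E}\Lambda^\ast_{\mu_n}}\leqslant C\max\Big\{(\delta n)^{-1/2},\frac{\log n}{n}\Big\}. \]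
   Context: For a probability measure $\mu$ on $\mathbb{R}^n$ with $X\sim\mu$: $\Lambda_\mu(\xi)=\log\mathbb{E}e^{\langle X,\xi\rangle}$, $\Lambda_\mu^\ast(x)=\sup_{\xi}(\langle x,\xi\rangle-\Lambda_\mu(\xi))$, and $\mathbb{E}\Lambda^\ast_\mu$ means $\mathbb{E}\Lambda^\ast_\mu(X)$. For $N>n$, $K_N=\mathrm{conv}\{X_1,\dots,X_N\}$ where $X_1,\dots,X_N$ are i.i.d. with law $\mu$, and $\mathbb{E}\mu(K_N)$ is the expectation over the $X_i$. For $\delta\in(0,1)$: $\varrho_1(\mu,\delta)=\sup\{r>0:\mathbb{E}\mu(K_N)\leqslant\delta\text{ for every }N\leqslant e^r\}$, $\varrho_2(\mu,\delta)=\inf\{r>0:\mathbb{E}\mu(K_N)\geqslant1-\delta\text{ for every }N\geqslant e^r\}$, and $\varrho(\mu,\delta)=\varrho_2(\mu,\delta)-\varrho_1(\mu,\delta)$. *)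

theory Defs
  imports "HOL-Probability.Probability"
begin

text \<open>Points of R^n are represented as extensional functions nat => real on the
index set {..<n} (the carrier of PiM {..<n} ...).\<close>

definition inner_n :: "nat \<Rightarrow> (nat \<Rightarrow> real) \<Rightarrow> (nat \<Rightarrow> real) \<Rightarrow> real" where
  "inner_n n x \<xi> = (\<Sum>i<n. x i * \<xi> i)"

definition log_concave :: "(real \<Rightarrow> real) \<Rightarrow> bool" where
  "log_concave f \<longleftrightarrow> (\<forall>x y t. 0 < t \<and> t < 1 \<longrightarrow>
      f x powr t * f y powr (1 - t) \<le> f (t * x + (1 - t) * y))"

definition has_log_concave_density :: "real measure \<Rightarrow> bool" where
  "has_log_concave_density M \<longleftrightarrow> prob_space M \<and>
     (\<exists>f. f \<in> borel_measurable borel \<and> (\<forall>x. 0 \<le> f x) \<and> log_concave f \<and>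
          M = density lborel (\<lambda>x. ennreal (f x)))"

text \<open>mu_n = lambda_1 x ... x lambda_n (sequence indexed from 0 here).\<close>
definition prod_meas :: "(nat \<Rightarrow> real measure) \<Rightarrow> nat \<Rightarrow> (nat \<Rightarrow> real) measure" where
  "prod_meas lam n = PiM {..<n} lam"

definition Lambda :: "nat \<Rightarrow> (nat \<Rightarrow> real) measure \<Rightarrow> (nat \<Rightarrow> real) \<Rightarrow> ereal" where
  "Lambda n \<mu> \<xi> =
    (let m = (\<integral>\<^sup>+ x. ennreal (exp (inner_n n x \<xi>)) \<partial>\<mu>)
     in if m = \<infinity> then \<infinity> else ereal (ln (enn2real m)))"

definition Lambda_star :: "nat \<Rightarrow> (nat \<Rightarrow> real) measure \<Rightarrow> (nat \<Rightarrow> real) \<Rightarrow> ereal" where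
  "Lambda_star n \<mu> x = (SUP \<xi>. ereal (inner_n n x \<xi>) - Lambda n \<mu> \<xi>)"

definition E_Lambda_star :: "nat \<Rightarrow> (nat \<Rightarrow> real) measure \<Rightarrow> real" where
  "E_Lambda_star n \<mu> = (\<integral>x. real_of_ereal (Lambda_star n \<mu> x) \<partial>\<mu>)"

definition K_hull :: "nat \<Rightarrow> nat \<Rightarrow> (nat \<Rightarrow> nat \<Rightarrow> real) \<Rightarrow> (nat \<Rightarrow> real) set" where
  "K_hull n N X = {y \<in> PiE {..<n} (\<lambda>_. UNIV). \<exists>a :: nat \<Rightarrow> real.
      (\<forall>j<N. 0 \<le> a j) \<and> (\<Sum>j<N. a j) = 1 \<and> (\<forall>i<n. y i = (\<Sum>j<N. a j * X j i))}"

definition E_meas_K :: "nat \<Rightarrow> nat \<Rightarrow> (nat \<Rightarrow> real) measure \<Rightarrow> real" where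
  "E_meas_K n N \<mu> = (\<integral>X. measure \<mu> (K_hull n N X) \<partial>(PiM {..<N} (\<lambda>_. \<mu>)))"

definition rho1 :: "nat \<Rightarrow> (nat \<Rightarrow> real) measure \<Rightarrow> real \<Rightarrow> real" where
  "rho1 n \<mu> \<delta> = Sup {r. r > 0 \<and> (\<forall>N. n < N \<and> real N \<le> exp r \<longrightarrow> E_meas_K n N \<mu> \<le> \<delta>)}"

definition rho2 :: "nat \<Rightarrow> (nat \<Rightarrow> real) measure \<Rightarrow> real \<Rightarrow> real" where
  "rho2 n \<mu> \<delta> = Inf {r. r > 0 \<and> (\<forall>N. n < N \<and> real N \<ge> exp r \<longrightarrow> E_meas_K n N \<mu> \<ge> 1 - \<delta>)}"

definition rho :: "nat \<Rightarrow> (nat \<Rightarrow> real) measure \<Rightarrow> real \<Rightarrow> real" where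
  "rho n \<mu> \<delta> = rho2 n \<mu> \<delta> - rho1 n \<mu> \<delta>"

end

theory Submission
  imports Defs "HOL-Real_Asymp.Real_Asymp"
begin

text \<open>The point \<open>x\<close> lies in \<open>K\<^sub>N\<close> with probability at most \<open>N\<close> times the \<open>\<mu>\<close>-mass of any half-space
  whose boundary passes through \<open>x\<close>, and is missed with probability at most \<open>(n + 1) / (N p)\<close> if
  all these half-spaces have mass at least \<open>p\<close>; the latter is a leave-one-out argument, since by
  Caratheodory at most \<open>n + 1\<close> sample points determine the point of the hull nearest to \<open>x\<close>. So
  everything depends on comparing the smallest half-space mass at \<open>x\<close> with \<open>exp (- \<Lambda>\<^sup>*(x))\<close>.
  Chernoff gives one direction. For the other, tilt every factor so that its mean becomes \<open>x\<^sub>i\<close>: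
  log-concavity bounds the kurtosis of the tilted factors, so by Paley-Zygmund a half-space through
  the barycentre \<open>x\<close> keeps a constant tilted mass, while the log-likelihood ratio fluctuates by
  \<open>O(sqrt (\<Sum> (1 + \<Lambda>\<^sub>i\<^sup>*(x\<^sub>i))\<^sup>2))\<close> around \<open>\<Lambda>\<^sup>*(x)\<close>. As \<open>\<Lambda>\<^sub>i\<^sup>*\<close> has mean bounded below and second moment
  bounded above by absolute constants, Chebyshev's inequality concludes.\<close>

section \<open>Distance from the origin to a convex hull\<close>

text \<open>The mean of the Legendre transform grows at least linearly in \<open>n\<close>, while
  its fluctuation and the tilting error are both of order \<open>sqrt n\<close>; this gap yields the
  two limits, and \<open>sqrt (n / \<delta>)\<close> divided by \<open>n\<close> is the term
  \<open>(\<delta> * n) powr (-1/2)\<close>. The term \<open>ln n / n\<close> pays for the factor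
  \<open>n + 1\<close> from Caratheodory and for a vanishing error in the union bound. The obstacle
  is uniformity: no constant may depend on the laws or on how far \<open>x\<close> lies in the tail.
  Log-concavity is invariant under scaling and exponential tilting, so a single kurtosis bound
  \<open>kurt\<close> serves all tilted factors. The tilting parameter is controlled without
  regularity of the density: undoing the tilt integrates \<open>exp (- \<xi> * (y - x))\<close> to
  exactly \<open>exp L\<close>, with \<open>L\<close> the one-dimensional transform, and
  Paley-Zygmund for the tilted law then bounds \<open>\<xi>\<^sup>2\<close> times the tilted
  variance by a multiple of \<open>(1 + L)\<^sup>2\<close>. Generating functions may be infinite, so
  they live in \<open>ennreal\<close>, and first-order conditions come from quadratic bounds instead
  of derivatives.\<close>

lemma homogeneous_system_nontrivial:
  fixes A :: "nat \<Rightarrow> 'j \<Rightarrow> real"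
  assumes "finite J" "n < card J"
  shows "\<exists>c. (\<exists>j\<in>J. c j \<noteq> 0) \<and> (\<forall>i<n. (\<Sum>j\<in>J. c j * A i j) = 0)"
  using assms
proof (induction n arbitrary: J A)
  case 0
  then obtain j where "j \<in> J" by (metis card.empty equals0I less_irrefl)
  then show ?case by (intro exI[of _ "\<lambda>_. 1"]) auto
next
  case (Suc n)
  show ?case
  proof (cases "\<forall>j\<in>J. A n j = 0")
    case True
    obtain c where c: "\<exists>j\<in>J. c j \<noteq> 0" "\<forall>i<n. (\<Sum>j\<in>J. c j * A i j) = 0"
      using Suc.IH[of J A] Suc.prems by auto
    have "(\<Sum>j\<in>J. c j * A n j) = 0" using True by simp
    with c show ?thesis by (metis less_Suc_eq)
  next
    case False
    then obtain k where k: "k \<in> J" "A n k \<noteq> 0" by auto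
    define J' where "J' = J - {k}"
    have J': "finite J'" "n < card J'" "k \<notin> J'" "J = insert k J'"
      using Suc.prems k by (auto simp: J'_def)
    obtain c where c: "\<exists>j\<in>J'. c j \<noteq> 0"
        "\<forall>i<n. (\<Sum>j\<in>J'. c j * (A i j - A n j / A n k * A i k)) = 0"
      using Suc.IH[OF J'(1,2), of "\<lambda>i j. A i j - A n j / A n k * A i k"] by blast
    \<comment> \<open>Back substitution: the unknown \<open>k\<close> has been eliminated with its
      pivot, and equation \<open>n\<close> now determines its value.\<close>
    define d where "d = c(k := - (\<Sum>j\<in>J'. c j * A n j) / A n k)"
    have sd: "(\<Sum>j\<in>J. d j * A i j) = (\<Sum>j\<in>J'. c j * (A i j - A n j / A n k * A i k))" for i
    proof -
      have "(\<Sum>j\<in>J. d j * A i j) = d k * A i k + (\<Sum>j\<in>J'. d j * A i j)"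
        using J' by simp
      also have "(\<Sum>j\<in>J'. d j * A i j) = (\<Sum>j\<in>J'. c j * A i j)"
        using J' by (intro sum.cong) (auto simp: d_def)
      also have "d k * A i k = - (\<Sum>j\<in>J'. c j * (A n j / A n k * A i k))"
        by (simp add: d_def sum_divide_distrib sum_distrib_right sum_negf[symmetric] mult.assoc)
      finally show ?thesis by (simp add: sum_subtractf right_diff_distrib)
    qed
    have "(\<Sum>j\<in>J. d j * A n j) = 0" unfolding sd using k by simp
    moreover have "\<exists>j\<in>J. d j \<noteq> 0" using c(1) J' by (auto simp: d_def)
    ultimately show ?thesis using c(2) sd by (metis less_Suc_eq)
  qed
qed

text \<open>Coefficients vanish off \<open>J\<close>, which makes the simplex compact in the product
  topology on all functions on \<open>nat\<close>; free coordinates would destroy this.\<close>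

definition std_simplex :: "nat set \<Rightarrow> (nat \<Rightarrow> real) set" where
  "std_simplex J = {a. (\<forall>j. 0 \<le> a j) \<and> (\<forall>j. j \<notin> J \<longrightarrow> a j = 0) \<and> sum a J = 1}"

definition comb_sqnorm :: "nat \<Rightarrow> nat set \<Rightarrow> (nat \<Rightarrow> nat \<Rightarrow> real) \<Rightarrow> (nat \<Rightarrow> real) \<Rightarrow> real" where
  "comb_sqnorm n J Y a = (\<Sum>i<n. (\<Sum>j\<in>J. a j * Y j i)\<^sup>2)"

text \<open>A squared distance instead of mere membership: the leave-one-out argument needs a
  quantity that can drop strictly while the hull still misses the origin. For empty \<open>J\<close>
  the infimum is over the empty set, hence the nonemptiness hypotheses below.\<close>

definition hull_sqdist :: "nat \<Rightarrow> nat set \<Rightarrow> (nat \<Rightarrow> nat \<Rightarrow> real) \<Rightarrow> real" where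
  "hull_sqdist n J Y = (INF a\<in>std_simplex J. comb_sqnorm n J Y a)"

lemma comb_sqnorm_nonneg: "0 \<le> comb_sqnorm n J Y a"
  by (simp add: comb_sqnorm_def sum_nonneg)

lemma bdd_below_comb_sqnorm: "bdd_below (comb_sqnorm n J Y ` S)"
  using comb_sqnorm_nonneg by (intro bdd_belowI[of _ 0]) auto

lemma hull_sqdist_le: "a \<in> std_simplex J \<Longrightarrow> hull_sqdist n J Y \<le> comb_sqnorm n J Y a"
  unfolding hull_sqdist_def by (intro cINF_lower bdd_below_comb_sqnorm)

lemma std_simplex_nonempty: "finite J \<Longrightarrow> J \<noteq> {} \<Longrightarrow> std_simplex J \<noteq> {}"
proof -
  assume J: "finite J" "J \<noteq> {}"
  then obtain k where "k \<in> J" by auto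
  then have "(\<lambda>j. if j = k then 1 else 0) \<in> std_simplex J" using J by (simp add: std_simplex_def)
  then show ?thesis by auto
qed

lemma compact_std_simplex: assumes "finite J" shows "compact (std_simplex J)"
proof -
  have "compactin (product_topology (\<lambda>_. euclidean :: real topology) (UNIV::nat set)) (PiE UNIV (\<lambda>_. {0..1}))"
    by (simp add: compactin_PiE)
  then have 1: "compact (PiE (UNIV::nat set) (\<lambda>_. {0..1::real}))"
    by (simp add: euclidean_product_topology)
  have c: "continuous_on UNIV (\<lambda>a::nat\<Rightarrow>real. a j)" for j by simp
  have "std_simplex J = (\<Inter>j. {a. 0 \<le> a j}) \<inter> (\<Inter>j\<in>-J. {a. a j = 0}) \<inter> {a. sum a J = 1}"
    by (auto simp: std_simplex_def)
  moreover have "closed \<dots>"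
    using c by (intro closed_Int closed_INT ballI closed_Collect_le closed_Collect_eq continuous_on_sum)
      (auto intro: continuous_on_const)
  ultimately have 2: "closed (std_simplex J)" by simp
  have "a j \<le> 1" if "a \<in> std_simplex J" for a j
  proof (cases "j \<in> J")
    case True
    then have "a j \<le> sum a J" using that assms
      by (intro member_le_sum) (auto simp: std_simplex_def)
    then show ?thesis using that by (simp add: std_simplex_def)
  qed (use that in \<open>auto simp: std_simplex_def\<close>)
  then have "std_simplex J \<subseteq> PiE UNIV (\<lambda>_. {0..1})"
    by (auto simp: std_simplex_def)
  then have "std_simplex J = PiE UNIV (\<lambda>_. {0..1}) \<inter> std_simplex J" by auto
  then show ?thesis using 1 2 by (metis compact_Int_closed)
qed

lemma hull_sqdist_attained:
  assumes "finite J" "J \<noteq> {}"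
  shows "\<exists>a\<in>std_simplex J. comb_sqnorm n J Y a = hull_sqdist n J Y"
proof -
  have "continuous_on (std_simplex J) (comb_sqnorm n J Y)"
    unfolding comb_sqnorm_def
    by (intro continuous_on_sum continuous_on_power continuous_on_mult continuous_on_const)
      (rule continuous_on_subset[OF continuous_on_product_coordinates], simp)
  then obtain a where a: "a \<in> std_simplex J" "\<forall>b\<in>std_simplex J. comb_sqnorm n J Y a \<le> comb_sqnorm n J Y b"
    using continuous_attains_inf[OF compact_std_simplex[OF assms(1)] std_simplex_nonempty[OF assms]] by blast
  then have "comb_sqnorm n J Y a \<le> hull_sqdist n J Y"
    unfolding hull_sqdist_def by (intro cINF_greatest std_simplex_nonempty assms) auto
  with hull_sqdist_le[OF a(1)] a(1) show ?thesis by (metis antisym)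
qed

text \<open>Among all coefficient vectors with the same barycentre take one with the smallest
  support. More than \<open>n + 1\<close> support points carry a nontrivial affine dependency
  \<open>c\<close>, and subtracting a multiple of it removes a point.\<close>

lemma caratheodory_std_simplex:
  assumes J: "finite J" and a: "a \<in> std_simplex J"
  shows "\<exists>b\<in>std_simplex J. (\<forall>i<n. (\<Sum>j\<in>J. b j * Y j i) = (\<Sum>j\<in>J. a j * Y j i)) \<and>
           card {j\<in>J. b j \<noteq> 0} \<le> n + 1"
proof -
  define P where "P b \<longleftrightarrow> b \<in> std_simplex J \<and> (\<forall>i<n. (\<Sum>j\<in>J. b j * Y j i) = (\<Sum>j\<in>J. a j * Y j i))" for b
  have "P a" using a by (simp add: P_def)
  then obtain b where b: "P b" and min: "\<And>b'. P b' \<Longrightarrow> card {j\<in>J. b j \<noteq> 0} \<le> card {j\<in>J. b' j \<noteq> 0}"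
    using ex_has_least_nat[of P a "\<lambda>b. card {j\<in>J. b j \<noteq> 0}"] by auto
  define S where "S = {j\<in>J. b j \<noteq> 0}"
  have S: "finite S" "S \<subseteq> J" using J by (auto simp: S_def)
  have bs: "\<And>j. 0 \<le> b j" "\<And>j. j \<notin> J \<Longrightarrow> b j = 0" "sum b J = 1"
    using b by (auto simp: P_def std_simplex_def)
  have "card S \<le> n + 1"
  proof (rule ccontr)
    assume "\<not> card S \<le> n + 1"
    then have "n + 1 < card S" by simp
    \<comment> \<open>One equation per coordinate and a row of ones, which makes \<open>c\<close>
      sum to zero and so preserves the total weight.\<close>
    from homogeneous_system_nontrivial[OF S(1) this, of "\<lambda>i j. if i < n then Y j i else 1"]
    obtain c where c: "\<exists>j\<in>S. c j \<noteq> 0"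
      "\<forall>i<n+1. (\<Sum>j\<in>S. c j * (if i < n then Y j i else 1)) = 0" by blast
    have c0: "sum c S = 0" using c(2)[rule_format, of n] by simp
    have cY: "(\<Sum>j\<in>S. c j * Y j i) = 0" if "i < n" for i
      using c(2)[rule_format, of i] that by simp
    have "\<exists>j\<in>S. c j > 0"
    proof (rule ccontr)
      assume "\<not> ?thesis"
      then have "\<forall>j\<in>S. 0 \<le> - c j" by force
      moreover have "sum (\<lambda>j. - c j) S = 0" using c0 by (simp add: sum_negf)
      ultimately have "\<forall>j\<in>S. - c j = 0" using S(1) by (subst (asm) sum_nonneg_eq_0_iff) auto
      with c(1) show False by auto
    qed
    then have ne: "{j\<in>S. c j > 0} \<noteq> {}" by auto
    \<comment> \<open>The largest step that keeps every \<open>b j - t * c j\<close> nonnegative;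
      the coefficient attaining the minimum becomes zero.\<close>
    define t where "t = Min ((\<lambda>j. b j / c j) ` {j\<in>S. c j > 0})"
    have "t \<in> (\<lambda>j. b j / c j) ` {j\<in>S. c j > 0}"
      unfolding t_def using S(1) ne by (intro Min_in) auto
    then obtain k where k: "k \<in> S" "c k > 0" "t = b k / c k" by auto
    have t0: "0 \<le> t" using k bs by simp
    have tle: "t \<le> b j / c j" if "j \<in> S" "c j > 0" for j
      unfolding t_def using that S(1) by (intro Min_le) auto
    define d where "d j = (if j \<in> S then b j - t * c j else 0)" for j
    have d0: "0 \<le> d j" for j
    proof (cases "j \<in> S \<and> c j > 0")
      case True
      then have "t * c j \<le> b j" using tle[of j] by (simp add: field_simps)
      then show ?thesis using True by (simp add: d_def)
    next
      case False
      then have "j \<in> S \<Longrightarrow> t * c j \<le> 0" using t0 by (simp add: mult_nonneg_nonpos)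
      then show ?thesis using bs(1)[of j] by (auto simp: d_def)
    qed
    have sumJ: "(\<Sum>j\<in>J. d j * g j) = (\<Sum>j\<in>J. b j * g j) - t * (\<Sum>j\<in>S. c j * g j)" for g
    proof -
      have "(\<Sum>j\<in>J. d j * g j) = (\<Sum>j\<in>S. d j * g j)"
        by (rule sum.mono_neutral_right[OF J S(2)]) (auto simp: d_def)
      also have "\<dots> = (\<Sum>j\<in>S. b j * g j) - t * (\<Sum>j\<in>S. c j * g j)"
        by (simp add: d_def sum_subtractf left_diff_distrib sum_distrib_left mult.assoc)
      also have "(\<Sum>j\<in>S. b j * g j) = (\<Sum>j\<in>J. b j * g j)"
        by (rule sum.mono_neutral_left[OF J S(2)]) (auto simp: S_def)
      finally show ?thesis .
    qed
    have "sum d J = 1" using sumJ[of "\<lambda>_. 1"] c0 bs by simp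
    then have "d \<in> std_simplex J" using d0 S(2) by (auto simp: std_simplex_def d_def)
    then have "P d" using b sumJ cY by (simp add: P_def)
    moreover have "{j\<in>J. d j \<noteq> 0} \<subseteq> S - {k}" using k by (auto simp: d_def)
    then have "card {j\<in>J. d j \<noteq> 0} < card S"
      using S(1) k(1) by (meson card_Diff1_less card_mono finite_Diff le_less_trans)
    ultimately show False using min[of d] by (simp add: S_def)
  qed
  then show ?thesis using b unfolding P_def S_def by blast
qed

lemma std_simplex_support_subset:
  assumes "finite J" "b \<in> std_simplex J" "J' \<subseteq> J" "\<And>j. j \<in> J - J' \<Longrightarrow> b j = 0"
  shows "b \<in> std_simplex J'" "comb_sqnorm n J' Y b = comb_sqnorm n J Y b"
proof -
  have "sum b J' = sum b J" using assms by (intro sum.mono_neutral_left) auto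
  then show "b \<in> std_simplex J'" using assms by (auto simp: std_simplex_def)
  have "(\<Sum>j\<in>J'. b j * Y j i) = (\<Sum>j\<in>J. b j * Y j i)" for i
    using assms by (intro sum.mono_neutral_left) auto
  then show "comb_sqnorm n J' Y b = comb_sqnorm n J Y b" by (simp add: comb_sqnorm_def)
qed

text \<open>Only the support of a minimiser is needed to realise the distance, and by
  Caratheodory it can be chosen with at most \<open>n + 1\<close> elements.\<close>

lemma card_essential_le:
  assumes J: "finite J" "J \<noteq> {}"
  shows "card {i\<in>J. hull_sqdist n J Y < hull_sqdist n (J - {i}) Y} \<le> n + 1"
proof -
  obtain a where a: "a \<in> std_simplex J" "comb_sqnorm n J Y a = hull_sqdist n J Y"
    using hull_sqdist_attained[OF J] by blast
  obtain b where b: "b \<in> std_simplex J" "\<forall>i<n. (\<Sum>j\<in>J. b j * Y j i) = (\<Sum>j\<in>J. a j * Y j i)"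
      "card {j\<in>J. b j \<noteq> 0} \<le> n + 1"
    using caratheodory_std_simplex[OF J(1) a(1)] by blast
  have eq: "comb_sqnorm n J Y b = hull_sqdist n J Y" using a(2) b(2) by (simp add: comb_sqnorm_def)
  have "{i\<in>J. hull_sqdist n J Y < hull_sqdist n (J - {i}) Y} \<subseteq> {j\<in>J. b j \<noteq> 0}"
  proof (rule ccontr)
    assume "\<not> ?thesis"
    then obtain i where i: "i \<in> J" "hull_sqdist n J Y < hull_sqdist n (J - {i}) Y" "b i = 0" by auto
    have "b \<in> std_simplex (J - {i})" "comb_sqnorm n (J - {i}) Y b = comb_sqnorm n J Y b"
      by (rule std_simplex_support_subset[OF J(1) b(1)]; use i in auto)+
    then have "hull_sqdist n (J - {i}) Y \<le> comb_sqnorm n J Y b"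
      using hull_sqdist_le by metis
    with eq i(2) show False by simp
  qed
  then have "card {i\<in>J. hull_sqdist n J Y < hull_sqdist n (J - {i}) Y} \<le> card {j\<in>J. b j \<noteq> 0}"
    using J(1) by (intro card_mono) auto
  with b(3) show ?thesis by simp
qed

lemma hull_sqdist_cong:
  assumes "\<And>j i. j \<in> J \<Longrightarrow> i < n \<Longrightarrow> Y j i = Y' j i"
  shows "hull_sqdist n J Y = hull_sqdist n J Y'"
proof -
  have "comb_sqnorm n J Y = comb_sqnorm n J Y'"
    using assms unfolding comb_sqnorm_def
    by (intro ext sum.cong arg_cong[of _ _ "\<lambda>x. x\<^sup>2"]) auto
  then show ?thesis by (simp add: hull_sqdist_def)
qed

lemma hull_sqdist_nonneg: "finite J \<Longrightarrow> J \<noteq> {} \<Longrightarrow> 0 \<le> hull_sqdist n J Y"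
  unfolding hull_sqdist_def by (intro cINF_greatest std_simplex_nonempty comb_sqnorm_nonneg)

lemma hull_sqdist_antimono:
  assumes "finite J" "J' \<subseteq> J" "J' \<noteq> {}"
  shows "hull_sqdist n J Y \<le> hull_sqdist n J' Y"
proof -
  have "finite J'" using assms finite_subset by blast
  then obtain a where a: "a \<in> std_simplex J'" "comb_sqnorm n J' Y a = hull_sqdist n J' Y"
    using hull_sqdist_attained assms by blast
  have "sum a J' = sum a J" using assms a(1)
    by (intro sum.mono_neutral_left) (auto simp: std_simplex_def)
  then have aJ: "a \<in> std_simplex J" using a(1) assms by (auto simp: std_simplex_def)
  have "comb_sqnorm n J' Y a = comb_sqnorm n J Y a"
    by (rule std_simplex_support_subset(2)[OF assms(1) aJ assms(2)])
      (use a(1) in \<open>auto simp: std_simplex_def\<close>)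
  then show ?thesis using hull_sqdist_le[OF aJ] a(2) by metis
qed

text \<open>\<open>z\<close> is the point of the hull nearest to the origin. If \<open>y\<close> has
  nonpositive inner product with \<open>z\<close>, the segment from \<open>z\<close> to
  \<open>y\<close> comes closer to the origin. The order of quantifiers matters: \<open>z\<close> is
  fixed before \<open>y\<close>, so that later \<open>y\<close> can be random and independent of
  it.\<close>

lemma hull_sqdist_decreases:
  assumes J: "finite J" "J \<noteq> {}" "k \<notin> J" and pos: "0 < hull_sqdist n J Y"
  shows "\<exists>z. \<forall>y. (\<Sum>i<n. z i * y i) \<le> 0 \<longrightarrow> hull_sqdist n (insert k J) (Y(k := y)) < hull_sqdist n J Y"
proof -
  obtain a where a: "a \<in> std_simplex J" "comb_sqnorm n J Y a = hull_sqdist n J Y"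
    using hull_sqdist_attained[OF J(1,2)] by blast
  define z where "z i = (\<Sum>j\<in>J. a j * Y j i)" for i
  define q where "q = (\<Sum>i<n. (z i)\<^sup>2)"
  have q: "q = hull_sqdist n J Y" using a(2) by (simp add: q_def z_def comb_sqnorm_def)
  have q0: "q > 0" using q pos by simp
  show ?thesis
  proof (intro exI[of _ z] allI impI)
    fix y assume y: "(\<Sum>i<n. z i * y i) \<le> 0"
    define r where "r = (\<Sum>i<n. (y i)\<^sup>2)"
    have r0: "0 \<le> r" by (simp add: r_def sum_nonneg)
    \<comment> \<open>The minimiser of \<open>s\<^sup>2 * r + (1 - s)\<^sup>2 * q\<close>; the
      minimum \<open>q * r / (q + r)\<close> is below \<open>q\<close>.\<close>
    define s where "s = q / (q + r)"
    have s: "0 < s" "s \<le> 1" using q0 r0 by (auto simp: s_def field_simps)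
    define b where "b j = (if j = k then s else (1 - s) * a j)" for j
    have ak: "a k = 0" using a(1) J by (auto simp: std_simplex_def)
    have sb: "(\<Sum>j\<in>J. b j * g j) = (1 - s) * (\<Sum>j\<in>J. a j * g j)" for g
      unfolding sum_distrib_left using J by (intro sum.cong) (auto simp: b_def)
    have "sum b (insert k J) = 1"
      using sb[of "\<lambda>_. 1"] J a(1) by (simp add: b_def std_simplex_def)
    then have bs: "b \<in> std_simplex (insert k J)" using s a(1) J by (auto simp: std_simplex_def b_def)
    have comb: "(\<Sum>j\<in>insert k J. b j * (Y(k := y)) j i) = s * y i + (1 - s) * z i" for i
    proof -
      have "(\<Sum>j\<in>J. b j * (Y(k := y)) j i) = (\<Sum>j\<in>J. b j * Y j i)"
        using J by (intro sum.cong) auto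
      then show ?thesis using J sb[of "\<lambda>j. Y j i"] by (simp add: b_def z_def)
    qed
    have "comb_sqnorm n (insert k J) (Y(k := y)) b = (\<Sum>i<n. (s * y i + (1 - s) * z i)\<^sup>2)"
      unfolding comb_sqnorm_def comb ..
    also have "\<dots> = s\<^sup>2 * r + 2 * s * (1 - s) * (\<Sum>i<n. z i * y i) + (1 - s)\<^sup>2 * q"
      unfolding r_def q_def sum_distrib_left sum.distrib[symmetric]
      by (intro sum.cong refl) (simp add: power2_eq_square algebra_simps)
    also have "\<dots> \<le> s\<^sup>2 * r + (1 - s)\<^sup>2 * q"
      using y s by (simp add: mult_nonneg_nonpos)
    also have "\<dots> = q * r / (q + r)"
    proof -
      have "1 - s = r / (q + r)" using q0 r0 by (simp add: s_def field_simps)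
      then have "s\<^sup>2 * r + (1 - s)\<^sup>2 * q = q\<^sup>2 * r / (q + r)\<^sup>2 + r\<^sup>2 * q / (q + r)\<^sup>2"
        by (simp only: s_def power_divide times_divide_eq_left)
      also have "\<dots> = (q * r * (q + r)) / (q + r)\<^sup>2"
        by (simp only: add_divide_distrib[symmetric]) (simp add: power2_eq_square algebra_simps)
      also have "\<dots> = q * r / (q + r)" by (simp add: power2_eq_square)
      finally show ?thesis .
    qed
    also have "\<dots> < q" using q0 r0 by (simp add: field_simps)
    finally have "comb_sqnorm n (insert k J) (Y(k := y)) b < q" .
    with hull_sqdist_le[OF bs, of n "Y(k := y)"] q
    show "hull_sqdist n (insert k J) (Y(k := y)) < hull_sqdist n J Y" by linarith
  qed
qed

section \<open>Membership in the hull and measurability of the distance\<close>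

lemma K_hull_iff_hull_sqdist:
  assumes "0 < N" "x \<in> PiE {..<n} (\<lambda>_. UNIV)"
  shows "x \<in> K_hull n N X \<longleftrightarrow> hull_sqdist n {..<N} (\<lambda>j i. X j i - x i) = 0"
proof
  assume "x \<in> K_hull n N X"
  then obtain a where a: "\<forall>j<N. 0 \<le> a j" "(\<Sum>j<N. a j) = 1" "\<forall>i<n. x i = (\<Sum>j<N. a j * X j i)"
    by (auto simp: K_hull_def)
  define b where "b j = (if j < N then a j else 0)" for j
  have "sum b {..<N} = 1" using a by (simp add: b_def)
  then have b: "b \<in> std_simplex {..<N}" using a by (auto simp: std_simplex_def b_def)
  have "(\<Sum>j<N. b j * (X j i - x i)) = 0" if "i < n" for i
    using a that by (simp add: b_def right_diff_distrib sum_subtractf sum_distrib_right[symmetric])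
  then have "comb_sqnorm n {..<N} (\<lambda>j i. X j i - x i) b = 0" by (simp add: comb_sqnorm_def)
  moreover have "0 \<le> hull_sqdist n {..<N} (\<lambda>j i. X j i - x i)"
    using assms by (intro hull_sqdist_nonneg) auto
  ultimately show "hull_sqdist n {..<N} (\<lambda>j i. X j i - x i) = 0"
    using hull_sqdist_le[OF b, of n "\<lambda>j i. X j i - x i"] by linarith
next
  assume "hull_sqdist n {..<N} (\<lambda>j i. X j i - x i) = 0"
  \<comment> \<open>The infimum is attained by compactness, so zero distance gives an exact convex
    combination.\<close>
  then obtain a where a: "a \<in> std_simplex {..<N}" "comb_sqnorm n {..<N} (\<lambda>j i. X j i - x i) a = 0"
    using hull_sqdist_attained[of "{..<N}" n "\<lambda>j i. X j i - x i"] assms by force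
  have "(\<Sum>j<N. a j * (X j i - x i)) = 0" if "i < n" for i
    using a(2) that by (auto simp: comb_sqnorm_def sum_nonneg_eq_0_iff)
  then have "\<forall>i<n. x i = (\<Sum>j<N. a j * X j i)"
    using a(1) by (simp add: right_diff_distrib sum_subtractf sum_distrib_right[symmetric] std_simplex_def)
  then show "x \<in> K_hull n N X" using a(1) assms(2) unfolding K_hull_def std_simplex_def by blast
qed

text \<open>An infimum of continuous functions is upper semicontinuous: its strict sublevel sets are
  unions of open sets, however large the family.\<close>

lemma borel_measurable_hull_sqdist:
  assumes J: "finite J" "J \<noteq> {}"
  shows "hull_sqdist n J \<in> borel_measurable borel"
proof (rule borel_measurableI_less)
  fix t :: real
  have "{Y. hull_sqdist n J Y < t} = (\<Union>a\<in>std_simplex J. {Y. comb_sqnorm n J Y a < t})"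
    unfolding hull_sqdist_def
    by (auto simp: cINF_less_iff std_simplex_nonempty J bdd_below_comb_sqnorm)
  moreover have "open {Y. comb_sqnorm n J Y a < t}" for a
  proof -
    have "continuous_on UNIV (\<lambda>Y::nat\<Rightarrow>nat\<Rightarrow>real. Y j i)" for j i
      by (rule continuous_on_product_then_coordinatewise, simp)
    then have "continuous_on UNIV (\<lambda>Y. comb_sqnorm n J Y a)"
      unfolding comb_sqnorm_def
      by (intro continuous_on_sum continuous_on_power continuous_on_mult continuous_on_const)
    then show ?thesis by (intro open_Collect_less continuous_on_const)
  qed
  ultimately have "open {Y. hull_sqdist n J Y < t}" by auto
  then show "{Y \<in> space borel. hull_sqdist n J Y < t} \<in> sets borel" by simp
qed

lemma measurable_hull_sqdist[measurable (raw)]: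
  assumes J: "finite J" "J \<noteq> {}"
    and [measurable]: "\<And>j i. j \<in> J \<Longrightarrow> i < n \<Longrightarrow> (\<lambda>\<omega>. F \<omega> j i) \<in> borel_measurable M"
  shows "(\<lambda>\<omega>. hull_sqdist n J (F \<omega>)) \<in> borel_measurable M"
proof -
  \<comment> \<open>\<open>F\<close> is assumed measurable only in the coordinates that enter the
    distance; the others are replaced by zero.\<close>
  define G where "G \<omega> j i = (if j \<in> J \<and> i < n then F \<omega> j i else 0)" for \<omega> j i
  have "G \<in> measurable M borel"
  proof (intro measurable_coordinatewise_then_product)
    fix j i show "(\<lambda>\<omega>. G \<omega> j i) \<in> borel_measurable M"
      by (cases "j \<in> J \<and> i < n") (auto simp: G_def)
  qed
  then have "(\<lambda>\<omega>. hull_sqdist n J (G \<omega>)) \<in> borel_measurable M"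
    by (rule measurable_compose[OF _ borel_measurable_hull_sqdist[OF J]])
  also have "(\<lambda>\<omega>. hull_sqdist n J (G \<omega>)) = (\<lambda>\<omega>. hull_sqdist n J (F \<omega>))"
    by (intro ext hull_sqdist_cong) (auto simp: G_def)
  finally show ?thesis .
qed

section \<open>Random convex hulls and half-space probabilities\<close>

definition hits_hull :: "nat \<Rightarrow> nat \<Rightarrow> (nat \<Rightarrow> real) \<Rightarrow> (nat \<Rightarrow> nat \<Rightarrow> real) \<Rightarrow> bool" where
  "hits_hull n N x X \<longleftrightarrow> hull_sqdist n {..<N} (\<lambda>j i. X j i - x i) = 0"

locale prob_Rn = prob_space M for M :: "(nat \<Rightarrow> real) measure" +
  fixes n :: nat
  assumes sets_M: "sets M = sets (PiM {..<n} (\<lambda>_. borel))"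
begin

lemma space_M: "space M = PiE {..<n} (\<lambda>_. UNIV)"
  using sets_eq_imp_space_eq[OF sets_M] by (simp add: space_PiM)

lemma measurable_M_component[measurable]: "i < n \<Longrightarrow> (\<lambda>y. y i) \<in> borel_measurable M"
  unfolding measurable_cong_sets[OF sets_M refl] by (rule measurable_component_singleton) simp

lemma measurable_sample_component:
  "j \<in> J \<Longrightarrow> i < n \<Longrightarrow> (\<lambda>X. X j i) \<in> borel_measurable (PiM J (\<lambda>_. M))"
  by (rule measurable_compose[OF measurable_component_singleton[where M = "\<lambda>_. M"] measurable_M_component])

text \<open>Removing the \<open>i\<close>-th of \<open>N\<close> sample points moves the hull away from \<open>x\<close> for at most
  \<open>n + 1\<close> indices \<open>i\<close>; if \<open>x\<close> is missed by the other points, this happens with probability at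
  least \<open>p\<close> over the \<open>i\<close>-th point.\<close>

lemma prob_miss_hull_le:
  assumes N: "2 \<le> N" and p: "0 < p"
    and depth: "\<And>\<theta>. p \<le> measure M {y\<in>space M. (\<Sum>i<n. \<theta> i * (y i - x i)) \<le> 0}"
  shows "measure (PiM {..<N} (\<lambda>_. M)) {X\<in>space (PiM {..<N} (\<lambda>_. M)). \<not> hits_hull n N x X}
           \<le> (real n + 1) / (real N * p)"
proof -
  define J where "J = {..<N}"
  define P where "P = PiM J (\<lambda>_. M)"
  define D where "D S X = hull_sqdist n S (\<lambda>j i. X j i - x i)" for S X
  define E where "E i = {X\<in>space P. 0 < D (J - {i}) X \<and> D J X < D (J - {i}) X}" for i
  interpret PS: product_prob_space "\<lambda>_. M" J by standard
  interpret P: prob_space P unfolding P_def by (rule prob_space_PiM) (rule prob_space_axioms)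
  have J: "finite J" "J \<noteq> {}" using N lessThan_empty_iff[of N] by (auto simp: J_def)
  \<comment> \<open>This is where \<open>N\<close> has to be at least \<open>2\<close>: removing one
    sample point must leave a hull.\<close>
  have J1: "J - {i} \<noteq> {}" for i
  proof -
    have "0 \<in> J" "1 \<in> J" using N by (auto simp: J_def)
    then show ?thesis by (cases "i = 0") auto
  qed
  have Dm: "(\<lambda>X. D S X) \<in> borel_measurable (PiM T (\<lambda>_. M))"
    if "finite S" "S \<noteq> {}" "S \<subseteq> T" for S T
    unfolding D_def using that by (intro measurable_hull_sqdist) (auto intro!: borel_measurable_diff measurable_sample_component)
  have [measurable]: "D J \<in> borel_measurable P" "D (J - {i}) \<in> borel_measurable P" for i
    using Dm[of J J] Dm[of "J - {i}" J] J J1[of i] by (auto simp: P_def)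
  have E[measurable]: "E i \<in> sets P" for i unfolding E_def by measurable
  define F where "F = {X\<in>space P. 0 < D J X}"
  have F[measurable]: "F \<in> sets P" unfolding F_def by measurable
  have key: "p * P.prob F \<le> P.prob (E i)" if i: "i \<in> J" for i
  proof -
    define I where "I = J - {i}"
    have I: "finite I" "i \<notin> I" "J = insert i I" "I \<noteq> {}" using J i J1 by (auto simp: I_def)
    define F' where "F' = {X\<in>space P. 0 < D I X}"
    have F'[measurable]: "F' \<in> sets P" unfolding F'_def I_def by measurable
    have PI: "P = PiM (insert i I) (\<lambda>_. M)" by (simp add: P_def I(3))
    have "F \<subseteq> F'"
      using hull_sqdist_antimono[of J I n] J I unfolding F_def F'_def D_def
      by (auto intro: order_less_le_trans)
    then have "ennreal p * emeasure P F \<le> ennreal p * emeasure P F'"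
      by (intro mult_left_mono emeasure_mono F') auto
    also have "\<dots> = (\<integral>\<^sup>+X. ennreal p * indicator F' X \<partial>P)"
      by (simp add: nn_integral_cmult_indicator)
    also have "\<dots> = (\<integral>\<^sup>+X. (\<integral>\<^sup>+y. ennreal p * indicator F' (X(i := y)) \<partial>M) \<partial>PiM I (\<lambda>_. M))"
      unfolding PI using F' unfolding PI by (subst PS.product_nn_integral_insert) (auto simp: I)
    also have "\<dots> \<le> (\<integral>\<^sup>+X. (\<integral>\<^sup>+y. indicator (E i) (X(i := y)) \<partial>M) \<partial>PiM I (\<lambda>_. M))"
    proof (rule nn_integral_mono)
      fix X assume X: "X \<in> space (PiM I (\<lambda>_. M))"
      have XP: "X(i := y) \<in> space P" if "y \<in> space M" for y
        using X that unfolding PI by (auto simp: space_PiM PiE_iff extensional_def)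
      have DI: "D I (X(i := y)) = D I X" for y
        unfolding D_def using I by (intro hull_sqdist_cong) auto
      show "(\<integral>\<^sup>+y. ennreal p * indicator F' (X(i := y)) \<partial>M) \<le> (\<integral>\<^sup>+y. indicator (E i) (X(i := y)) \<partial>M)"
      proof (cases "0 < D I X")
        case True
        \<comment> \<open>The normal \<open>z\<close> depends only on the other sample points, which
          the inner integral keeps fixed, so \<open>depth\<close> applies to it while the
          \<open>i\<close>-th point is still random.\<close>
        obtain z where z: "\<And>y. (\<Sum>k<n. z k * y k) \<le> 0 \<Longrightarrow>
            hull_sqdist n (insert i I) ((\<lambda>j k. X j k - x k)(i := y)) < hull_sqdist n I (\<lambda>j k. X j k - x k)"
          using hull_sqdist_decreases[OF I(1,4,2) True[unfolded D_def]] by blast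
        define H where "H = {y\<in>space M. (\<Sum>k<n. z k * (y k - x k)) \<le> 0}"
        have H[measurable]: "H \<in> sets M" unfolding H_def by measurable
        have HE: "X(i := y) \<in> E i" if "y \<in> H" for y
        proof -
          have "D J (X(i := y)) = hull_sqdist n (insert i I) ((\<lambda>j k. X j k - x k)(i := (\<lambda>k. y k - x k)))"
            unfolding D_def I(3) by (intro hull_sqdist_cong) auto
          also have "\<dots> < D I X" unfolding D_def using that z[of "\<lambda>k. y k - x k"] by (simp add: H_def)
          finally show ?thesis using that True XP[of y] DI[of y]
            unfolding E_def I_def[symmetric] H_def by auto
        qed
        have "(\<integral>\<^sup>+y. ennreal p * indicator F' (X(i := y)) \<partial>M) \<le> (\<integral>\<^sup>+y. ennreal p \<partial>M)"
          by (intro nn_integral_mono) (auto split: split_indicator)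
        also have "\<dots> = ennreal p" by (simp add: emeasure_space_1)
        also have "\<dots> \<le> emeasure M H"
          using depth[of z] unfolding H_def[symmetric] by (simp add: emeasure_eq_measure)
        also have "\<dots> = (\<integral>\<^sup>+y. indicator H y \<partial>M)" by simp
        also have "\<dots> \<le> (\<integral>\<^sup>+y. indicator (E i) (X(i := y)) \<partial>M)"
          using HE by (intro nn_integral_mono) (auto split: split_indicator)
        finally show ?thesis .
      next
        case False
        then have "indicator F' (X(i := y)) = (0::ennreal)" for y using DI by (simp add: F'_def)
        then show ?thesis by simp
      qed
    qed
    also have "\<dots> = (\<integral>\<^sup>+X. indicator (E i) X \<partial>P)"
      unfolding PI using E[of i] unfolding PI
      by (subst PS.product_nn_integral_insert[symmetric]) (auto simp: I)
    also have "\<dots> = emeasure P (E i)" using E by simp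
    finally show ?thesis
      using p by (simp add: P.emeasure_eq_measure ennreal_mult[symmetric])
  qed
  have "(\<Sum>i\<in>J. P.prob (E i)) = (\<integral>X. (\<Sum>i\<in>J. indicator (E i) X) \<partial>P)"
    by (subst Bochner_Integration.integral_sum) (auto simp: P.emeasure_eq_measure)
  also have "\<dots> \<le> (\<integral>X. real n + 1 \<partial>P)"
  proof (intro integral_mono)
    fix X assume "X \<in> space P"
    have "(\<Sum>i\<in>J. indicator (E i) X) = real (card {i\<in>J. X \<in> E i})"
      using J by (simp add: indicator_def sum.If_cases Int_def)
    also have "card {i\<in>J. X \<in> E i} \<le> card {i\<in>J. D J X < D (J - {i}) X}"
      using J by (intro card_mono) (auto simp: E_def)
    also have "\<dots> \<le> n + 1" unfolding D_def by (rule card_essential_le[OF J])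
    finally show "(\<Sum>i\<in>J. indicator (E i) X) \<le> real n + 1" by simp
  qed (auto intro!: Bochner_Integration.integrable_sum integrable_real_indicator simp: P.emeasure_eq_measure)
  finally have "(\<Sum>i\<in>J. P.prob (E i)) \<le> real n + 1" by (simp add: P.prob_space)
  moreover have "real N * (p * P.prob F) \<le> (\<Sum>i\<in>J. P.prob (E i))"
    using sum_mono[of J "\<lambda>_. p * P.prob F", OF key] by (simp add: J_def)
  ultimately have "real N * p * P.prob F \<le> real n + 1" by simp
  then have "P.prob F \<le> (real n + 1) / (real N * p)" using N p by (simp add: field_simps)
  moreover have "F = {X\<in>space P. \<not> hits_hull n N x X}"
  proof -
    have "0 \<le> D J X" for X unfolding D_def by (rule hull_sqdist_nonneg[OF J])
    then have "0 < D J X \<longleftrightarrow> D J X \<noteq> 0" for X using less_le[of 0 "D J X"] by auto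
    then show ?thesis unfolding F_def by (simp add: hits_hull_def D_def J_def)
  qed
  ultimately show ?thesis by (simp add: P_def J_def)
qed

text \<open>Both sides are the mass of one measurable set of pairs of a sample and a point, sliced
  in the two possible orders. Fixing the point reduces everything to the probability that a given
  \<open>x\<close> is hit.\<close>

lemma
  assumes N: "0 < N"
  shows E_meas_K_eq: "E_meas_K n N M = (\<integral>x. measure (PiM {..<N} (\<lambda>_. M))
      {X\<in>space (PiM {..<N} (\<lambda>_. M)). hits_hull n N x X} \<partial>M)"
    and measurable_prob_hits_hull: "(\<lambda>x. measure (PiM {..<N} (\<lambda>_. M))
      {X\<in>space (PiM {..<N} (\<lambda>_. M)). hits_hull n N x X}) \<in> borel_measurable M"
    and sets_hits_hull: "{X\<in>space (PiM {..<N} (\<lambda>_. M)). hits_hull n N x X} \<in> sets (PiM {..<N} (\<lambda>_. M))"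
proof -
  define P where "P = PiM {..<N} (\<lambda>_. M)"
  interpret P: prob_space P unfolding P_def by (rule prob_space_PiM) (rule prob_space_axioms)
  interpret PM: pair_prob_space P M by standard
  have Pc: "(\<lambda>X. X j i) \<in> borel_measurable P" if "j < N" "i < n" for j i
    using that unfolding P_def by (intro measurable_sample_component) auto
  define Q where "Q = {\<omega>\<in>space (P \<Otimes>\<^sub>M M). hits_hull n N (snd \<omega>) (fst \<omega>)}"
  have "(\<lambda>\<omega>. hull_sqdist n {..<N} (\<lambda>j i. fst \<omega> j i - snd \<omega> i)) \<in> borel_measurable (P \<Otimes>\<^sub>M M)"
  proof (intro measurable_hull_sqdist borel_measurable_diff)
    fix j i assume ji: "j \<in> {..<N}" "i < n"
    show "(\<lambda>\<omega>. fst \<omega> j i) \<in> borel_measurable (P \<Otimes>\<^sub>M M)"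
      by (rule measurable_compose[OF measurable_fst, where g = "\<lambda>X. X j i"]) (use ji Pc in auto)
    show "(\<lambda>\<omega>. snd \<omega> i) \<in> borel_measurable (P \<Otimes>\<^sub>M M)"
      by (rule measurable_compose[OF measurable_snd, where g = "\<lambda>X. X i"]) (use ji in auto)
  qed (use N in auto)
  then have Q[measurable]: "Q \<in> sets (P \<Otimes>\<^sub>M M)" unfolding Q_def hits_hull_def by measurable
  have s1: "Pair X -` Q = K_hull n N X" if "X \<in> space P" for X
    using that K_hull_iff_hull_sqdist[OF N] unfolding Q_def hits_hull_def
    by (auto simp: space_pair_measure space_M K_hull_def)
  have s2: "(\<lambda>X. (X, y)) -` Q = {X\<in>space P. hits_hull n N y X}" if "y \<in> space M" for y
    using that unfolding Q_def by (auto simp: space_pair_measure)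
  have m1: "(\<lambda>X. measure M (K_hull n N X)) \<in> borel_measurable P"
  proof -
    have "(\<lambda>X. enn2real (emeasure M (Pair X -` Q))) \<in> borel_measurable P"
      using measurable_emeasure_Pair[OF Q] by measurable
    then show ?thesis
      by (rule measurable_cong[THEN iffD1, rotated]) (simp add: s1 measure_def)
  qed
  have m2: "(\<lambda>y. P.prob {X\<in>space P. hits_hull n N y X}) \<in> borel_measurable M"
  proof -
    have "(\<lambda>y. enn2real (emeasure P ((\<lambda>X. (X, y)) -` Q))) \<in> borel_measurable M"
      using PM.measurable_emeasure_Pair2[OF Q] by measurable
    then show ?thesis
      by (rule measurable_cong[THEN iffD1, rotated]) (simp add: s2 measure_def)
  qed
  then show "(\<lambda>x. measure (PiM {..<N} (\<lambda>_. M))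
      {X\<in>space (PiM {..<N} (\<lambda>_. M)). hits_hull n N x X}) \<in> borel_measurable M" by (simp add: P_def)
  have "E_meas_K n N M = enn2real (\<integral>\<^sup>+X. ennreal (measure M (K_hull n N X)) \<partial>P)"
    unfolding E_meas_K_def P_def[symmetric] using m1 by (intro integral_eq_nn_integral) auto
  also have "(\<integral>\<^sup>+X. ennreal (measure M (K_hull n N X)) \<partial>P) = emeasure (P \<Otimes>\<^sub>M M) Q"
    by (subst emeasure_pair_measure_alt[OF Q]) (intro nn_integral_cong, simp add: s1 emeasure_eq_measure)
  also have "\<dots> = (\<integral>\<^sup>+y. ennreal (P.prob {X\<in>space P. hits_hull n N y X}) \<partial>M)"
    by (subst PM.emeasure_pair_measure_alt2[OF Q]) (intro nn_integral_cong, simp add: s2 P.emeasure_eq_measure)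
  also have "enn2real \<dots> = (\<integral>y. P.prob {X\<in>space P. hits_hull n N y X} \<partial>M)"
    using m2 by (intro integral_eq_nn_integral[symmetric]) auto
  finally show "E_meas_K n N M = (\<integral>x. measure (PiM {..<N} (\<lambda>_. M))
      {X\<in>space (PiM {..<N} (\<lambda>_. M)). hits_hull n N x X} \<partial>M)" by (simp add: P_def)
  have "(\<lambda>X. hull_sqdist n {..<N} (\<lambda>j i. X j i - x i)) \<in> borel_measurable P"
    using N by (intro measurable_hull_sqdist) (auto intro!: borel_measurable_diff Pc)
  then have "{X\<in>space P. hits_hull n N x X} \<in> sets P" unfolding hits_hull_def by measurable
  then show "{X\<in>space (PiM {..<N} (\<lambda>_. M)). hits_hull n N x X} \<in> sets (PiM {..<N} (\<lambda>_. M))"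
    by (simp add: P_def)
qed

text \<open>Averages \<open>prob_miss_hull_le\<close> over \<open>x\<close>: points of
  \<open>A\<close> contribute one minus the miss probability, and at the other points the lower
  bound is nonpositive.\<close>

lemma E_meas_K_ge:
  assumes N: "2 \<le> N" and p: "0 < p" and A: "A \<in> sets M"
    and depth: "AE x in M. x \<in> A \<longrightarrow> (\<forall>\<theta>. p \<le> measure M {y\<in>space M. (\<Sum>i<n. \<theta> i * (y i - x i)) \<le> 0})"
  shows "prob A - (real n + 1) / (real N * p) \<le> E_meas_K n N M"
proof -
  define P where "P = PiM {..<N} (\<lambda>_. M)"
  define h where "h x = measure P {X\<in>space P. hits_hull n N x X}" for x
  interpret P: prob_space P unfolding P_def by (rule prob_space_PiM) (rule prob_space_axioms)
  have N0: "0 < N" using N by simp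
  have hm[measurable]: "h \<in> borel_measurable M"
    unfolding h_def[abs_def] P_def by (rule measurable_prob_hits_hull[OF N0])
  have c: "0 \<le> (real n + 1) / (real N * p)" using N p by simp
  have "prob A - (real n + 1) / (real N * p) = (\<integral>x. indicator A x - (real n + 1) / (real N * p) \<partial>M)"
    using A by (subst Bochner_Integration.integral_diff) (auto simp: prob_space emeasure_eq_measure)
  also have "\<dots> \<le> (\<integral>x. h x \<partial>M)"
  proof (intro integral_mono_AE)
    have "\<bar>h x\<bar> \<le> 1" for x unfolding h_def using P.prob_le_1 by simp
    then show "integrable M h" by (intro integrable_const_bound[of _ 1] AE_I2 hm) simp
    show "AE x in M. indicator A x - (real n + 1) / (real N * p) \<le> h x"
      using depth
    proof eventually_elim
      case (elim x)
      show ?case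
      proof (cases "x \<in> A")
        case True
        have "P.prob {X\<in>space P. \<not> hits_hull n N x X} \<le> (real n + 1) / (real N * p)"
          unfolding P_def using elim True by (intro prob_miss_hull_le[OF N p]) auto
        moreover have "P.prob {X\<in>space P. \<not> hits_hull n N x X} = 1 - h x"
          unfolding h_def using sets_hits_hull[OF N0] by (intro P.prob_neg) (simp add: P_def)
        ultimately show ?thesis using True by simp
      next
        case False
        then show ?thesis using c by (simp add: h_def order_trans[OF _ measure_nonneg])
      qed
    qed
  qed (use A in \<open>auto intro!: Bochner_Integration.integrable_diff simp: emeasure_eq_measure\<close>)
  also have "\<dots> = E_meas_K n N M" using E_meas_K_eq[OF N0] by (simp add: h_def P_def)
  finally show ?thesis .
qed

lemma E_meas_K_le:
  assumes N: "0 < N" and q: "0 \<le> q" and A: "A \<in> sets M"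
    and depth: "AE x in M. x \<notin> A \<longrightarrow> (\<exists>\<theta>. measure M {y\<in>space M. 0 \<le> (\<Sum>i<n. \<theta> i * (y i - x i))} \<le> q)"
  shows "E_meas_K n N M \<le> prob A + real N * q"
proof -
  define P where "P = PiM {..<N} (\<lambda>_. M)"
  define h where "h x = measure P {X\<in>space P. hits_hull n N x X}" for x
  interpret P: prob_space P unfolding P_def by (rule prob_space_PiM) (rule prob_space_axioms)
  have hm[measurable]: "h \<in> borel_measurable M"
    unfolding h_def[abs_def] P_def by (rule measurable_prob_hits_hull[OF N])
  have "E_meas_K n N M = (\<integral>x. h x \<partial>M)" using E_meas_K_eq[OF N] by (simp add: h_def P_def)
  also have "\<dots> \<le> (\<integral>x. indicator A x + real N * q \<partial>M)"
  proof (intro integral_mono_AE)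
    have "\<bar>h x\<bar> \<le> 1" for x unfolding h_def using P.prob_le_1 by simp
    then show "integrable M h" by (intro integrable_const_bound[of _ 1] AE_I2 hm) simp
    show "AE x in M. h x \<le> indicator A x + real N * q"
      using depth AE_space
    proof eventually_elim
      case (elim x)
      show ?case
      proof (cases "x \<in> A")
        case True
        have "h x \<le> 1" by (simp add: h_def)
        then show ?thesis using True q by (simp add: add_increasing2)
      next
        case False
        then obtain \<theta> where th: "measure M {y\<in>space M. 0 \<le> (\<Sum>i<n. \<theta> i * (y i - x i))} \<le> q"
          using elim by blast
        define H where "H = {y\<in>space M. 0 \<le> (\<Sum>i<n. \<theta> i * (y i - x i))}"
        have H[measurable]: "H \<in> sets M" unfolding H_def by measurable
        \<comment> \<open>A convex combination of points strictly on the negative side of the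
          hyperplane through \<open>x\<close> stays strictly on that side and cannot be
          \<open>x\<close>; hence some sample point lies in \<open>H\<close>.\<close>
        have sub: "{X\<in>space P. hits_hull n N x X} \<subseteq> (\<Union>j<N. (\<lambda>X. X j) -` H \<inter> space P)"
        proof (rule ccontr)
          assume "\<not> ?thesis"
          then obtain X where X: "X \<in> space P" "hits_hull n N x X" "\<And>j. j < N \<Longrightarrow> X j \<notin> H" by blast
          have neg: "(\<Sum>i<n. \<theta> i * (X j i - x i)) < 0" if "j < N" for j
            using X(1) X(3)[OF that] that unfolding H_def P_def by (auto simp: space_PiM PiE_iff)
          have "x \<in> K_hull n N X"
            using X(2) K_hull_iff_hull_sqdist[OF N, of x n X] elim by (simp add: hits_hull_def space_M)
          then obtain a where a: "\<forall>j<N. 0 \<le> a j" "(\<Sum>j<N. a j) = 1" "\<forall>i<n. x i = (\<Sum>j<N. a j * X j i)"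
            by (auto simp: K_hull_def)
          have "(\<Sum>j<N. a j * (\<Sum>i<n. \<theta> i * (X j i - x i))) = (\<Sum>i<n. \<theta> i * (\<Sum>j<N. a j * (X j i - x i)))"
            unfolding sum_distrib_left by (subst sum.swap) (simp add: mult_ac)
          also have "\<dots> = 0"
            using a by (intro sum.neutral ballI)
              (simp add: right_diff_distrib sum_subtractf sum_distrib_right[symmetric])
          finally have z: "(\<Sum>j<N. - (a j * (\<Sum>i<n. \<theta> i * (X j i - x i)))) = 0" by (simp add: sum_negf)
          have "\<forall>j<N. a j = 0"
          proof -
            have "0 \<le> - (a j * (\<Sum>i<n. \<theta> i * (X j i - x i)))" if "j \<in> {..<N}" for j
              using a(1) neg[of j] that by (simp add: mult_nonneg_nonpos less_imp_le)
            then have "\<forall>j\<in>{..<N}. - (a j * (\<Sum>i<n. \<theta> i * (X j i - x i))) = 0"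
              using z by (subst (asm) sum_nonneg_eq_0_iff) auto
            then show ?thesis using neg by (metis lessThan_iff less_irrefl mult_eq_0_iff neg_equal_0_iff_equal)
          qed
          with a(2) show False by simp
        qed
        have "h x \<le> P.prob (\<Union>j<N. (\<lambda>X. X j) -` H \<inter> space P)"
          unfolding h_def using H by (intro P.finite_measure_mono sub sets.finite_UN)
            (auto simp: P_def intro!: measurable_sets[OF measurable_component_singleton])
        also have "\<dots> \<le> (\<Sum>j<N. P.prob ((\<lambda>X. X j) -` H \<inter> space P))"
          using H by (intro P.finite_measure_subadditive_finite)
            (auto simp: P_def intro!: measurable_sets[OF measurable_component_singleton])
        also have "\<dots> = (\<Sum>j<N. prob H)"
        proof (intro sum.cong refl)
          fix j assume "j \<in> {..<N}"
          then have d: "distr P M (\<lambda>X. X j) = M"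
            unfolding P_def by (intro distr_PiM_component) (auto intro: prob_space_axioms)
          have "P.prob ((\<lambda>X. X j) -` H \<inter> space P) = measure (distr P M (\<lambda>X. X j)) H"
            using \<open>j \<in> {..<N}\<close> unfolding P_def by (intro measure_distr[symmetric]) auto
          then show "P.prob ((\<lambda>X. X j) -` H \<inter> space P) = prob H" using d by simp
        qed
        also have "\<dots> \<le> real N * q" using th by (simp add: H_def mult_left_mono)
        finally show ?thesis using False by simp
      qed
    qed
  qed (use A in \<open>auto simp: emeasure_eq_measure\<close>)
  also have "\<dots> = prob A + real N * q"
    using A by (subst Bochner_Integration.integral_add) (auto simp: prob_space emeasure_eq_measure)
  finally show ?thesis .
qed


lemma E_meas_K_nonneg: "0 \<le> E_meas_K n N M"
  unfolding E_meas_K_def by simp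

end

section \<open>Moment inequalities\<close>

lemma (in prob_space) integrable_power_le:
  fixes W :: "'a \<Rightarrow> real"
  assumes [measurable]: "random_variable borel W" and "integrable M (\<lambda>w. W w ^ m)" "k \<le> m" "even m"
  shows "integrable M (\<lambda>w. W w ^ k)"
proof (rule Bochner_Integration.integrable_bound[of _ "\<lambda>w. 1 + W w ^ m"])
  show "AE w in M. norm (W w ^ k) \<le> norm (1 + W w ^ m)"
  proof (rule AE_I2)
    fix w
    have m: "W w ^ m = \<bar>W w\<bar> ^ m" using power_even_abs[OF assms(4), of "W w"] by (rule sym)
    have "\<bar>W w\<bar> ^ k \<le> 1 + \<bar>W w\<bar> ^ m"
    proof (cases "\<bar>W w\<bar> \<le> 1")
      case True
      then have "\<bar>W w\<bar> ^ k \<le> 1" by (intro power_le_one) auto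
      then show ?thesis by (simp add: add_increasing2)
    next
      case False
      then have "\<bar>W w\<bar> ^ k \<le> \<bar>W w\<bar> ^ m" using assms(3) by (intro power_increasing) auto
      then show ?thesis by simp
    qed
    then show "norm (W w ^ k) \<le> norm (1 + W w ^ m)" by (simp add: power_abs m)
  qed
qed (use assms in auto)

text \<open>The fourth moment bounds \<open>E \<bar>W\<bar>\<close> from below through
  \<open>\<bar>w\<bar> \<ge> w\<^sup>2 / s - w\<^sup>4 / (4 s\<^sup>3)\<close>, and half of \<open>E \<bar>W\<bar>\<close> comes from the positive part.\<close>

lemma (in prob_space) paley_zygmund_centered:
  fixes W :: "'a \<Rightarrow> real"
  assumes [measurable]: "random_variable borel W" and int4: "integrable M (\<lambda>w. W w ^ 4)"
    and mean: "expectation W = 0" and B: "1 \<le> B"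
    and fourth: "expectation (\<lambda>w. W w ^ 4) \<le> B * (expectation (\<lambda>w. (W w)\<^sup>2))\<^sup>2"
  shows "1 / (16 * B) \<le> prob {w\<in>space M. sqrt (expectation (\<lambda>w. (W w)\<^sup>2)) / (8 * sqrt B) \<le> W w}"
proof -
  define v where "v = expectation (\<lambda>w. (W w)\<^sup>2)"
  have int2: "integrable M (\<lambda>w. (W w)\<^sup>2)" by (rule integrable_power_le[OF _ int4]) auto
  have int1: "integrable M W" using integrable_power_le[OF _ int4, of 1] by auto
  have v0: "0 \<le> v" by (simp add: v_def)
  show ?thesis
  proof (cases "v = 0")
    case True
    \<comment> \<open>Degenerate variance: the threshold is zero and \<open>W\<close> vanishes
      almost surely.\<close>
    then have "AE w in M. (W w)\<^sup>2 = 0"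
      unfolding v_def by (subst integral_nonneg_eq_0_iff_AE[symmetric]) (auto intro: int2)
    then have "AE w in M. w \<in> {w\<in>space M. 0 \<le> W w}" by (auto elim: AE_mp)
    then have "prob {w\<in>space M. 0 \<le> W w} = 1" by (subst prob_eq_1) auto
    then show ?thesis using True B by (simp add: v_def[symmetric] field_simps)
  next
    case False
    define \<sigma> where "\<sigma> = sqrt v"
    define b where "b = sqrt B"
    have pos: "\<sigma> > 0" "b > 0" and sq: "\<sigma>\<^sup>2 = v" "b\<^sup>2 = B"
      using False v0 B by (auto simp: \<sigma>_def b_def)
    \<comment> \<open>\<open>s\<close>, \<open>a\<close> and \<open>k\<close> are tuned so that, of
      the main term \<open>\<sigma> / b\<close>, one quarter each goes to the fourth moment, to
      \<open>2 * a\<close> and to \<open>k * v\<close>, leaving a quarter for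
      \<open>H\<close>.\<close>
    define s where "s = b * \<sigma>"
    define a where "a = \<sigma> / (8 * b)"
    define k where "k = 1 / (4 * b * \<sigma>)"
    define H where "H = {w\<in>space M. a \<le> W w}"
    have H[measurable]: "H \<in> sets M" unfolding H_def by measurable
    have spos: "s > 0" "a > 0" "k > 0" using pos by (auto simp: s_def a_def k_def)
    have low: "x\<^sup>2 / s - x ^ 4 / (4 * s ^ 3) \<le> \<bar>x\<bar>" for x :: real
    proof -
      define u where "u = \<bar>x\<bar> / s"
      have u: "0 \<le> u" "\<bar>x\<bar> = u * s" using spos by (auto simp: u_def)
      have "0 \<le> 1 - u + u ^ 3 / 4"
      proof -
        show ?thesis
        proof (cases "u \<le> 2")
          case True
          have "1 - u + u ^ 3 / 4 = (u - 1)\<^sup>2 * (u + 2) / 4 + (2 - u) / 4"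
            by (simp add: field_simps power2_eq_square power3_eq_cube)
          moreover have "0 \<le> (u - 1)\<^sup>2 * (u + 2) / 4" using u by simp
          ultimately show ?thesis using True by simp
        next
          case False
          then have "0 \<le> u * (u - 2) * (u + 2) / 4" by simp
          moreover have "1 - u + u ^ 3 / 4 = 1 + u * (u - 2) * (u + 2) / 4"
            by (simp add: field_simps power2_eq_square power3_eq_cube)
          ultimately show ?thesis by linarith
        qed
      qed
      then have "0 \<le> s * u * (1 - u + u ^ 3 / 4)" using spos u by simp
      also have "\<dots> = \<bar>x\<bar> - (\<bar>x\<bar>\<^sup>2 / s - \<bar>x\<bar> ^ 4 / (4 * s ^ 3))"
        unfolding u(2) using spos by (simp add: field_simps power2_eq_square power3_eq_cube power4_eq_xxxx)
      finally show ?thesis by simp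
    qed
    \<comment> \<open>Adding the centred \<open>x\<close> turns \<open>\<bar>x\<bar>\<close> into
      twice its positive part. On \<open>H\<close> this is at most
      \<open>k * x\<^sup>2 + 1 / k\<close> by the arithmetic-geometric mean inequality, off
      \<open>H\<close> at most \<open>2 * a\<close>.\<close>
    have up: "\<bar>x\<bar> \<le> 2 * a + k * x\<^sup>2 + indicator H w / k - x" if "x = W w" "w \<in> space M" for x w
    proof (cases "a \<le> x")
      case True
      have "0 \<le> (k * x - 1)\<^sup>2 / k" using spos by simp
      also have "\<dots> = k * x\<^sup>2 + 1 / k - 2 * x" using spos by (simp add: field_simps power2_eq_square)
      finally show ?thesis using that True spos by (simp add: H_def)
    next
      case False
      then have "0 \<le> k * x\<^sup>2" "\<bar>x\<bar> + x \<le> 2 * a" using spos by auto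
      then show ?thesis using that False by (simp add: H_def)
    qed
    have intH: "integrable M (\<lambda>w. indicator H w :: real)" by (simp add: emeasure_eq_measure)
    have "v / s - expectation (\<lambda>w. W w ^ 4) / (4 * s ^ 3) = expectation (\<lambda>w. (W w)\<^sup>2 / s - W w ^ 4 / (4 * s ^ 3))"
      using int2 int4 by (simp add: v_def)
    also have "\<dots> \<le> expectation (\<lambda>w. 2 * a + k * (W w)\<^sup>2 + indicator H w / k - W w)"
      using int1 int2 int4 intH
      by (intro integral_mono order_trans[OF low up]) (auto intro!: Bochner_Integration.integrable_diff Bochner_Integration.integrable_add)
    also have "\<dots> = 2 * a + k * v + prob H / k"
      using int1 int2 intH mean by (simp add: v_def prob_space)
    finally have "v / s - expectation (\<lambda>w. W w ^ 4) / (4 * s ^ 3) \<le> 2 * a + k * v + prob H / k" .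
    moreover have "expectation (\<lambda>w. W w ^ 4) / (4 * s ^ 3) \<le> b\<^sup>2 * (\<sigma>\<^sup>2)\<^sup>2 / (4 * s ^ 3)"
      using fourth spos unfolding sq v_def by (intro divide_right_mono) auto
    moreover have "b\<^sup>2 * (\<sigma>\<^sup>2)\<^sup>2 / (4 * s ^ 3) = \<sigma> / (4 * b)"
      unfolding s_def using pos by (simp add: field_simps power2_eq_square power3_eq_cube)
    moreover have "v / s = \<sigma> / b" "k * v = \<sigma> / (4 * b)" "2 * a = \<sigma> / (4 * b)"
      unfolding s_def sq(1)[symmetric] k_def a_def using pos by (simp_all add: field_simps power2_eq_square)
    moreover have "\<sigma> / b = 4 * (\<sigma> / (4 * b))" by simp
    ultimately have "\<sigma> / (4 * b) \<le> prob H / k" by linarith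
    then have "\<sigma> / (4 * b) * k \<le> prob H" using spos by (simp add: field_simps)
    moreover have "\<sigma> / (4 * b) * k = 1 / (16 * B)"
      unfolding k_def sq(2)[symmetric] using pos by (simp add: field_simps power2_eq_square)
    ultimately show ?thesis by (simp add: H_def a_def \<sigma>_def b_def v_def)
  qed
qed

lemma (in prob_space) second_moment_sum_indep:
  fixes W :: "'i \<Rightarrow> 'a \<Rightarrow> real"
  assumes "finite I" "indep_vars (\<lambda>_. borel) W I"
    and "\<And>i. i \<in> I \<Longrightarrow> integrable M (\<lambda>w. (W i w)\<^sup>2)" "\<And>i. i \<in> I \<Longrightarrow> expectation (W i) = 0"
  shows "integrable M (\<lambda>w. (\<Sum>i\<in>I. W i w)\<^sup>2) \<and> expectation (\<lambda>w. \<Sum>i\<in>I. W i w) = 0 \<and>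
    expectation (\<lambda>w. (\<Sum>i\<in>I. W i w)\<^sup>2) = (\<Sum>i\<in>I. expectation (\<lambda>w. (W i w)\<^sup>2))"
  using assms
proof (induction I)
  case (insert i I)
  define S where "S w = (\<Sum>i\<in>I. W i w)" for w
  have rv[measurable]: "random_variable borel (W j)" if "j \<in> insert i I" for j
    using insert.prems(1) that by (auto simp: indep_vars_def)
  then have [measurable]: "random_variable borel S" "random_variable borel (W i)" unfolding S_def by auto
  have "indep_vars (\<lambda>_. borel) W I" by (rule indep_vars_subset[OF insert.prems(1)]) auto
  with insert have IH: "integrable M (\<lambda>w. (S w)\<^sup>2)" "expectation S = 0"
    "expectation (\<lambda>w. (S w)\<^sup>2) = (\<Sum>i\<in>I. expectation (\<lambda>w. (W i w)\<^sup>2))" by (auto simp: S_def[abs_def])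
  have ind: "indep_var borel (W i) borel S" unfolding S_def
    by (rule indep_vars_sum) (use insert in auto)
  have int: "integrable M (W i)" "integrable M S" "integrable M (\<lambda>w. (W i w)\<^sup>2)"
    using square_integrable_imp_integrable[of "W i"] square_integrable_imp_integrable[of S] IH(1) insert.prems by auto
  have cross: "integrable M (\<lambda>w. W i w * S w)" "expectation (\<lambda>w. W i w * S w) = 0"
    using indep_var_integrable[OF ind int(1,2)] indep_var_lebesgue_integral[OF ind int(1,2)] IH(2) by auto
  have eq: "(\<Sum>j\<in>insert i I. W j w) = W i w + S w" for w using insert.hyps by (simp add: S_def)
  have sq: "(W i w + S w)\<^sup>2 = (W i w)\<^sup>2 + 2 * (W i w * S w) + (S w)\<^sup>2" for w
    by (simp add: power2_eq_square algebra_simps)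
  show ?case
    unfolding eq sq using int cross IH insert.hyps insert.prems(3) by simp
qed simp

text \<open>The Gaussian kurtosis \<open>3\<close> is the threshold: the cross term
  \<open>6 * (p * q)\<close> is then at most \<open>2 * B * (p * q)\<close>, which completes the
  square of \<open>p + q\<close>. So the kurtosis bound passes to the sum without loss in the number
  of summands.\<close>

lemma (in prob_space) fourth_moment_sum_indep:
  fixes W :: "'i \<Rightarrow> 'a \<Rightarrow> real"
  assumes "finite I" "indep_vars (\<lambda>_. borel) W I" "3 \<le> B"
    and "\<And>i. i \<in> I \<Longrightarrow> integrable M (\<lambda>w. W i w ^ 4)" "\<And>i. i \<in> I \<Longrightarrow> expectation (W i) = 0"
    and "\<And>i. i \<in> I \<Longrightarrow> expectation (\<lambda>w. W i w ^ 4) \<le> B * (expectation (\<lambda>w. (W i w)\<^sup>2))\<^sup>2"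
  shows "integrable M (\<lambda>w. (\<Sum>i\<in>I. W i w) ^ 4) \<and>
    expectation (\<lambda>w. (\<Sum>i\<in>I. W i w) ^ 4) \<le> B * (expectation (\<lambda>w. (\<Sum>i\<in>I. W i w)\<^sup>2))\<^sup>2"
  using assms
proof (induction I)
  case (insert i I)
  define S where "S w = (\<Sum>i\<in>I. W i w)" for w
  have rv[measurable]: "random_variable borel (W j)" if "j \<in> insert i I" for j
    using insert.prems(1) that by (auto simp: indep_vars_def)
  then have [measurable]: "random_variable borel S" "random_variable borel (W i)" unfolding S_def by auto
  have indI: "indep_vars (\<lambda>_. borel) W I" by (rule indep_vars_subset[OF insert.prems(1)]) auto
  with insert have IH: "integrable M (\<lambda>w. S w ^ 4)"
    "expectation (\<lambda>w. S w ^ 4) \<le> B * (expectation (\<lambda>w. (S w)\<^sup>2))\<^sup>2" by (auto simp: S_def[abs_def])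
  have ind: "indep_var borel (W i) borel S" unfolding S_def
    by (rule indep_vars_sum) (use insert in auto)
  have intW: "integrable M (\<lambda>w. W i w ^ k)" if "k \<le> 4" for k
    using integrable_power_le[of "W i" 4 k] insert.prems(3) that by auto
  have intS: "integrable M (\<lambda>w. S w ^ k)" if "k \<le> 4" for k
    using integrable_power_le[of S 4 k] IH(1) that by auto
  have ind': "indep_var borel (\<lambda>w. W i w ^ k) borel (\<lambda>w. S w ^ l)" for k l
    using indep_var_compose[OF ind, of "\<lambda>x. x ^ k" borel "\<lambda>x. x ^ l" borel] by (simp add: comp_def)
  have cross: "integrable M (\<lambda>w. W i w ^ k * S w ^ l)"
      "expectation (\<lambda>w. W i w ^ k * S w ^ l) = expectation (\<lambda>w. W i w ^ k) * expectation (\<lambda>w. S w ^ l)"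
    if "k \<le> 4" "l \<le> 4" for k l
    using indep_var_integrable[OF ind' intW intS] indep_var_lebesgue_integral[OF ind' intW intS] that by auto
  have "integrable M (\<lambda>w. (W j w)\<^sup>2)" if "j \<in> I" for j
    using integrable_power_le[of "W j" 4 2] insert.prems(3)[of j] rv[of j] that by auto
  then have S0: "expectation S = 0" and W0: "expectation (W i) = 0"
    using second_moment_sum_indep[OF insert.hyps(1) indI] insert.prems(4) unfolding S_def[abs_def] by auto
  have eq: "(\<Sum>j\<in>insert i I. W j w) = W i w + S w" for w using insert.hyps by (simp add: S_def)
  have e4: "(W i w + S w) ^ 4 = W i w ^ 4 + 4 * (W i w ^ 3 * S w ^ 1) + 6 * (W i w ^ 2 * S w ^ 2)
      + 4 * (W i w ^ 1 * S w ^ 3) + S w ^ 4" for w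
    by (simp add: algebra_simps power4_eq_xxxx power3_eq_cube power2_eq_square)
  have e2: "(W i w + S w)\<^sup>2 = W i w ^ 2 + 2 * (W i w ^ 1 * S w ^ 1) + S w ^ 2" for w
    by (simp add: algebra_simps power2_eq_square)
  define p q where "p = expectation (\<lambda>w. W i w ^ 2)" and "q = expectation (\<lambda>w. S w ^ 2)"
  have pq: "0 \<le> p" "0 \<le> q" by (simp_all add: p_def q_def)
  have E4: "expectation (\<lambda>w. (W i w + S w) ^ 4) = expectation (\<lambda>w. W i w ^ 4) + 6 * (p * q) + expectation (\<lambda>w. S w ^ 4)"
    unfolding e4 using cross[of 3 1] cross[of 2 2] cross[of 1 3] intW[of 4] intS[of 4] S0 W0
    by (simp add: p_def q_def)
  have E2: "expectation (\<lambda>w. (W i w + S w)\<^sup>2) = p + q"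
    unfolding e2 using cross[of 1 1] intW[of 2] intS[of 2] S0 W0 by (simp add: p_def q_def)
  have "6 * (p * q) \<le> 2 * B * (p * q)" using pq insert.prems(2) by (intro mult_right_mono) auto
  then have "expectation (\<lambda>w. (W i w + S w) ^ 4) \<le> B * p\<^sup>2 + 2 * B * (p * q) + B * q\<^sup>2"
    unfolding E4 using IH(2) insert.prems(5)[of i] unfolding p_def[symmetric] q_def[symmetric] by auto
  also have "\<dots> = B * (p + q)\<^sup>2" by (simp add: algebra_simps power2_eq_square)
  finally have "expectation (\<lambda>w. (W i w + S w) ^ 4) \<le> B * (expectation (\<lambda>w. (W i w + S w)\<^sup>2))\<^sup>2" unfolding E2 .
  moreover have "integrable M (\<lambda>w. (W i w + S w) ^ 4)"
    unfolding e4 by (intro Bochner_Integration.integrable_add integrable_mult_right cross intW intS) auto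
  ultimately show ?case unfolding eq by simp
qed simp

lemma indep_vars_PiM_coordinate_functions:
  fixes g :: "'i \<Rightarrow> 'b \<Rightarrow> real"
  assumes M: "\<And>i. i \<in> I \<Longrightarrow> prob_space (M i)" and g: "\<And>i. i \<in> I \<Longrightarrow> g i \<in> borel_measurable (M i)"
  shows "prob_space.indep_vars (PiM I M) (\<lambda>_. borel) (\<lambda>i x. g i (x i)) I"
proof -
  interpret P: prob_space "PiM I M" by (rule prob_space_PiM) (rule M)
  show ?thesis
  proof (cases "I = {}")
    case True
    then show ?thesis unfolding P.indep_vars_def P.indep_sets_def by auto
  next
    case False
    have d: "distr (PiM I M) (M i) (\<lambda>x. x i) = M i" if "i \<in> I" for i
      using distr_PiM_component[OF M that] .
    have "distr (PiM I M) (PiM I M) (\<lambda>x. \<lambda>i\<in>I. x i) = distr (PiM I M) (PiM I M) (\<lambda>x. x)"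
      by (intro distr_cong) (auto simp: space_PiM PiE_def extensional_restrict)
    also have "\<dots> = PiM I M" by (rule distr_id)
    also have "\<dots> = PiM I (\<lambda>i. distr (PiM I M) (M i) (\<lambda>x. x i))"
      using d by (intro PiM_cong) auto
    finally have "P.indep_vars M (\<lambda>i x. x i) I"
      by (subst P.indep_vars_iff_distr_eq_PiM'[OF False]) auto
    then show ?thesis by (rule P.indep_vars_compose2) (rule g)
  qed
qed

section \<open>Log-concave densities on the line\<close>

lemma log_concaveD:
  "log_concave f \<Longrightarrow> 0 < t \<Longrightarrow> t < 1 \<Longrightarrow> f x powr t * f y powr (1 - t) \<le> f (t * x + (1 - t) * y)"
  unfolding log_concave_def by blast

text \<open>A weighted geometric mean is at least the smaller of its entries, so log-concavity gives
  quasi-concavity.\<close>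

lemma log_concave_min_le:
  assumes lc: "log_concave f" and nn: "\<And>x. 0 \<le> f x" and z: "min u w \<le> z" "z \<le> max u w"
  shows "min (f u) (f w) \<le> f z"
proof (cases "z = u \<or> z = w")
  case False
  define t where "t = (w - z) / (w - u)"
  have ne: "u \<noteq> w" using z False by (auto simp: min_def max_def split: if_splits)
  have t: "0 < t" "t < 1"
    using z False ne by (auto simp: t_def field_simps min_def max_def split: if_splits)
  have "t * (w - u) = w - z" using ne by (simp add: t_def)
  then have "z = t * u + (1 - t) * w" by (simp add: algebra_simps)
  then have *: "f u powr t * f w powr (1 - t) \<le> f z" using log_concaveD[OF lc t] by simp
  define h where "h = min (f u) (f w)"
  have h: "0 \<le> h" using nn by (simp add: h_def)
  have "h = h powr t * h powr (1 - t)" using h by (cases "h = 0") (simp_all add: powr_add[symmetric])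
  also have "\<dots> \<le> f u powr t * f w powr (1 - t)"
    using h t by (intro mult_mono powr_mono2) (auto simp: h_def)
  finally show ?thesis using * by (simp add: h_def)
qed auto

lemma log_concave_midpoint:
  assumes lc: "log_concave f" and nn: "\<And>x. 0 \<le> f x"
  shows "sqrt (f u * f w) \<le> f ((u + w) / 2)"
  using log_concaveD[OF lc, of "1/2" u w] nn
  by (simp add: powr_half_sqrt real_sqrt_mult field_simps)

locale log_concave_pdf =
  fixes f :: "real \<Rightarrow> real"
  assumes meas[measurable]: "f \<in> borel_measurable borel"
    and nonneg: "0 \<le> f x" and lc: "log_concave f"
    and total: "(\<integral>\<^sup>+x. ennreal (f x) \<partial>lborel) = 1"
begin

lemma mass_bound:
  assumes "0 \<le> h" "\<And>z. min u w \<le> z \<Longrightarrow> z \<le> max u w \<Longrightarrow> h \<le> f z"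
  shows "h * \<bar>w - u\<bar> \<le> 1"
proof -
  have "ennreal (h * \<bar>w - u\<bar>) = ennreal h * ennreal \<bar>w - u\<bar>" using assms by (intro ennreal_mult) auto
  also have "ennreal \<bar>w - u\<bar> = emeasure lborel {min u w..max u w}" by (simp add: min_def max_def)
  also have "ennreal h * \<dots> = (\<integral>\<^sup>+x. ennreal h * indicator {min u w..max u w} x \<partial>lborel)"
    by (simp add: nn_integral_cmult_indicator)
  also have "\<dots> \<le> (\<integral>\<^sup>+x. ennreal (f x) \<partial>lborel)"
    using assms by (intro nn_integral_mono) (auto split: split_indicator intro: ennreal_leI)
  finally show ?thesis using total by simp
qed

text \<open>Let \<open>s\<close> be the geometric mean of \<open>f a\<close> and \<open>f y\<close>.
  If \<open>f y\<close> exceeds \<open>f a\<close>, then \<open>s\<close> bounds \<open>f\<close>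
  from below at the midpoint and at \<open>y\<close>, hence between them, and total mass
  \<open>1\<close> on that stretch bounds \<open>s\<close> and with it \<open>f y\<close>.\<close>

lemma bounded_aux:
  assumes "0 < f a" "0 < d" "d \<le> \<bar>y - a\<bar>"
  shows "f y \<le> max (f a) (4 / (d\<^sup>2 * f a))"
proof (cases "f y \<le> f a")
  case False
  define s where "s = sqrt (f a * f y)"
  have s: "0 \<le> s" using nonneg by (simp add: s_def)
  have "s \<le> sqrt (f y * f y)" unfolding s_def using False nonneg[of y] by (intro real_sqrt_le_mono mult_right_mono) auto
  then have "s \<le> f y" using nonneg by simp
  moreover have "s \<le> f ((a + y) / 2)" unfolding s_def by (rule log_concave_midpoint[OF lc nonneg])
  ultimately have "s \<le> f z" if "min ((a + y) / 2) y \<le> z" "z \<le> max ((a + y) / 2) y" for z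
    using log_concave_min_le[OF lc nonneg that] by linarith
  then have "s * \<bar>y - (a + y) / 2\<bar> \<le> 1" by (rule mass_bound[OF s])
  moreover have "\<bar>y - (a + y) / 2\<bar> = \<bar>y - a\<bar> / 2" by (simp add: field_simps abs_if)
  moreover have "s * (d / 2) \<le> s * (\<bar>y - a\<bar> / 2)" using assms s by (intro mult_left_mono) auto
  ultimately have "s * (d / 2) \<le> 1" by simp
  then have "(s * (d / 2))\<^sup>2 \<le> 1" using s assms by (intro power_le_one) auto
  then have "f a * f y * d\<^sup>2 \<le> 4" using assms nonneg by (simp add: s_def power_mult_distrib power_divide)
  then have "f y \<le> 4 / (d\<^sup>2 * f a)" using assms by (simp add: field_simps)
  then show ?thesis by simp
qed simp

lemma bounded: "\<exists>H. \<forall>x. f x \<le> H"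
proof -
  \<comment> \<open>Two base points, because \<open>bounded_aux\<close> says nothing near its base
    point; a density positive at one point at most would integrate to zero.\<close>
  have "\<exists>a b. a < b \<and> 0 < f a \<and> 0 < f b"
  proof (rule ccontr)
    assume no: "\<not> ?thesis"
    have "\<exists>c. \<forall>x. x \<noteq> c \<longrightarrow> f x = 0"
    proof (cases "\<exists>c. 0 < f c")
      case True
      then obtain c where "0 < f c" ..
      have "f x = 0" if "x \<noteq> c" for x
      proof (rule ccontr)
        assume "f x \<noteq> 0"
        then have "0 < f x" using nonneg[of x] by simp
        with \<open>0 < f c\<close> no that show False by (metis less_linear)
      qed
      then show ?thesis by blast
    next
      case False
      then show ?thesis using nonneg by (metis less_eq_real_def)
    qed
    then obtain c where "\<And>x. x \<noteq> c \<Longrightarrow> f x = 0" by blast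
    then have "AE x in lborel. ennreal (f x) = 0"
      using AE_lborel_singleton[of c] by (auto elim: AE_mp)
    then have "(\<integral>\<^sup>+x. ennreal (f x) \<partial>lborel) = 0" by (subst nn_integral_0_iff_AE) auto
    with total show False by simp
  qed
  then obtain a b where ab: "a < b" "0 < f a" "0 < f b" by blast
  define d where "d = (b - a) / 2"
  have d: "0 < d" using ab by (simp add: d_def)
  have "f y \<le> max (max (f a) (4 / (d\<^sup>2 * f a))) (max (f b) (4 / (d\<^sup>2 * f b)))" for y
  proof (cases "d \<le> \<bar>y - a\<bar>")
    case True
    then show ?thesis using bounded_aux[OF ab(2) d, of y] by (meson max.coboundedI1)
  next
    case False
    then have "d \<le> \<bar>y - b\<bar>" unfolding d_def by argo
    then show ?thesis using bounded_aux[OF ab(3) d, of y] by (meson max.coboundedI2)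
  qed
  then show ?thesis by blast
qed

text \<open>The point \<open>m\<close> nearly maximises \<open>f\<close>, and \<open>r = 3 / f m\<close>: if \<open>f (m \<plusminus> r) > f m / e\<close>, then
  \<open>f\<close> would have mass at least \<open>3 / e > 1\<close>.\<close>

lemma exponential_decay: "\<exists>m r. 0 < r \<and> (\<forall>y. f y \<le> 17 / r * exp (- \<bar>y - m\<bar> / r))"
proof -
  define M where "M = (SUP x. f x)"
  have bdd: "bdd_above (range f)" using bounded by (auto intro: bdd_aboveI2)
  have le: "f x \<le> M" for x unfolding M_def using bdd by (intro cSUP_upper) auto
  have "0 < M"
  proof (rule ccontr)
    assume "\<not> 0 < M"
    then have "f x = 0" for x using le[of x] nonneg[of x] by linarith
    with total show False by simp
  qed
  then have "M / 2 < (SUP x. f x)" by (simp add: M_def)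
  then obtain m where m: "M / 2 < f m" using bdd by (subst (asm) less_cSUP_iff) auto
  have fm: "0 < f m" using m \<open>0 < M\<close> by simp
  define r where "r = 3 / f m"
  have r: "0 < r" using fm by (simp add: r_def)
  have e3: "exp 1 < (3::real)" using exp_le by (rule order_le_neq_trans) (use e_less_272 in simp)
  have small: "f (m + s) \<le> f m / exp 1" if s: "\<bar>s\<bar> = r" for s
  proof (rule ccontr)
    assume c: "\<not> ?thesis"
    have "f m / exp 1 \<le> f m" using fm by (simp add: field_simps)
    then have "f m / exp 1 \<le> f z" if "min m (m + s) \<le> z" "z \<le> max m (m + s)" for z
      using log_concave_min_le[OF lc nonneg that] c by linarith
    then have "f m / exp 1 * \<bar>m + s - m\<bar> \<le> 1" using fm by (intro mass_bound) auto
    then have "3 / exp 1 \<le> (1::real)" using s fm by (simp add: r_def)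
    then show False using e3 by (simp add: field_simps)
  qed
  have far: "f y \<le> f m * exp (- \<bar>y - m\<bar> / r)" if y: "r \<le> \<bar>y - m\<bar>" for y
  proof (cases "f y = 0 \<or> \<bar>y - m\<bar> = r")
    case True
    then show ?thesis
    proof
      assume "\<bar>y - m\<bar> = r"
      then show ?thesis using small[of "y - m"] r by (simp add: exp_minus field_simps)
    qed (use fm in simp)
  next
    case False
    then have fy: "0 < f y" using nonneg[of y] by simp
    \<comment> \<open>The weight that gives the point at distance \<open>r\<close> from
      \<open>m\<close> towards \<open>y\<close>, where \<open>small\<close> applies; log-concavity
      along this ray then forces a factor \<open>1 / e\<close> per length \<open>r\<close>.\<close>
    define t where "t = r / \<bar>y - m\<bar>"
    have t: "0 < t" "t < 1" using y False r by (auto simp: t_def field_simps)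
    have "t * y + (1 - t) * m = m + t * (y - m)" by (simp add: algebra_simps)
    moreover have "\<bar>t * (y - m)\<bar> = r" using r t y by (simp add: t_def abs_mult)
    ultimately have "f y powr t * f m powr (1 - t) \<le> f m / exp 1"
      using log_concaveD[OF lc t, of y m] small[of "t * (y - m)"] by simp
    then have "ln (f y powr t * f m powr (1 - t)) \<le> ln (f m / exp 1)"
      using fy fm by (subst ln_le_cancel_iff) auto
    then have "t * ln (f y) + (1 - t) * ln (f m) \<le> ln (f m) - 1"
      using fy fm by (simp add: ln_mult ln_powr ln_div)
    then have "t * (ln (f y) - ln (f m)) \<le> - 1" by (simp add: algebra_simps)
    then have "ln (f y) - ln (f m) \<le> - 1 / t" using t by (simp add: field_simps)
    then have "ln (f y) \<le> ln (f m) - \<bar>y - m\<bar> / r" using r y by (simp add: t_def)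
    then have "exp (ln (f y)) \<le> exp (ln (f m) - \<bar>y - m\<bar> / r)" by simp
    then show ?thesis using fy fm by (simp add: exp_diff exp_minus divide_inverse)
  qed
  \<comment> \<open>Closer than \<open>r\<close> to \<open>m\<close>, \<open>f\<close> is at most
    \<open>2 * f m\<close>, that is \<open>6 / r\<close>, and the exponential is at least
    \<open>1 / e\<close>; the constant \<open>17\<close> covers \<open>6 * e\<close>.\<close>
  have e6: "6 * exp 1 \<le> (17::real)" using e_less_272 by simp
  have "f y \<le> 17 / r * exp (- \<bar>y - m\<bar> / r)" for y
  proof (cases "r \<le> \<bar>y - m\<bar>")
    case True
    have "f m \<le> 17 / r" using fm by (simp add: r_def)
    then show ?thesis using far[OF True] by (meson exp_ge_zero mult_right_mono order_trans)
  next
    case False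
    then have "exp (- 1) \<le> exp (- \<bar>y - m\<bar> / r)" using r by (simp add: field_simps)
    then have "17 / r * exp (- 1) \<le> 17 / r * exp (- \<bar>y - m\<bar> / r)" using r by (intro mult_left_mono) auto
    moreover have "f y \<le> 2 * f m" using le[of y] m by linarith
    moreover have "2 * f m \<le> 17 / r * exp (- 1)" using e6 fm by (simp add: r_def exp_minus field_simps)
    ultimately show ?thesis by linarith
  qed
  with r show ?thesis by blast
qed

end

section \<open>Scale, moments and tilts of log-concave laws\<close>

lemma nn_integral_exp_abs_le:
  assumes l: "0 < l"
  shows "(\<integral>\<^sup>+y. ennreal (exp (- l * \<bar>y - m\<bar>)) \<partial>lborel) \<le> ennreal (2 / l)"
proof -
  interpret E: prob_space "density lborel (exponential_density l)"
    by (rule prob_space_exponential_density[OF l])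
  have E1: "(\<integral>\<^sup>+y. ennreal (exponential_density l y) \<partial>lborel) = 1"
    using E.emeasure_space_1 by (simp add: emeasure_density)
  have E2: "(\<integral>\<^sup>+y. ennreal (exponential_density l (- y)) \<partial>lborel) = 1"
    using nn_integral_real_affine[of "\<lambda>y. ennreal (exponential_density l y)" "-1" 0] E1 by simp
  have "(\<integral>\<^sup>+y. ennreal (exp (- l * \<bar>y - m\<bar>)) \<partial>lborel) = (\<integral>\<^sup>+y. ennreal (exp (- l * \<bar>y\<bar>)) \<partial>lborel)"
    using nn_integral_real_affine[of "\<lambda>y. ennreal (exp (- l * \<bar>y - m\<bar>))" 1 m] by simp
  also have "\<dots> \<le> (\<integral>\<^sup>+y. ennreal (1 / l) * (ennreal (exponential_density l y) + ennreal (exponential_density l (- y))) \<partial>lborel)"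
  proof (rule nn_integral_mono)
    fix y :: real
    have "exp (- l * \<bar>y\<bar>) \<le> 1 / l * (exponential_density l y + exponential_density l (- y))"
      using l by (auto simp: exponential_density_def field_simps)
    then show "ennreal (exp (- l * \<bar>y\<bar>)) \<le> ennreal (1 / l) * (ennreal (exponential_density l y) + ennreal (exponential_density l (- y)))"
      using l by (simp add: ennreal_mult[symmetric] ennreal_plus[symmetric] exponential_density_def ennreal_leI del: ennreal_plus)
  qed
  also have "\<dots> = ennreal (2 / l)"
    using l by (simp add: nn_integral_cmult nn_integral_add E1 E2 ennreal_mult[symmetric]
        ennreal_numeral[symmetric] del: ennreal_numeral)
  finally show ?thesis .
qed

text \<open>One location \<open>m\<close> and one scale \<open>r\<close> describe the law:
  exponential decay gives the moment bound \<open>17 / r * (4 * r) = 68\<close>, and the height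
  bound \<open>17 / r\<close> keeps the mass within \<open>r / 68\<close> of any point at most
  \<open>1 / 2\<close>.\<close>

lemma log_concave_law_scale:
  assumes "has_log_concave_density N"
  obtains m r where "0 < r" "integrable N (\<lambda>y. exp (\<bar>y - m\<bar> / (2 * r)))"
    "(\<integral>y. exp (\<bar>y - m\<bar> / (2 * r)) \<partial>N) \<le> 68"
    "\<And>x. 1 / 2 \<le> measure N {y. r / 68 < \<bar>y - x\<bar>}"
proof -
  interpret N: prob_space N using assms by (simp add: has_log_concave_density_def)
  obtain f where f: "f \<in> borel_measurable borel" "\<And>x. 0 \<le> f x" "log_concave f"
    and N: "N = density lborel (\<lambda>x. ennreal (f x))"
    using assms by (auto simp: has_log_concave_density_def)
  note f(1)[measurable]
  interpret log_concave_pdf f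
  proof
    show "(\<integral>\<^sup>+x. ennreal (f x) \<partial>lborel) = 1"
      using N.emeasure_space_1 unfolding N by (simp add: emeasure_density)
  qed (use f in auto)
  obtain m r where r: "0 < r" and dec: "\<And>y. f y \<le> 17 / r * exp (- \<bar>y - m\<bar> / r)"
    using exponential_decay by blast
  have sets_N[simp, measurable_cong]: "sets N = sets borel" unfolding N by simp
  have "(\<integral>\<^sup>+y. ennreal (exp (\<bar>y - m\<bar> / (2 * r))) \<partial>N) = (\<integral>\<^sup>+y. ennreal (f y) * ennreal (exp (\<bar>y - m\<bar> / (2 * r))) \<partial>lborel)"
    unfolding N by (subst nn_integral_density) auto
  also have "\<dots> \<le> (\<integral>\<^sup>+y. ennreal (17 / r) * ennreal (exp (- (1 / (2 * r)) * \<bar>y - m\<bar>)) \<partial>lborel)"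
  proof (rule nn_integral_mono)
    fix y
    have "f y * exp (\<bar>y - m\<bar> / (2 * r)) \<le> 17 / r * exp (- \<bar>y - m\<bar> / r) * exp (\<bar>y - m\<bar> / (2 * r))"
      using dec[of y] by (intro mult_right_mono) auto
    also have "\<dots> = 17 / r * exp (- \<bar>y - m\<bar> / r + \<bar>y - m\<bar> / (2 * r))" by (simp only: exp_add mult.assoc)
    also have "- \<bar>y - m\<bar> / r + \<bar>y - m\<bar> / (2 * r) = - (1 / (2 * r)) * \<bar>y - m\<bar>" using r by (simp add: field_simps)
    finally show "ennreal (f y) * ennreal (exp (\<bar>y - m\<bar> / (2 * r))) \<le> ennreal (17 / r) * ennreal (exp (- (1 / (2 * r)) * \<bar>y - m\<bar>))"
      using f(2) r by (simp add: ennreal_mult[symmetric] ennreal_leI)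
  qed
  also have "\<dots> = ennreal (17 / r) * (\<integral>\<^sup>+y. ennreal (exp (- (1 / (2 * r)) * \<bar>y - m\<bar>)) \<partial>lborel)"
    by (rule nn_integral_cmult) measurable
  also have "\<dots> \<le> ennreal (17 / r) * ennreal (2 / (1 / (2 * r)))"
    using r by (intro mult_left_mono nn_integral_exp_abs_le) auto
  also have "\<dots> = ennreal 68" using r by (simp add: ennreal_mult[symmetric])
  finally have nn: "(\<integral>\<^sup>+y. ennreal (exp (\<bar>y - m\<bar> / (2 * r))) \<partial>N) \<le> ennreal 68" .
  have int: "integrable N (\<lambda>y. exp (\<bar>y - m\<bar> / (2 * r)))"
  proof (rule integrableI_bounded)
    show "(\<integral>\<^sup>+y. ennreal (norm (exp (\<bar>y - m\<bar> / (2 * r)))) \<partial>N) < \<infinity>"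
      using le_less_trans[OF nn ennreal_less_top] by simp
  qed measurable
  have I: "(\<integral>y. exp (\<bar>y - m\<bar> / (2 * r)) \<partial>N) \<le> 68"
    using nn nn_integral_eq_integral[OF int] by (subst (asm) nn_integral_eq_integral[OF int]) (auto simp del: ennreal_numeral)
  have conc: "1 / 2 \<le> measure N {y. r / 68 < \<bar>y - x\<bar>}" for x
  proof -
    have "emeasure N {y. \<bar>y - x\<bar> \<le> r / 68} = (\<integral>\<^sup>+y. ennreal (f y) * indicator {y. \<bar>y - x\<bar> \<le> r / 68} y \<partial>lborel)"
      unfolding N by (subst emeasure_density) auto
    also have "\<dots> \<le> (\<integral>\<^sup>+y. ennreal (17 / r) * indicator {x - r / 68..x + r / 68} y \<partial>lborel)"
    proof (rule nn_integral_mono)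
      fix y
      have "exp (- \<bar>y - m\<bar> / r) \<le> 1" using r by simp
      then have "17 / r * exp (- \<bar>y - m\<bar> / r) \<le> 17 / r * 1" using r by (intro mult_left_mono) auto
      then have "f y \<le> 17 / r" using dec[of y] by simp
      then show "ennreal (f y) * indicator {y. \<bar>y - x\<bar> \<le> r / 68} y \<le> ennreal (17 / r) * indicator {x - r / 68..x + r / 68} y"
        using r by (auto split: split_indicator intro!: ennreal_leI simp: abs_le_iff field_simps)
    qed
    also have "\<dots> = ennreal (17 / r) * ennreal (r / 34)"
      using r by (simp add: nn_integral_cmult_indicator)
    also have "\<dots> = ennreal (1 / 2)" using r by (simp add: ennreal_mult[symmetric])
    finally have "ennreal (measure N {y. \<bar>y - x\<bar> \<le> r / 68}) \<le> ennreal (1 / 2)"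
      by (simp only: N.emeasure_eq_measure)
    then have "measure N {y. \<bar>y - x\<bar> \<le> r / 68} \<le> 1 / 2" by (subst (asm) ennreal_le_iff) auto
    moreover have "measure N {y\<in>space N. \<not> \<bar>y - x\<bar> \<le> r / 68} = 1 - measure N {y\<in>space N. \<bar>y - x\<bar> \<le> r / 68}"
      by (rule N.prob_neg) measurable
    moreover have "space N = UNIV" unfolding N by simp
    ultimately show ?thesis by (simp add: not_le)
  qed
  show thesis by (rule that[OF r int I conc])
qed

lemma exp_le_quadratic: "exp u \<le> 1 + u + u\<^sup>2 * exp \<bar>u\<bar>" for u :: real
proof -
  obtain t where t: "\<bar>t\<bar> \<le> \<bar>u\<bar>" "exp u = (\<Sum>m<2. u ^ m / fact m) + exp t / fact 2 * u ^ 2"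
    using Maclaurin_exp_le[of u 2] by blast
  have "exp t \<le> exp \<bar>u\<bar>" using t(1) by simp
  then have "exp t / 2 \<le> exp \<bar>u\<bar>" using exp_gt_zero[of t] by linarith
  then have "exp t / 2 * u\<^sup>2 \<le> exp \<bar>u\<bar> * u\<^sup>2" by (rule mult_right_mono) simp
  then show ?thesis using t(2) by (simp add: numeral_2_eq_2 mult.commute)
qed

text \<open>A second-order expansion of the generating function at \<open>0\<close> with explicit
  remainder. Half of the exponent \<open>a\<close> absorbs \<open>\<bar>s * V\<bar>\<close>, the
  other half absorbs \<open>V\<^sup>2\<close>; the factor \<open>8 / a\<^sup>2\<close> is
  \<open>u\<^sup>2 / 2 \<le> exp u\<close> at \<open>u = a / 2 * \<bar>V\<bar>\<close>.\<close>

lemma (in prob_space) mgf_le_quadratic: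
  fixes V :: "'a \<Rightarrow> real"
  assumes [measurable]: "random_variable borel V" and a: "0 < a"
    and int: "integrable M (\<lambda>w. exp (a * \<bar>V w\<bar>))" and s: "\<bar>s\<bar> \<le> a / 2"
  shows "integrable M (\<lambda>w. exp (s * V w))" "integrable M V"
    "expectation (\<lambda>w. exp (s * V w)) \<le> 1 + s * expectation V + s\<^sup>2 * (8 / a\<^sup>2 * expectation (\<lambda>w. exp (a * \<bar>V w\<bar>)))"
proof -
  have sV: "\<bar>s * V w\<bar> \<le> a / 2 * \<bar>V w\<bar>" for w
    using mult_right_mono[OF s, of "\<bar>V w\<bar>"] by (simp add: abs_mult)
  show i1: "integrable M (\<lambda>w. exp (s * V w))"
  proof (rule Bochner_Integration.integrable_bound[OF int])
    show "AE w in M. norm (exp (s * V w)) \<le> norm (exp (a * \<bar>V w\<bar>))"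
    proof (rule AE_I2)
      fix w
      have "s * V w \<le> a * \<bar>V w\<bar>" using sV[of w] a mult_nonneg_nonneg[of a "\<bar>V w\<bar>"] by linarith
      then show "norm (exp (s * V w)) \<le> norm (exp (a * \<bar>V w\<bar>))" by simp
    qed
  qed measurable
  show i2: "integrable M V"
  proof (rule Bochner_Integration.integrable_bound[of _ "\<lambda>w. 1 / a * exp (a * \<bar>V w\<bar>)"])
    show "AE w in M. norm (V w) \<le> norm (1 / a * exp (a * \<bar>V w\<bar>))"
    proof (rule AE_I2)
      fix w
      have "a * \<bar>V w\<bar> \<le> exp (a * \<bar>V w\<bar>)" using exp_ge_add_one_self[of "a * \<bar>V w\<bar>"] by linarith
      then show "norm (V w) \<le> norm (1 / a * exp (a * \<bar>V w\<bar>))" using a by (simp add: field_simps)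
    qed
  qed (use int in auto)
  have pt: "exp (s * V w) \<le> 1 + s * V w + s\<^sup>2 * (8 / a\<^sup>2 * exp (a * \<bar>V w\<bar>))" for w
  proof -
    have "(a / 2 * \<bar>V w\<bar>)\<^sup>2 / 2 \<le> exp (a / 2 * \<bar>V w\<bar>)"
    proof -
      have "0 \<le> a / 2 * \<bar>V w\<bar>" using a by simp
      with exp_lower_Taylor_quadratic[OF this] show ?thesis by linarith
    qed
    then have "(V w)\<^sup>2 \<le> 8 / a\<^sup>2 * exp (a / 2 * \<bar>V w\<bar>)"
      using a by (simp add: field_simps power2_eq_square)
    then have "(V w)\<^sup>2 * exp \<bar>s * V w\<bar> \<le> 8 / a\<^sup>2 * exp (a / 2 * \<bar>V w\<bar>) * exp (a / 2 * \<bar>V w\<bar>)"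
      using sV[of w] by (intro mult_mono) auto
    also have "\<dots> = 8 / a\<^sup>2 * exp (a * \<bar>V w\<bar>)" by (simp add: exp_add[symmetric])
    finally have "s\<^sup>2 * ((V w)\<^sup>2 * exp \<bar>s * V w\<bar>) \<le> s\<^sup>2 * (8 / a\<^sup>2 * exp (a * \<bar>V w\<bar>))"
      by (intro mult_left_mono) auto
    then show ?thesis using exp_le_quadratic[of "s * V w"] by (simp add: power_mult_distrib mult.assoc)
  qed
  have "expectation (\<lambda>w. exp (s * V w)) \<le> expectation (\<lambda>w. 1 + s * V w + s\<^sup>2 * (8 / a\<^sup>2 * exp (a * \<bar>V w\<bar>)))"
    using i1 i2 int pt by (intro integral_mono) auto
  also have "\<dots> = 1 + s * expectation V + s\<^sup>2 * (8 / a\<^sup>2 * expectation (\<lambda>w. exp (a * \<bar>V w\<bar>)))"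
    using i2 int by (simp add: prob_space)
  finally show "expectation (\<lambda>w. exp (s * V w)) \<le> 1 + s * expectation V + s\<^sup>2 * (8 / a\<^sup>2 * expectation (\<lambda>w. exp (a * \<bar>V w\<bar>)))" .
qed

text \<open>The factors come from \<open>(y - x) ^ 4 \<le> 1024 r ^ 4 exp (\<bar>y - x\<bar> / (2 r))\<close>, from the bound
  \<open>68 exp 68\<close> on the mean of that exponential, and from the variance being at least
  \<open>r\<^sup>2 / 9248\<close>.\<close>

definition kurt :: real where "kurt = 1024 * (68 * exp 68) * 9248\<^sup>2"

lemma kurt_ge: "3 \<le> kurt"
proof -
  have "(1::real) \<le> exp 68" by simp
  moreover have "kurt = 5955311894528 * exp 68" by (simp add: kurt_def)
  ultimately show ?thesis by linarith
qed

lemma log_concave_law_space: "has_log_concave_density N \<Longrightarrow> space N = UNIV"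
  and log_concave_law_sets: "has_log_concave_density N \<Longrightarrow> sets N = sets borel"
  by (auto simp: has_log_concave_density_def)

text \<open>Recentres \<open>log_concave_law_scale\<close> at the mean, which lies within
  \<open>136 * r\<close> of \<open>m\<close>; this costs the factor \<open>exp 68\<close>. The
  fourth moment is at most a multiple of \<open>r ^ 4\<close> and the variance at least a multiple
  of \<open>r\<^sup>2\<close>, so the scale cancels in the kurtosis.\<close>

lemma log_concave_law_moments:
  assumes N: "has_log_concave_density N"
  defines "x \<equiv> \<integral>y. y \<partial>N"
  obtains r where "0 < r" "integrable N (\<lambda>y. exp (1 / (2 * r) * \<bar>y - x\<bar>))"
    "(\<integral>y. exp (1 / (2 * r) * \<bar>y - x\<bar>) \<partial>N) \<le> 68 * exp 68"
    "integrable N (\<lambda>y. (y - x) ^ 4)"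
    "(\<integral>y. (y - x) ^ 4 \<partial>N) \<le> kurt * (\<integral>y. (y - x)\<^sup>2 \<partial>N)\<^sup>2"
    "r / 136 \<le> (\<integral>y. \<bar>y - x\<bar> \<partial>N)"
proof -
  interpret N: prob_space N using N by (simp add: has_log_concave_density_def)
  have sN[measurable_cong]: "sets N = sets borel" by (rule log_concave_law_sets[OF N])
  obtain m r where r: "0 < r" and int: "integrable N (\<lambda>y. exp (\<bar>y - m\<bar> / (2 * r)))"
    and le: "(\<integral>y. exp (\<bar>y - m\<bar> / (2 * r)) \<partial>N) \<le> 68"
    and conc: "\<And>x. 1 / 2 \<le> measure N {y. r / 68 < \<bar>y - x\<bar>}"
    using log_concave_law_scale[OF N] by blast
  have intm: "integrable N (\<lambda>y. y - m)"
    by (rule N.mgf_le_quadratic(2)[of _ "1 / (2 * r)" 0]) (use int r in auto)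
  have inty: "integrable N (\<lambda>y. y)"
    using Bochner_Integration.integrable_add[OF intm, of "\<lambda>_. m"] by simp
  have "\<bar>x - m\<bar> = \<bar>\<integral>y. y - m \<partial>N\<bar>" unfolding x_def using inty by (simp add: N.prob_space)
  also have "\<dots> \<le> (\<integral>y. \<bar>y - m\<bar> \<partial>N)" by (rule integral_abs_bound)
  also have "\<dots> \<le> (\<integral>y. 2 * r * exp (\<bar>y - m\<bar> / (2 * r)) \<partial>N)"
  proof (rule integral_mono)
    fix y :: real
    have "\<bar>y - m\<bar> / (2 * r) \<le> exp (\<bar>y - m\<bar> / (2 * r))"
      using exp_ge_add_one_self[of "\<bar>y - m\<bar> / (2 * r)"] by linarith
    then show "\<bar>y - m\<bar> \<le> 2 * r * exp (\<bar>y - m\<bar> / (2 * r))" using r by (simp add: field_simps)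
  qed (use intm int in auto)
  also have "\<dots> \<le> 2 * r * 68" using le r by simp
  finally have xm: "\<bar>x - m\<bar> / (2 * r) \<le> 68" using r by (simp add: field_simps)
  define g where "g y = exp (1 / (2 * r) * \<bar>y - x\<bar>)" for y
  have g_le: "g y \<le> exp 68 * exp (\<bar>y - m\<bar> / (2 * r))" for y
  proof -
    have "\<bar>y - x\<bar> / (2 * r) \<le> \<bar>y - m\<bar> / (2 * r) + \<bar>x - m\<bar> / (2 * r)"
      unfolding add_divide_distrib[symmetric] using r by (intro divide_right_mono) auto
    then have "1 / (2 * r) * \<bar>y - x\<bar> \<le> 68 + \<bar>y - m\<bar> / (2 * r)" using xm by simp
    then show ?thesis unfolding g_def exp_add[symmetric] by simp
  qed
  have intg: "integrable N g"
  proof (rule Bochner_Integration.integrable_bound)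
    show "integrable N (\<lambda>y. exp 68 * exp (\<bar>y - m\<bar> / (2 * r)))" using int by simp
    show "AE y in N. norm (g y) \<le> norm (exp 68 * exp (\<bar>y - m\<bar> / (2 * r)))"
      using g_le by (intro AE_I2) (simp add: g_def)
  qed (simp add: g_def[abs_def])
  have "(\<integral>y. g y \<partial>N) \<le> (\<integral>y. exp 68 * exp (\<bar>y - m\<bar> / (2 * r)) \<partial>N)"
    using int intg g_le by (intro integral_mono) auto
  also have "\<dots> \<le> exp 68 * 68" using le by simp
  finally have Ig: "(\<integral>y. g y \<partial>N) \<le> 68 * exp 68" by simp
  have g4: "(y - x) ^ 4 \<le> 1024 * r ^ 4 * g y" for y
  proof -
    define u where "u = 1 / (2 * r) * \<bar>y - x\<bar>"
    have u: "0 \<le> u" using r by (simp add: u_def)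
    have "2 * r * u = \<bar>y - x\<bar>" using r by (simp add: u_def)
    then have "(y - x) ^ 4 = (2 * r * u) ^ 4" by simp
    then have y4: "(y - x) ^ 4 = 16 * r ^ 4 * u ^ 4" by (simp add: power_mult_distrib)
    have "(u / 2)\<^sup>2 / 2 \<le> exp (u / 2)" using exp_lower_Taylor_quadratic[of "u / 2"] u by linarith
    then have "((u / 2)\<^sup>2 / 2)\<^sup>2 \<le> (exp (u / 2))\<^sup>2" by (intro power_mono) auto
    then have "u ^ 4 \<le> 64 * exp u"
      by (simp add: power_divide power2_eq_square exp_add[symmetric] power4_eq_xxxx)
    then have "16 * r ^ 4 * u ^ 4 \<le> 16 * r ^ 4 * (64 * exp u)" by (intro mult_left_mono) auto
    then show ?thesis using y4 by (simp add: g_def u_def)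
  qed
  have int4: "integrable N (\<lambda>y. (y - x) ^ 4)"
  proof (rule Bochner_Integration.integrable_bound)
    show "integrable N (\<lambda>y. 1024 * r ^ 4 * g y)" using intg by simp
    show "AE y in N. norm ((y - x) ^ 4) \<le> norm (1024 * r ^ 4 * g y)"
      using g4 by (intro AE_I2) (simp add: g_def)
  qed simp
  have "(\<integral>y. (y - x) ^ 4 \<partial>N) \<le> (\<integral>y. 1024 * r ^ 4 * g y \<partial>N)"
    using int4 intg g4 by (intro integral_mono) auto
  also have "\<dots> \<le> 1024 * r ^ 4 * (68 * exp 68)" using mult_left_mono[OF Ig, of "1024 * r ^ 4"] by simp
  finally have I4: "(\<integral>y. (y - x) ^ 4 \<partial>N) \<le> 1024 * r ^ 4 * (68 * exp 68)" .
  define H where "H = {y. r / 68 < \<bar>y - x\<bar>}"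
  have H[measurable]: "H \<in> sets N" unfolding H_def sN by measurable
  have intH: "integrable N (indicator H :: real \<Rightarrow> real)" by (simp add: N.emeasure_eq_measure)
  have PH: "1 / 2 \<le> measure N H" using conc by (simp add: H_def)
  have int2: "integrable N (\<lambda>y. (y - x)\<^sup>2)" by (rule N.integrable_power_le[OF _ int4]) auto
  have "(r / 68)\<^sup>2 * (1 / 2) \<le> (r / 68)\<^sup>2 * measure N H" using PH by (intro mult_left_mono) auto
  also have "\<dots> = (\<integral>y. (r / 68)\<^sup>2 * indicator H y \<partial>N)" by simp
  also have "\<dots> \<le> (\<integral>y. (y - x)\<^sup>2 \<partial>N)"
  proof (intro integral_mono)
    fix y
    show "(r / 68)\<^sup>2 * indicator H y \<le> (y - x)\<^sup>2"
    proof (cases "y \<in> H")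
      case True
      then have "(r / 68)\<^sup>2 \<le> \<bar>y - x\<bar>\<^sup>2" using r by (intro power_mono) (auto simp: H_def)
      then show ?thesis using True by simp
    qed simp
  qed (use int2 intH in auto)
  finally have "r\<^sup>2 / 9248 \<le> (\<integral>y. (y - x)\<^sup>2 \<partial>N)" by (simp add: power_divide)
  then have "(r\<^sup>2 / 9248)\<^sup>2 \<le> (\<integral>y. (y - x)\<^sup>2 \<partial>N)\<^sup>2" by (intro power_mono) auto
  then have "kurt * (r\<^sup>2 / 9248)\<^sup>2 \<le> kurt * (\<integral>y. (y - x)\<^sup>2 \<partial>N)\<^sup>2" using kurt_ge by (intro mult_left_mono) auto
  moreover have "kurt * (r\<^sup>2 / 9248)\<^sup>2 = 1024 * r ^ 4 * (68 * exp 68)"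
    by (simp add: kurt_def power_divide flip: power_mult)
  ultimately have K: "(\<integral>y. (y - x) ^ 4 \<partial>N) \<le> kurt * (\<integral>y. (y - x)\<^sup>2 \<partial>N)\<^sup>2" using I4 by linarith
  have "r / 68 * (1 / 2) \<le> r / 68 * measure N H" using PH r by (intro mult_left_mono) auto
  also have "\<dots> = (\<integral>y. r / 68 * indicator H y \<partial>N)" by simp
  also have "\<dots> \<le> (\<integral>y. \<bar>y - x\<bar> \<partial>N)"
  proof (intro integral_mono)
    show "integrable N (\<lambda>y. \<bar>y - x\<bar>)" using inty by auto
  qed (use intH in \<open>auto simp: H_def split: split_indicator\<close>)
  finally have "r / 136 \<le> (\<integral>y. \<bar>y - x\<bar> \<partial>N)" by simp
  with r intg Ig int4 K show thesis unfolding g_def by (rule that)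
qed

lemma log_concave_exp_mult:
  assumes lc: "log_concave f" and nn: "\<And>x. 0 \<le> f x"
  shows "log_concave (\<lambda>y. f y * exp (\<xi> * (y - a) + b))"
  unfolding log_concave_def
proof (intro allI impI)
  fix x y t :: real assume t: "0 < t \<and> t < 1"
  have e: "(c * exp u) powr s = c powr s * exp (s * u)" if "0 \<le> c" for c u s :: real
    using that by (simp add: powr_mult) (simp add: powr_def)
  have "(f x * exp (\<xi> * (x - a) + b)) powr t * (f y * exp (\<xi> * (y - a) + b)) powr (1 - t)
    = (f x powr t * f y powr (1 - t)) * exp (t * (\<xi> * (x - a) + b) + (1 - t) * (\<xi> * (y - a) + b))"
    unfolding e[OF nn] by (simp only: exp_add mult_ac)
  also have "t * (\<xi> * (x - a) + b) + (1 - t) * (\<xi> * (y - a) + b) = \<xi> * (t * x + (1 - t) * y - a) + b"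
    by (simp add: algebra_simps)
  also have "(f x powr t * f y powr (1 - t)) * exp (\<xi> * (t * x + (1 - t) * y - a) + b)
      \<le> f (t * x + (1 - t) * y) * exp (\<xi> * (t * x + (1 - t) * y - a) + b)"
    using log_concaveD[OF lc, of t x y] t by (intro mult_right_mono) auto
  finally show "(f x * exp (\<xi> * (x - a) + b)) powr t * (f y * exp (\<xi> * (y - a) + b)) powr (1 - t)
    \<le> f (t * x + (1 - t) * y) * exp (\<xi> * (t * x + (1 - t) * y - a) + b)" .
qed

text \<open>Tilting multiplies the density by a log-affine factor, so the bounds for log-concave
  laws hold for tilted laws with the same absolute constants, however large \<open>\<xi>\<close>
  is.\<close>

lemma has_log_concave_density_tilt:
  assumes N: "has_log_concave_density N" and one: "(\<integral>\<^sup>+y. ennreal (exp (\<xi> * (y - a) + b)) \<partial>N) = 1"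
  shows "has_log_concave_density (density N (\<lambda>y. ennreal (exp (\<xi> * (y - a) + b))))"
proof -
  obtain f where f: "f \<in> borel_measurable borel" "\<And>x. 0 \<le> f x" "log_concave f"
    and Nf: "N = density lborel (\<lambda>x. ennreal (f x))"
    using N by (auto simp: has_log_concave_density_def)
  note f(1)[measurable]
  have sN[measurable_cong]: "sets N = sets borel" by (rule log_concave_law_sets[OF N])
  have "prob_space (density N (\<lambda>y. ennreal (exp (\<xi> * (y - a) + b))))"
    by (rule prob_spaceI) (simp add: emeasure_density one cong: nn_integral_cong)
  moreover have "density N (\<lambda>y. ennreal (exp (\<xi> * (y - a) + b))) =
      density lborel (\<lambda>y. ennreal (f y * exp (\<xi> * (y - a) + b)))"
    unfolding Nf by (subst density_density_eq) (auto simp: ennreal_mult f(2))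
  moreover have "log_concave (\<lambda>y. f y * exp (\<xi> * (y - a) + b))"
    by (rule log_concave_exp_mult[OF f(3,2)])
  ultimately show ?thesis unfolding has_log_concave_density_def using f(2)
    by (intro conjI exI[of _ "\<lambda>y. f y * exp (\<xi> * (y - a) + b)"]) auto
qed

text \<open>Centring at \<open>x\<close> absorbs the linear term: minus the logarithm is the
  expression maximised in the Legendre transform at \<open>x\<close>. Values lie in
  \<open>ennreal\<close> since the integral may diverge.\<close>

definition mgf_at :: "real measure \<Rightarrow> real \<Rightarrow> real \<Rightarrow> ennreal" where
  "mgf_at N x \<xi> = (\<integral>\<^sup>+y. ennreal (exp (\<xi> * (y - x))) \<partial>N)"

text \<open>The one-dimensional Legendre transform \<open>\<Lambda>\<^sup>*\<close>, in multiplicative form.\<close>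

definition rate :: "real measure \<Rightarrow> real \<Rightarrow> real" where
  "rate N x = - ln (enn2real (INF \<xi>. mgf_at N x \<xi>))"

text \<open>Chernoff's bound with an offset \<open>\<eta>\<close>. Offset \<open>0\<close> compares
  the transform with the tails at \<open>x\<close>; a positive offset makes the function grow in
  \<open>\<xi>\<close>, which yields a minimiser.\<close>

lemma mgf_at_ge_tail:
  assumes sN[measurable_cong]: "sets N = sets borel"
  shows "0 \<le> \<xi> \<Longrightarrow> 0 \<le> \<eta> \<Longrightarrow> ennreal (exp (\<xi> * \<eta>)) * emeasure N {x + \<eta>..} \<le> mgf_at N x \<xi>"
    and "\<xi> \<le> 0 \<Longrightarrow> 0 \<le> \<eta> \<Longrightarrow> ennreal (exp (- \<xi> * \<eta>)) * emeasure N {..x - \<eta>} \<le> mgf_at N x \<xi>"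
proof -
  assume h: "0 \<le> \<xi>" "0 \<le> \<eta>"
  have "ennreal (exp (\<xi> * \<eta>)) * emeasure N {x + \<eta>..} = (\<integral>\<^sup>+y. ennreal (exp (\<xi> * \<eta>)) * indicator {x + \<eta>..} y \<partial>N)"
    by (subst nn_integral_cmult_indicator) (auto simp: sN)
  also have "\<dots> \<le> mgf_at N x \<xi>" unfolding mgf_at_def
    using h by (intro nn_integral_mono) (auto split: split_indicator intro!: ennreal_leI mult_left_mono)
  finally show "ennreal (exp (\<xi> * \<eta>)) * emeasure N {x + \<eta>..} \<le> mgf_at N x \<xi>" .
next
  assume h: "\<xi> \<le> 0" "0 \<le> \<eta>"
  have "ennreal (exp (- \<xi> * \<eta>)) * emeasure N {..x - \<eta>} = (\<integral>\<^sup>+y. ennreal (exp (- \<xi> * \<eta>)) * indicator {..x - \<eta>} y \<partial>N)"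
    by (subst nn_integral_cmult_indicator) (auto simp: sN)
  also have "\<dots> \<le> mgf_at N x \<xi>" unfolding mgf_at_def
  proof (intro nn_integral_mono)
    fix y
    have "- \<xi> * \<eta> \<le> \<xi> * (y - x)" if "y \<le> x - \<eta>"
      using mult_left_mono[of \<eta> "x - y" "- \<xi>"] h that by (simp add: algebra_simps)
    then show "ennreal (exp (- \<xi> * \<eta>)) * indicator {..x - \<eta>} y \<le> ennreal (exp (\<xi> * (y - x)))"
      by (auto split: split_indicator intro!: ennreal_leI)
  qed
  finally show "ennreal (exp (- \<xi> * \<eta>)) * emeasure N {..x - \<eta>} \<le> mgf_at N x \<xi>" .
qed

lemma mgf_at_zero: "prob_space N \<Longrightarrow> mgf_at N x 0 = 1"
  unfolding mgf_at_def by (simp add: prob_space.emeasure_space_1)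

text \<open>Direct method: mass on both sides of \<open>x\<close> at positive distance makes
  \<open>mgf_at N x\<close> grow exponentially in both directions, so minimising sequences are
  bounded. Fatou's lemma supplies lower semicontinuity, which survives where the function becomes
  infinite.\<close>

lemma mgf_at_minimiser:
  assumes N: "prob_space N" and sN[measurable_cong]: "sets N = sets borel"
    and up: "emeasure N {x<..} > 0" and down: "emeasure N {..<x} > 0"
  shows "\<exists>\<xi>. mgf_at N x \<xi> = (INF \<xi>. mgf_at N x \<xi>)"
proof -
  define I where "I = (INF \<xi>. mgf_at N x \<xi>)"
  have "\<exists>k::nat. emeasure N {x + 1 / Suc k..} \<noteq> 0"
  proof (rule ccontr)
    assume "\<not> ?thesis"
    then have "emeasure N (\<Union>k. {x + 1 / Suc k..}) = 0" by (intro emeasure_UN_eq_0) (auto simp: sN)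
    moreover have "{x<..} \<subseteq> (\<Union>k. {x + 1 / Suc k..})"
    proof
      fix y assume "y \<in> {x<..}"
      then obtain k :: nat where "1 / Suc k < y - x" using nat_approx_posE[of "y - x"] by auto
      then show "y \<in> (\<Union>k. {x + 1 / Suc k..})" by (auto intro!: exI[of _ k])
    qed
    then have "emeasure N {x<..} \<le> emeasure N (\<Union>k. {x + 1 / Suc k..})" by (intro emeasure_mono) (auto simp: sN)
    ultimately show False using up by simp
  qed
  then obtain k :: nat where k: "emeasure N {x + 1 / Suc k..} \<noteq> 0" ..
  have "\<exists>k::nat. emeasure N {..x - 1 / Suc k} \<noteq> 0"
  proof (rule ccontr)
    assume "\<not> ?thesis"
    then have "emeasure N (\<Union>k. {..x - 1 / Suc k}) = 0" by (intro emeasure_UN_eq_0) (auto simp: sN)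
    moreover have "{..<x} \<subseteq> (\<Union>k. {..x - 1 / Suc k})"
    proof
      fix y assume "y \<in> {..<x}"
      then obtain k :: nat where "1 / Suc k < x - y" using nat_approx_posE[of "x - y"] by auto
      then show "y \<in> (\<Union>k. {..x - 1 / Suc k})" by (auto intro!: exI[of _ k])
    qed
    then have "emeasure N {..<x} \<le> emeasure N (\<Union>k. {..x - 1 / Suc k})" by (intro emeasure_mono) (auto simp: sN)
    ultimately show False using down by simp
  qed
  then obtain l :: nat where l: "emeasure N {..x - 1 / Suc l} \<noteq> 0" ..
  interpret N: prob_space N by (rule N)
  define p where "p = min (measure N {x + 1 / Suc k..}) (measure N {..x - 1 / Suc l})"
  define \<eta> where "\<eta> = min (1 / real (Suc k)) (1 / real (Suc l))"
  have p: "0 < p" using k l unfolding p_def by (simp add: N.emeasure_eq_measure zero_less_measure_iff)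
  have eta: "0 < \<eta>" by (simp add: \<eta>_def)
  have growth: "ennreal (exp (\<bar>\<xi>\<bar> * \<eta>) * p) \<le> mgf_at N x \<xi>" for \<xi>
  proof (cases "0 \<le> \<xi>")
    case True
    have "exp (\<xi> * \<eta>) * p \<le> exp (\<xi> * (1 / Suc k)) * measure N {x + 1 / Suc k..}"
    proof (rule mult_mono)
      have "\<xi> * \<eta> \<le> \<xi> * (1 / Suc k)" using True unfolding \<eta>_def by (intro mult_left_mono) auto
      then show "exp (\<xi> * \<eta>) \<le> exp (\<xi> * (1 / Suc k))" by simp
    qed (use p in \<open>auto simp: p_def\<close>)
    then have "ennreal (exp (\<xi> * \<eta>) * p) \<le> ennreal (exp (\<xi> * (1 / Suc k))) * emeasure N {x + 1 / Suc k..}"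
      by (simp add: N.emeasure_eq_measure ennreal_mult[symmetric] ennreal_leI)
    also have "\<dots> \<le> mgf_at N x \<xi>" by (rule mgf_at_ge_tail(1)[OF sN True]) simp
    finally show ?thesis using True by simp
  next
    case False
    have "exp (- \<xi> * \<eta>) * p \<le> exp (- \<xi> * (1 / Suc l)) * measure N {..x - 1 / Suc l}"
    proof (rule mult_mono)
      have "- \<xi> * \<eta> \<le> - \<xi> * (1 / Suc l)" using False unfolding \<eta>_def by (intro mult_left_mono) auto
      then show "exp (- \<xi> * \<eta>) \<le> exp (- \<xi> * (1 / Suc l))" by simp
    qed (use p in \<open>auto simp: p_def\<close>)
    then have "ennreal (exp (- \<xi> * \<eta>) * p) \<le> ennreal (exp (- \<xi> * (1 / Suc l))) * emeasure N {..x - 1 / Suc l}"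
      by (simp add: N.emeasure_eq_measure ennreal_mult[symmetric] ennreal_leI)
    also have "\<dots> \<le> mgf_at N x \<xi>" using False by (intro mgf_at_ge_tail(2)[OF sN]) auto
    finally show ?thesis using False by simp
  qed
  obtain h :: "nat \<Rightarrow> ennreal" where h: "decseq h" "range h \<subseteq> range (mgf_at N x)" "I = (INF i. h i)"
    using ennreal_Inf_countable_INF[of "range (mgf_at N x)"] by (auto simp: I_def)
  then have "\<forall>i. \<exists>\<xi>. h i = mgf_at N x \<xi>" by blast
  then obtain z where z: "\<And>i. h i = mgf_at N x (z i)" by metis
  have lim: "h \<longlonglongrightarrow> I" using LIMSEQ_INF[OF h(1)] h(3) by simp
  have "I \<le> mgf_at N x 0" unfolding I_def by (rule INF_lower) simp
  \<comment> \<open>\<open>2\<close> is merely a finite level above the value \<open>1\<close> at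
    parameter \<open>0\<close>; staying below it confines the sequence \<open>z\<close> to a bounded
    interval.\<close>
  then have "I < 2" using mgf_at_zero[OF N] by (simp add: le_less_trans[of _ 1])
  then have "eventually (\<lambda>i. h i < 2) sequentially" using lim by (intro order_tendstoD(2))
  then obtain i0 where i0: "\<And>i. i0 \<le> i \<Longrightarrow> h i < 2" by (auto simp: eventually_sequentially)
  define R where "R = ln (2 / p) / \<eta>"
  have "\<bar>z i\<bar> \<le> R" if "i0 \<le> i" for i
  proof -
    have "ennreal (exp (\<bar>z i\<bar> * \<eta>) * p) \<le> ennreal 2"
      using growth[of "z i"] i0[OF that] z[of i] by simp
    then have "exp (\<bar>z i\<bar> * \<eta>) * p \<le> 2" by (subst (asm) ennreal_le_iff) auto
    then have "exp (\<bar>z i\<bar> * \<eta>) \<le> 2 / p" using p by (simp add: field_simps)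
    then have "\<bar>z i\<bar> * \<eta> \<le> ln (2 / p)" using p by (subst ln_ge_iff) auto
    then show ?thesis using eta by (simp add: R_def field_simps)
  qed
  then have "\<bar>z (i + i0)\<bar> \<le> R" for i by simp
  then have "\<forall>i. z (i + i0) \<in> {- R..R}" by (simp add: abs_le_iff minus_le_iff)
  moreover have "seq_compact {- R..R}" by (intro compact_imp_seq_compact compact_Icc)
  ultimately obtain \<xi> \<rho> where \<rho>: "strict_mono (\<rho> :: nat \<Rightarrow> nat)" "((\<lambda>i. z (i + i0)) \<circ> \<rho>) \<longlonglongrightarrow> \<xi>"
    using seq_compactE[of "{- R..R}" "\<lambda>i. z (i + i0)"] by metis
  define w where "w i = z (\<rho> i + i0)" for i
  have w: "w \<longlonglongrightarrow> \<xi>" using \<rho>(2) by (simp add: w_def[abs_def] comp_def)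
  have "filterlim (\<lambda>i. \<rho> i + i0) at_top sequentially"
    using filterlim_subseq[OF \<rho>(1)] by (rule filterlim_at_top_mono) simp
  then have lim': "(\<lambda>i. mgf_at N x (w i)) \<longlonglongrightarrow> I"
    using filterlim_compose[OF lim] by (simp add: w_def z[symmetric])
  have "mgf_at N x \<xi> = (\<integral>\<^sup>+y. liminf (\<lambda>i. ennreal (exp (w i * (y - x)))) \<partial>N)"
    unfolding mgf_at_def
  proof (intro nn_integral_cong)
    fix y
    have "(\<lambda>i. ennreal (exp (w i * (y - x)))) \<longlonglongrightarrow> ennreal (exp (\<xi> * (y - x)))"
      by (intro tendsto_ennrealI tendsto_intros w)
    then show "ennreal (exp (\<xi> * (y - x))) = liminf (\<lambda>i. ennreal (exp (w i * (y - x))))"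
      by (intro lim_imp_Liminf[symmetric]) auto
  qed
  also have "\<dots> \<le> liminf (\<lambda>i. mgf_at N x (w i))"
    unfolding mgf_at_def by (rule nn_integral_liminf) measurable
  also have "\<dots> = I" using lim' by (intro lim_imp_Liminf) auto
  finally have "mgf_at N x \<xi> \<le> I" .
  moreover have "I \<le> mgf_at N x \<xi>" unfolding I_def by (rule INF_lower) simp
  ultimately show ?thesis unfolding I_def by (metis antisym)
qed

section \<open>Tilting a law to a prescribed mean\<close>

text \<open>The tail is monotone, so a nonempty such set is a ray or the whole line. It need not
  contain its left end, hence the exhaustion by closed rays with endpoints in the set: each has mass
  at most \<open>t\<close>, and continuity from below passes this to the union.\<close>

lemma prob_upper_tail_small:
  fixes N :: "real measure"
  assumes N: "prob_space N" and sN: "sets N = sets borel"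
  shows "{x. measure N {x..} \<le> t} \<in> sets borel" and "0 \<le> t \<Longrightarrow> measure N {x. measure N {x..} \<le> t} \<le> t"
proof -
  interpret N: prob_space N by (rule N)
  define A where "A = {x. measure N {x..} \<le> t}"
  have up: "y \<in> A" if "x \<in> A" "x \<le> y" for x y
  proof -
    have "measure N {y..} \<le> measure N {x..}" using that by (intro N.finite_measure_mono) (auto simp: sN)
    then show ?thesis using that(1) by (simp add: A_def)
  qed
  have "\<exists>u. decseq u \<and> range u \<subseteq> A \<and> A = (\<Union>k::nat. {u k..})" if ne: "A \<noteq> {}"
  proof (cases "bdd_below A")
    case True
    define a where "a = Inf A"
    have le: "a \<le> x" if "x \<in> A" for x unfolding a_def using that True by (rule cInf_lower)
    show ?thesis
    proof (cases "a \<in> A")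
      case True
      then have "A = {a..}" using le up by auto
      then show ?thesis by (intro exI[of _ "\<lambda>_. a"]) (auto simp: decseq_def)
    next
      case False
      define u where "u k = a + 1 / real (Suc k)" for k
      have "u k \<in> A" for k
      proof -
        have "Inf A < u k" by (simp add: u_def a_def)
        then obtain x where "x \<in> A" "x < u k" using ne True cInf_less_iff by metis
        then show ?thesis using up by (meson less_imp_le)
      qed
      moreover have "decseq u" unfolding u_def decseq_def by (auto intro!: divide_left_mono)
      moreover have "x \<in> (\<Union>k. {u k..})" if "x \<in> A" for x
      proof -
        have "a < x" using le[OF that] that False by (metis less_eq_real_def)
        then obtain k :: nat where "1 / Suc k < x - a" using nat_approx_posE[of "x - a"] by auto
        then show ?thesis by (auto simp: u_def intro!: exI[of _ k])
      qed
      ultimately show ?thesis using up by (intro exI[of _ u]) auto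
    qed
  next
    case False
    have all: "x \<in> A" for x
    proof -
      obtain y where "y \<in> A" "\<not> x \<le> y" using False unfolding bdd_below_def by blast
      then show ?thesis using up by (meson linear)
    qed
    have "x \<in> (\<Union>k::nat. {- real k..})" for x
    proof -
      obtain k :: nat where "- x \<le> real k" using real_arch_simple by blast
      then show ?thesis by (auto intro!: exI[of _ k])
    qed
    then show ?thesis using all by (intro exI[of _ "\<lambda>k. - real k"]) (auto simp: decseq_def)
  qed
  then have *: "A \<noteq> {} \<Longrightarrow> \<exists>u. decseq u \<and> range u \<subseteq> A \<and> A = (\<Union>k::nat. {u k..})" .
  show "{x. measure N {x..} \<le> t} \<in> sets borel"
  proof (cases "A = {}")
    case False
    then obtain u :: "nat \<Rightarrow> real" where u: "A = (\<Union>k. {u k..})" using * by blast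
    have "A \<in> sets borel" unfolding u by measurable
    then show ?thesis by (simp add: A_def)
  qed (simp add: A_def)
  assume t: "0 \<le> t"
  have "measure N A \<le> t"
  proof (cases "A = {}")
    case False
    then obtain u :: "nat \<Rightarrow> real" where u: "decseq u" "range u \<subseteq> A" "A = (\<Union>k. {u k..})" using * by blast
    have inc: "incseq (\<lambda>k. {u k..})" using u(1) by (auto simp: incseq_def decseq_def intro: order_trans)
    have "(\<lambda>k. measure N {u k..}) \<longlonglongrightarrow> measure N (\<Union>k. {u k..})"
      using inc by (intro N.finite_Lim_measure_incseq) (auto simp: sN)
    moreover have "measure N {u k..} \<le> t" for k using u(2) by (auto simp: A_def)
    ultimately show ?thesis unfolding u(3) by (intro LIMSEQ_le_const2) auto
  qed (use t in simp)
  then show "measure N {x. measure N {x..} \<le> t} \<le> t" by (simp add: A_def)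
qed

lemma prob_lower_tail_small:
  fixes N :: "real measure"
  assumes N: "prob_space N" and sN[measurable_cong]: "sets N = sets borel"
  shows "{x. measure N {..x} \<le> t} \<in> sets borel" and "0 \<le> t \<Longrightarrow> measure N {x. measure N {..x} \<le> t} \<le> t"
proof -
  interpret N: prob_space N by (rule N)
  define N' where "N' = distr N borel uminus"
  have N': "prob_space N'" unfolding N'_def by (rule N.prob_space_distr) measurable
  have sp: "space N = UNIV" using sets_eq_imp_space_eq[OF sN] by simp
  have m: "measure N' B = measure N (uminus -` B)" if "B \<in> sets borel" for B
    unfolding N'_def using that by (subst measure_distr) (auto simp: sp)
  have tail: "measure N' {x..} = measure N {..- x}" for x
  proof -
    have "uminus -` {x..} = {..- x}" by auto
    then show ?thesis by (simp add: m)
  qed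
  define A where "A = {x. measure N' {x..} \<le> t}"
  have A: "A \<in> sets borel" unfolding A_def by (rule prob_upper_tail_small[OF N']) (simp add: N'_def)
  have eq: "uminus -` A = {x. measure N {..x} \<le> t}" unfolding A_def tail by auto
  have "uminus -` A \<in> sets borel"
    using measurable_sets[of uminus "borel :: real measure" borel A] A by simp
  then show "{x. measure N {..x} \<le> t} \<in> sets borel" by (simp add: eq)
  assume "0 \<le> t"
  then have "measure N' A \<le> t" unfolding A_def by (intro prob_upper_tail_small[OF N']) (simp_all add: N'_def)
  then show "measure N {x. measure N {..x} \<le> t} \<le> t" using m[OF A] eq by simp
qed

text \<open>The tail lemmas at level \<open>0\<close>: almost no point has a null closed tail. The
  law has no atoms, so the open tails have the same mass.\<close>

lemma AE_tails_positive:
  assumes N: "has_log_concave_density N"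
  shows "AE x in N. 0 < emeasure N {x<..} \<and> 0 < emeasure N {..<x}"
proof -
  interpret N: prob_space N using N by (simp add: has_log_concave_density_def)
  have P: "prob_space N" by (rule N.prob_space_axioms)
  have sN[measurable_cong]: "sets N = sets borel" and sp: "space N = UNIV"
    using N log_concave_law_space log_concave_law_sets by auto
  obtain f where f: "f \<in> borel_measurable borel" "N = density lborel (\<lambda>x. ennreal (f x))"
    using N by (auto simp: has_log_concave_density_def)
  have "absolutely_continuous lborel N" unfolding f(2) using f(1)
    by (intro absolutely_continuousI_density) measurable
  moreover have "{x} \<in> null_sets lborel" for x :: real
    by (simp add: null_sets_def)
  ultimately have nul: "{x} \<in> null_sets N" for x unfolding absolutely_continuous_def by blast
  have e1: "emeasure N {x..} = emeasure N {x<..}" for x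
  proof -
    have "{x..} = {x<..} \<union> {x}" by auto
    then show ?thesis using emeasure_Un_null_set[of "{x<..}" N "{x}"] nul by (simp add: sN)
  qed
  have e2: "emeasure N {..x} = emeasure N {..<x}" for x
  proof -
    have "{..x} = {..<x} \<union> {x}" by auto
    then show ?thesis using emeasure_Un_null_set[of "{..<x}" N "{x}"] nul by (simp add: sN)
  qed
  have "measure N {x. measure N {x..} \<le> 0} \<le> 0" by (rule prob_upper_tail_small(2)[OF P sN]) simp
  then have "measure N {x. measure N {x..} \<le> 0} = 0" by (rule antisym) (rule measure_nonneg)
  then have "emeasure N {x. measure N {x..} \<le> 0} = 0" by (simp only: N.emeasure_eq_measure ennreal_0)
  moreover have "measure N {x. measure N {..x} \<le> 0} \<le> 0" by (rule prob_lower_tail_small(2)[OF P sN]) simp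
  then have "measure N {x. measure N {..x} \<le> 0} = 0" by (rule antisym) (rule measure_nonneg)
  then have "emeasure N {x. measure N {..x} \<le> 0} = 0" by (simp only: N.emeasure_eq_measure ennreal_0)
  ultimately have z: "emeasure N {x. measure N {x..} \<le> 0} = 0" "emeasure N {x. measure N {..x} \<le> 0} = 0" by auto
  have "AE x in N. \<not> measure N {x..} \<le> 0"
    by (rule AE_I[OF _ z(1)]) (use prob_upper_tail_small(1)[OF P sN, of 0] in \<open>auto simp: sN\<close>)
  moreover have "AE x in N. \<not> measure N {..x} \<le> 0"
    by (rule AE_I[OF _ z(2)]) (use prob_lower_tail_small(1)[OF P sN, of 0] in \<open>auto simp: sN\<close>)
  ultimately show ?thesis
  proof eventually_elim
    case (elim x)
    then have "0 < emeasure N {x..}" "0 < emeasure N {..x}"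
      unfolding N.emeasure_eq_measure by auto
    then show ?case using e1 e2 by simp
  qed
qed

text \<open>First-order condition without differentiating under an integral: for a small
  perturbation of sign opposite to \<open>v\<close> the linear term would beat the quadratic
  one.\<close>

lemma quadratic_lower_bound_imp_zero:
  fixes v K d :: real
  assumes "0 < d" "0 \<le> K" and le: "\<And>s. \<bar>s\<bar> \<le> d \<Longrightarrow> 0 \<le> s * v + s\<^sup>2 * K"
  shows "v = 0"
proof (rule ccontr)
  assume v: "v \<noteq> 0"
  \<comment> \<open>The quotient makes \<open>q * K\<close> too small to compensate
    \<open>\<bar>v\<bar>\<close>; the summand \<open>1\<close> keeps \<open>q\<close> positive when
    \<open>K = 0\<close>.\<close>
  define q where "q = min d (\<bar>v\<bar> / (2 * K + 1))"
  have q: "0 < q" "q \<le> d" "q \<le> \<bar>v\<bar> / (2 * K + 1)" using assms v by (auto simp: q_def)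
  have "\<bar>- sgn v * q\<bar> \<le> d" using q v by (simp add: abs_mult sgn_if)
  then have "0 \<le> (- sgn v * q) * v + (- sgn v * q)\<^sup>2 * K" by (rule le)
  also have "(- sgn v * q)\<^sup>2 = q\<^sup>2" using v by (simp add: sgn_if)
  also have "(- sgn v * q) * v = - (q * \<bar>v\<bar>)" using v by (simp add: sgn_if abs_if)
  finally have "q * \<bar>v\<bar> \<le> q * (q * K)" by (simp add: power2_eq_square mult.assoc)
  then have 1: "\<bar>v\<bar> \<le> q * K" using q(1) by (simp only: mult_le_cancel_left_pos)
  have "q * (2 * K + 1) \<le> \<bar>v\<bar>" using q(3) assms(2) by (simp add: field_simps)
  moreover have "0 \<le> q * K" using q assms by simp
  ultimately have "2 * (q * K) + q \<le> q * K" using 1 by (simp add: algebra_simps)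
  then show False using q \<open>0 \<le> q * K\<close> by linarith
qed

text \<open>The Paley-Zygmund threshold \<open>sqrt (\<xi>\<^sup>2 * v) / (8 * sqrt kurt)\<close> is
  shown to be at most \<open>ln (16 * kurt) * (1 + L)\<close>; squaring and solving for
  \<open>\<xi>\<^sup>2 * v\<close> gives this constant.\<close>

definition tilt_const :: real where "tilt_const = 64 * kurt * (ln (16 * kurt))\<^sup>2"

text \<open>\<open>\<xi>\<close> tilts the law \<open>N\<close> to one with mean \<open>x\<close>; equivalently \<open>\<Lambda>\<^sup>*(x) = x \<xi> - \<Lambda>(\<xi>)\<close>.\<close>

definition centring_tilt :: "real measure \<Rightarrow> real \<Rightarrow> real \<Rightarrow> bool" where
  "centring_tilt N x \<xi> \<longleftrightarrow>
    (let L = rate N x; T = density N (\<lambda>y. ennreal (exp (\<xi> * (y - x) + L))) in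
      0 \<le> L \<and> mgf_at N x \<xi> = ennreal (exp (- L)) \<and> (\<forall>\<zeta>. ennreal (exp (- L)) \<le> mgf_at N x \<zeta>) \<and>
      prob_space T \<and> integrable T (\<lambda>y. (y - x) ^ 4) \<and> (\<integral>y. y - x \<partial>T) = 0 \<and>
      (\<integral>y. (y - x) ^ 4 \<partial>T) \<le> kurt * (\<integral>y. (y - x)\<^sup>2 \<partial>T)\<^sup>2 \<and>
      \<xi>\<^sup>2 * (\<integral>y. (y - x)\<^sup>2 \<partial>T) \<le> tilt_const * (1 + L)\<^sup>2)"

text \<open>The tilt is the minimiser of \<open>mgf_at N x\<close>. A priori it might lie on the
  boundary of the domain of finiteness, but the tilted law is again log-concave and so has
  exponential moments: the generating function is finite on both sides of \<open>\<xi>\<close>, and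
  minimality forces the tilted mean to be \<open>x\<close>.\<close>

lemma centring_tilt_exists:
  assumes N: "has_log_concave_density N"
    and pos: "0 < emeasure N {x<..}" "0 < emeasure N {..<x}"
  shows "\<exists>\<xi>. centring_tilt N x \<xi>"
proof -
  interpret N: prob_space N using N by (simp add: has_log_concave_density_def)
  have sN[measurable_cong]: "sets N = sets borel" and sp: "space N = UNIV"
    using N log_concave_law_space log_concave_law_sets by auto
  obtain \<xi> where xi: "mgf_at N x \<xi> = (INF \<xi>. mgf_at N x \<xi>)"
    using mgf_at_minimiser[OF N.prob_space_axioms sN pos] by blast
  define I where "I = (INF \<xi>. mgf_at N x \<xi>)"
  have I_le: "I \<le> mgf_at N x \<zeta>" for \<zeta> unfolding I_def by (rule INF_lower) simp
  have I1: "I \<le> 1" using I_le[of 0] mgf_at_zero[OF N.prob_space_axioms] by simp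
  have I0: "I \<noteq> 0"
  proof
    assume "I = 0"
    then have "mgf_at N x \<xi> = 0" using xi by (simp add: I_def)
    then have "AE y in N. False" unfolding mgf_at_def by (subst (asm) nn_integral_0_iff_AE) auto
    then show False by simp
  qed
  define L where "L = rate N x"
  have fin: "I < \<top>" using le_less_trans[OF I1] by simp
  have Ir: "0 < enn2real I" "enn2real I \<le> 1"
    using I0 I1 fin by (auto simp: enn2real_positive_iff zero_less_iff_neq_zero intro: enn2real_leI)
  have eL: "exp (- L) = enn2real I" using Ir by (simp add: L_def rate_def I_def[symmetric])
  have L0: "0 \<le> L" using Ir by (simp add: L_def rate_def I_def[symmetric] ln_le_zero_iff)
  have IL: "I = ennreal (exp (- L))" unfolding eL using fin by simp
  define g where "g y = exp (\<xi> * (y - x) + L)" for y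
  define T where "T = density N (\<lambda>y. ennreal (g y))"
  have [measurable]: "g \<in> borel_measurable borel" unfolding g_def[abs_def] by measurable
  \<comment> \<open>Exponential moments of \<open>T\<close> are those of \<open>N\<close> with
    shifted parameter, so minimality at \<open>\<xi>\<close> for \<open>N\<close> becomes minimality
    at \<open>0\<close> for \<open>T\<close>.\<close>
  have nnT: "(\<integral>\<^sup>+y. ennreal (exp (s * (y - x))) \<partial>T) = ennreal (exp L) * mgf_at N x (s + \<xi>)" for s
  proof -
    have "(\<integral>\<^sup>+y. ennreal (exp (s * (y - x))) \<partial>T) = (\<integral>\<^sup>+y. ennreal (g y) * ennreal (exp (s * (y - x))) \<partial>N)"
      unfolding T_def by (subst nn_integral_density) auto
    also have "\<dots> = (\<integral>\<^sup>+y. ennreal (exp L) * ennreal (exp ((s + \<xi>) * (y - x))) \<partial>N)"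
      by (intro nn_integral_cong)
        (simp add: g_def ennreal_mult[symmetric] exp_add[symmetric] algebra_simps)
    also have "\<dots> = ennreal (exp L) * mgf_at N x (s + \<xi>)"
      unfolding mgf_at_def by (rule nn_integral_cmult) measurable
    finally show ?thesis .
  qed
  have LL: "ennreal (exp L) * ennreal (exp (- L)) = 1" by (simp add: ennreal_mult[symmetric] exp_add[symmetric])
  have "(\<integral>\<^sup>+y. ennreal (g y) \<partial>N) = (\<integral>\<^sup>+y. ennreal (exp (0 * (y - x))) \<partial>T)"
    unfolding T_def by (subst nn_integral_density) auto
  also have "\<dots> = 1" unfolding nnT using xi by (simp add: I_def[symmetric] IL LL)
  finally have one: "(\<integral>\<^sup>+y. ennreal (exp (\<xi> * (y - x) + L)) \<partial>N) = 1" by (simp add: g_def)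
  have T: "has_log_concave_density T" unfolding T_def g_def by (rule has_log_concave_density_tilt[OF N one])
  interpret T: prob_space T using T by (simp add: has_log_concave_density_def)
  have sT[measurable_cong]: "sets T = sets borel" by (rule log_concave_law_sets[OF T])
  obtain r where r: "0 < r" and ie0: "integrable T (\<lambda>y. exp (1 / (2 * r) * \<bar>y - (\<integral>y. y \<partial>T)\<bar>))"
    and i4: "integrable T (\<lambda>y. (y - (\<integral>y. y \<partial>T)) ^ 4)"
    and k4: "(\<integral>y. (y - (\<integral>y. y \<partial>T)) ^ 4 \<partial>T) \<le> kurt * (\<integral>y. (y - (\<integral>y. y \<partial>T))\<^sup>2 \<partial>T)\<^sup>2"
    using log_concave_law_moments[OF T] by blast
  define a where "a = 1 / (2 * r)"
  have a: "0 < a" using r by (simp add: a_def)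
  define m where "m = (\<integral>y. y \<partial>T)"
  have ie: "integrable T (\<lambda>y. exp (a * \<bar>y - x\<bar>))"
  proof (rule Bochner_Integration.integrable_bound)
    show "integrable T (\<lambda>y. exp (a * \<bar>m - x\<bar>) * exp (a * \<bar>y - m\<bar>))"
      using ie0 by (simp add: a_def m_def)
    have "exp (a * \<bar>y - x\<bar>) \<le> exp (a * \<bar>m - x\<bar>) * exp (a * \<bar>y - m\<bar>)" for y
    proof -
      have "a * \<bar>y - x\<bar> \<le> a * (\<bar>m - x\<bar> + \<bar>y - m\<bar>)" using a by (intro mult_left_mono) auto
      then show ?thesis unfolding exp_add[symmetric] by (simp add: algebra_simps)
    qed
    then show "AE y in T. norm (exp (a * \<bar>y - x\<bar>)) \<le> norm (exp (a * \<bar>m - x\<bar>) * exp (a * \<bar>y - m\<bar>))"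
      by (intro AE_I2) simp
  qed measurable
  have intV: "integrable T (\<lambda>y. y - x)"
    by (rule T.mgf_le_quadratic(2)[of _ a 0]) (use a ie in auto)
  have EV: "(\<integral>y. y - x \<partial>T) = 0"
  proof (rule quadratic_lower_bound_imp_zero)
    show "0 < a / 2" using a by simp
    show "0 \<le> 8 / a\<^sup>2 * (\<integral>y. exp (a * \<bar>y - x\<bar>) \<partial>T)" by simp
    fix s assume s: "\<bar>s\<bar> \<le> a / 2"
    have i: "integrable T (\<lambda>y. exp (s * (y - x)))"
      by (rule T.mgf_le_quadratic(1)[of _ a]) (use a ie s in auto)
    have "1 \<le> ennreal (exp L) * mgf_at N x (s + \<xi>)"
      using mult_left_mono[OF I_le[of "s + \<xi>"], of "ennreal (exp L)"] LL IL by simp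
    also have "\<dots> = ennreal (\<integral>y. exp (s * (y - x)) \<partial>T)"
      unfolding nnT[symmetric] by (rule nn_integral_eq_integral[OF i]) simp
    finally have "1 \<le> (\<integral>y. exp (s * (y - x)) \<partial>T)" by simp
    also have "\<dots> \<le> 1 + s * (\<integral>y. y - x \<partial>T) + s\<^sup>2 * (8 / a\<^sup>2 * (\<integral>y. exp (a * \<bar>y - x\<bar>) \<partial>T))"
      by (rule T.mgf_le_quadratic(3)) (use a ie s in auto)
    finally show "0 \<le> s * (\<integral>y. y - x \<partial>T) + s\<^sup>2 * (8 / a\<^sup>2 * (\<integral>y. exp (a * \<bar>y - x\<bar>) \<partial>T))" by simp
  qed
  have "integrable T (\<lambda>y. y)" using Bochner_Integration.integrable_add[OF intV, of "\<lambda>_. x"] by simp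
  then have mx: "(\<integral>y. y \<partial>T) = x" using EV by (simp add: T.prob_space)
  note i4 = i4[unfolded mx] and k4 = k4[unfolded mx]
  define v where "v = (\<integral>y. (y - x)\<^sup>2 \<partial>T)"
  have "\<xi>\<^sup>2 * v \<le> tilt_const * (1 + L)\<^sup>2"
  proof -
    \<comment> \<open>The sign is that of undoing the tilt: \<open>exp W\<close> has integral
      \<open>exp L\<close> under \<open>T\<close>, while Paley-Zygmund gives \<open>W\<close> a
      constant chance to exceed a multiple of its standard deviation. Together they bound that
      deviation.\<close>
    define W where "W y = - \<xi> * (y - x)" for y
    have [measurable]: "W \<in> borel_measurable borel" unfolding W_def[abs_def] by measurable
    have W2: "(\<integral>y. (W y)\<^sup>2 \<partial>T) = \<xi>\<^sup>2 * v" by (simp add: W_def power_mult_distrib v_def)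
    have W4: "(\<integral>y. W y ^ 4 \<partial>T) = \<xi> ^ 4 * (\<integral>y. (y - x) ^ 4 \<partial>T)" by (simp add: W_def power_mult_distrib)
    have x4: "\<xi> ^ 4 = (\<xi>\<^sup>2)\<^sup>2" by (simp flip: power_mult)
    have "(\<integral>y. W y ^ 4 \<partial>T) \<le> \<xi> ^ 4 * (kurt * v\<^sup>2)" unfolding W4 using k4 by (intro mult_left_mono) (auto simp: v_def)
    also have "\<dots> = kurt * (\<integral>y. (W y)\<^sup>2 \<partial>T)\<^sup>2" unfolding W2 x4 by (simp add: power_mult_distrib mult_ac)
    finally have W4le: "(\<integral>y. W y ^ 4 \<partial>T) \<le> kurt * (\<integral>y. (W y)\<^sup>2 \<partial>T)\<^sup>2" .
    define c where "c = sqrt (\<xi>\<^sup>2 * v) / (8 * sqrt kurt)"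
    define H where "H = {y\<in>space T. c \<le> W y}"
    have H[measurable]: "H \<in> sets T" unfolding H_def by measurable
    have "1 / (16 * kurt) \<le> T.prob {w\<in>space T. sqrt (\<integral>y. (W y)\<^sup>2 \<partial>T) / (8 * sqrt kurt) \<le> W w}"
    proof (rule T.paley_zygmund_centered)
      show "integrable T (\<lambda>w. W w ^ 4)" using i4 by (simp add: W_def power_mult_distrib)
      show "T.expectation W = 0" using EV by (simp add: W_def[abs_def])
    qed (use kurt_ge W4le in auto)
    then have PZ: "1 / (16 * kurt) \<le> T.prob H" unfolding H_def c_def W2 .
    have "ennreal (exp c * (1 / (16 * kurt))) \<le> ennreal (exp c * T.prob H)"
      using PZ by (intro ennreal_leI mult_left_mono) auto
    also have "\<dots> = (\<integral>\<^sup>+y. ennreal (exp c) * indicator H y \<partial>T)"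
      by (simp add: nn_integral_cmult_indicator T.emeasure_eq_measure ennreal_mult)
    also have "\<dots> \<le> (\<integral>\<^sup>+y. ennreal (exp (- \<xi> * (y - x))) \<partial>T)"
      by (intro nn_integral_mono) (auto split: split_indicator simp: H_def W_def intro!: ennreal_leI)
    also have "\<dots> = ennreal (exp L)"
      unfolding nnT using mgf_at_zero[OF N.prob_space_axioms, of x] by simp
    finally have "exp c * (1 / (16 * kurt)) \<le> exp L" by (subst (asm) ennreal_le_iff) auto
    then have "exp c \<le> exp L * (16 * kurt)" using kurt_ge by (simp add: field_simps)
    also have "\<dots> = exp (L + ln (16 * kurt))" using kurt_ge by (simp add: exp_add)
    finally have cle: "c \<le> L + ln (16 * kurt)" by simp
    have "1 \<le> ln (16 * kurt)"
      using kurt_ge exp_le by (subst ln_ge_iff) auto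
    then have "L \<le> ln (16 * kurt) * L" using L0 mult_right_mono[of 1 "ln (16 * kurt)" L] by simp
    then have "c \<le> ln (16 * kurt) * (1 + L)" using cle by (simp add: algebra_simps)
    moreover have v0: "0 \<le> v" by (simp add: v_def)
    then have c0: "0 \<le> c" using kurt_ge by (simp add: c_def)
    ultimately have "c\<^sup>2 \<le> (ln (16 * kurt) * (1 + L))\<^sup>2" by (intro power_mono)
    then have "64 * kurt * c\<^sup>2 \<le> 64 * kurt * (ln (16 * kurt) * (1 + L))\<^sup>2"
      using kurt_ge by (intro mult_left_mono) auto
    moreover have "64 * kurt * c\<^sup>2 = \<xi>\<^sup>2 * v"
      using v0 kurt_ge by (simp add: c_def power_divide power_mult_distrib)
    moreover have "64 * kurt * (ln (16 * kurt) * (1 + L))\<^sup>2 = tilt_const * (1 + L)\<^sup>2"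
      unfolding tilt_const_def power_mult_distrib by (simp only: mult.assoc)
    ultimately show ?thesis by simp
  qed
  then have "centring_tilt N x \<xi>"
    unfolding centring_tilt_def Let_def L_def[symmetric] g_def[symmetric] T_def[symmetric] v_def[symmetric]
    using L0 xi I_le IL T.prob_space_axioms i4 EV k4 by (simp add: I_def[symmetric] v_def)
  then show ?thesis by blast
qed

lemma AE_centring_tilt:
  assumes N: "has_log_concave_density N"
  shows "AE x in N. \<exists>\<xi>. centring_tilt N x \<xi>"
  using AE_tails_positive[OF N] by eventually_elim (blast intro: centring_tilt_exists[OF N])

section \<open>Moments of the Legendre transform\<close>

lemma mgf_at_shift:
  assumes [measurable_cong]: "sets N = sets borel"
  shows "mgf_at N x \<zeta> = ennreal (exp (\<zeta> * (m - x))) * mgf_at N m \<zeta>"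
proof -
  have "mgf_at N x \<zeta> = (\<integral>\<^sup>+y. ennreal (exp (\<zeta> * (m - x))) * ennreal (exp (\<zeta> * (y - m))) \<partial>N)"
    unfolding mgf_at_def by (intro nn_integral_cong)
      (simp add: ennreal_mult[symmetric] exp_add[symmetric] algebra_simps)
  also have "\<dots> = ennreal (exp (\<zeta> * (m - x))) * mgf_at N m \<zeta>"
    unfolding mgf_at_def by (rule nn_integral_cmult) measurable
  finally show ?thesis .
qed

text \<open>For fixed \<open>\<zeta>\<close> the dependence on \<open>x\<close> is an exponential
  times a constant, possibly infinite; either way strict sublevel sets are open, and so are their
  unions over \<open>\<zeta>\<close>.\<close>

lemma borel_measurable_rate:
  assumes sN[measurable_cong]: "sets N = sets borel"
  shows "rate N \<in> borel_measurable borel"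
proof -
  have "(\<lambda>x. INF \<zeta>. mgf_at N x \<zeta>) \<in> borel_measurable borel"
  proof (rule borel_measurableI_less)
    fix t :: ennreal
    have "open {x. mgf_at N x \<zeta> < t}" for \<zeta>
    proof (cases "mgf_at N 0 \<zeta> = \<top>")
      case True
      have "mgf_at N x \<zeta> = \<top>" for x
        using mgf_at_shift[OF sN, of x \<zeta> 0] True by (simp add: ennreal_mult_eq_top_iff)
      then show ?thesis by simp
    next
      case False
      then obtain c where c: "0 \<le> c" "mgf_at N 0 \<zeta> = ennreal c" by (cases "mgf_at N 0 \<zeta>") auto
      have "mgf_at N x \<zeta> = ennreal (exp (\<zeta> * (0 - x)) * c)" for x
        using mgf_at_shift[OF sN, of x \<zeta> 0] c by (simp add: ennreal_mult)
      then show ?thesis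
        by (auto intro!: open_Collect_less continuous_on_ennreal continuous_intros)
    qed
    then have "open (\<Union>\<zeta>. {x. mgf_at N x \<zeta> < t})" by blast
    moreover have "{x. (INF \<zeta>. mgf_at N x \<zeta>) < t} = (\<Union>\<zeta>. {x. mgf_at N x \<zeta> < t})"
      by (auto simp: INF_less_iff)
    ultimately show "{x \<in> space borel. (INF \<zeta>. mgf_at N x \<zeta>) < t} \<in> sets borel" by simp
  qed
  then show ?thesis unfolding rate_def[abs_def] by measurable
qed

lemma centring_tiltD:
  assumes "centring_tilt N x \<xi>"
  shows "0 \<le> rate N x" "mgf_at N x \<xi> = ennreal (exp (- rate N x))"
    "ennreal (exp (- rate N x)) \<le> mgf_at N x \<zeta>"
  using assms by (auto simp: centring_tilt_def Let_def)

text \<open>Layer bound for the mean of the squared \<open>1 + rate\<close>: between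
  \<open>k\<close> and \<open>k + 1\<close> the square is at most \<open>(k + 2)\<^sup>2\<close>,
  and \<open>rate\<close> reaches \<open>k\<close> with probability at most
  \<open>2 * exp (- k)\<close>.\<close>

definition rate_const :: real where
  "rate_const = (\<Sum>k. (real k + 2)\<^sup>2 * (2 * exp (- real k)))"

lemma summable_rate_const: "summable (\<lambda>k. (real k + 2)\<^sup>2 * (2 * exp (- real k)))"
proof (rule summable_comparison_test')
  show "summable (\<lambda>k. 16 * exp 1 * exp (- (1 / 2)) ^ k :: real)"
    by (intro summable_mult summable_geometric) simp
  fix k :: nat assume "0 \<le> k"
  define u where "u = (real k + 2) / 2"
  have u: "0 \<le> u" by (simp add: u_def)
  then have "u\<^sup>2 / 2 \<le> exp u" using exp_lower_Taylor_quadratic[OF u] by linarith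
  then have "(real k + 2)\<^sup>2 \<le> 8 * exp u" by (simp add: u_def power_divide)
  then have "(real k + 2)\<^sup>2 * (2 * exp (- real k)) \<le> 8 * exp u * (2 * exp (- real k))"
    by (intro mult_right_mono) auto
  also have "\<dots> = 16 * exp 1 * exp (real k * (- (1 / 2)))"
    by (simp add: u_def exp_add[symmetric] add_divide_distrib)
  also have "exp (real k * (- (1 / 2))) = exp (- (1 / 2)) ^ k" by (rule exp_of_nat_mult)
  finally show "norm ((real k + 2)\<^sup>2 * (2 * exp (- real k))) \<le> 16 * exp 1 * exp (- (1 / 2)) ^ k" by simp
qed

lemma rate_const_pos: "0 < rate_const"
  unfolding rate_const_def by (rule suminf_pos[OF summable_rate_const]) simp

text \<open>By Chernoff's bound \<open>exp (- \<Lambda>\<^sup>*(x))\<close> is at least the smaller of the two tails at \<open>x\<close>, and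
  these tails are stochastically at least uniform.\<close>

lemma prob_rate_ge:
  assumes N: "has_log_concave_density N" and t: "0 < t"
  shows "measure N {x\<in>space N. - ln t \<le> rate N x} \<le> 2 * t"
proof -
  interpret N: prob_space N using N by (simp add: has_log_concave_density_def)
  have P: "prob_space N" by (rule N.prob_space_axioms)
  have sN[measurable_cong]: "sets N = sets borel" by (rule log_concave_law_sets[OF N])
  have [measurable]: "rate N \<in> borel_measurable borel" by (rule borel_measurable_rate[OF sN])
  define U where "U = {x. measure N {x..} \<le> t}"
  define V where "V = {x. measure N {..x} \<le> t}"
  have UV: "U \<in> sets N" "V \<in> sets N"
    unfolding U_def V_def sN by (rule prob_upper_tail_small[OF P sN] prob_lower_tail_small[OF P sN])+
  have "AE x in N. x \<in> {x\<in>space N. - ln t \<le> rate N x} \<longrightarrow> x \<in> U \<union> V"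
    using AE_centring_tilt[OF N]
  proof eventually_elim
    case (elim x)
    then obtain \<xi> where xi: "centring_tilt N x \<xi>" by blast
    show ?case
    proof (intro impI)
      assume "x \<in> {x\<in>space N. - ln t \<le> rate N x}"
      then have "exp (- rate N x) \<le> exp (ln t)" by (subst exp_le_cancel_iff) auto
      then have "exp (- rate N x) \<le> t" using t by simp
      then have le: "mgf_at N x \<xi> \<le> ennreal t" using centring_tiltD(2)[OF xi] by (simp add: ennreal_leI)
      show "x \<in> U \<union> V"
      proof (cases "0 \<le> \<xi>")
        case True
        then have "emeasure N {x..} \<le> ennreal t" using mgf_at_ge_tail(1)[OF sN True, of 0 x] le by simp
        then show ?thesis using t by (simp add: U_def N.emeasure_eq_measure)
      next
        case False
        then have "emeasure N {..x} \<le> ennreal t" using mgf_at_ge_tail(2)[OF sN, of \<xi> 0 x] le by simp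
        then show ?thesis using t by (simp add: V_def N.emeasure_eq_measure)
      qed
    qed
  qed
  then have "measure N {x\<in>space N. - ln t \<le> rate N x} \<le> measure N (U \<union> V)"
    using UV by (intro N.finite_measure_mono_AE) auto
  also have "\<dots> \<le> measure N U + measure N V" using UV by (intro measure_Un_le)
  also have "measure N U \<le> t" unfolding U_def using t by (intro prob_upper_tail_small(2)[OF P sN]) simp
  also have "measure N V \<le> t" unfolding V_def using t by (intro prob_lower_tail_small(2)[OF P sN]) simp
  finally show ?thesis by simp
qed

lemma rate_second_moment:
  assumes N: "has_log_concave_density N"
  shows "integrable N (\<lambda>x. (1 + rate N x)\<^sup>2)" "(\<integral>x. (1 + rate N x)\<^sup>2 \<partial>N) \<le> rate_const"
proof -
  interpret N: prob_space N using N by (simp add: has_log_concave_density_def)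
  have sN[measurable_cong]: "sets N = sets borel" by (rule log_concave_law_sets[OF N])
  have [measurable]: "rate N \<in> borel_measurable borel" by (rule borel_measurable_rate[OF sN])
  define A where "A k = {x\<in>space N. real k \<le> rate N x}" for k :: nat
  have A[measurable]: "A k \<in> sets N" for k unfolding A_def by measurable
  have PA: "measure N (A k) \<le> 2 * exp (- real k)" for k
    using prob_rate_ge[OF N, of "exp (- real k)"] by (simp add: A_def)
  have "(\<integral>\<^sup>+x. ennreal ((1 + rate N x)\<^sup>2) \<partial>N) \<le> (\<integral>\<^sup>+x. (\<Sum>k. ennreal ((real k + 2)\<^sup>2) * indicator (A k) x) \<partial>N)"
  proof (rule nn_integral_mono_AE)
    show "AE x in N. ennreal ((1 + rate N x)\<^sup>2) \<le> (\<Sum>k. ennreal ((real k + 2)\<^sup>2) * indicator (A k) x)"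
      using AE_centring_tilt[OF N] AE_space
    proof eventually_elim
      case (elim x)
      then have L0: "0 \<le> rate N x" using centring_tiltD(1) by blast
      define k where "k = nat \<lfloor>rate N x\<rfloor>"
      have k: "real k \<le> rate N x" "rate N x \<le> real k + 1" using L0 unfolding k_def by linarith+
      then have "x \<in> A k" using elim by (simp add: A_def)
      have "ennreal ((1 + rate N x)\<^sup>2) \<le> ennreal ((real k + 2)\<^sup>2) * indicator (A k) x"
        using \<open>x \<in> A k\<close> k L0 by (auto intro!: ennreal_leI power_mono)
      also have "\<dots> \<le> (\<Sum>k. ennreal ((real k + 2)\<^sup>2) * indicator (A k) x)"
        using sum_le_suminf[of "\<lambda>k. ennreal ((real k + 2)\<^sup>2) * indicator (A k) x" "{k}"]
        by (simp del: sum_mult_indicator)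
      finally show ?case .
    qed
  qed
  also have "\<dots> = (\<Sum>k. \<integral>\<^sup>+x. ennreal ((real k + 2)\<^sup>2) * indicator (A k) x \<partial>N)"
    by (rule nn_integral_suminf) measurable
  also have "\<dots> = (\<Sum>k. ennreal ((real k + 2)\<^sup>2 * measure N (A k)))"
    by (simp add: nn_integral_cmult_indicator N.emeasure_eq_measure ennreal_mult)
  also have "\<dots> \<le> (\<Sum>k. ennreal ((real k + 2)\<^sup>2 * (2 * exp (- real k))))"
    using PA by (intro suminf_le) (auto intro!: ennreal_leI mult_left_mono)
  also have "\<dots> = ennreal rate_const"
    unfolding rate_const_def by (rule suminf_ennreal2) (auto intro: summable_rate_const)
  finally have nn: "(\<integral>\<^sup>+x. ennreal ((1 + rate N x)\<^sup>2) \<partial>N) \<le> ennreal rate_const" .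
  show int: "integrable N (\<lambda>x. (1 + rate N x)\<^sup>2)"
  proof (rule integrableI_bounded)
    show "(\<integral>\<^sup>+x. ennreal (norm ((1 + rate N x)\<^sup>2)) \<partial>N) < \<infinity>"
      using le_less_trans[OF nn ennreal_less_top] by simp
  qed measurable
  have "ennreal (\<integral>x. (1 + rate N x)\<^sup>2 \<partial>N) \<le> ennreal rate_const"
    using nn by (subst nn_integral_eq_integral[symmetric, OF int]) auto
  then show "(\<integral>x. (1 + rate N x)\<^sup>2 \<partial>N) \<le> rate_const"
    using rate_const_pos by (subst (asm) ennreal_le_iff) auto
qed

lemma rate_integrable:
  assumes N: "has_log_concave_density N"
  shows "integrable N (rate N)" "integrable N (\<lambda>x. (rate N x)\<^sup>2)"
proof -
  interpret N: prob_space N using N by (simp add: has_log_concave_density_def)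
  have sN[measurable_cong]: "sets N = sets borel" by (rule log_concave_law_sets[OF N])
  have [measurable]: "rate N \<in> borel_measurable borel" by (rule borel_measurable_rate[OF sN])
  have "integrable N (\<lambda>x. 1 + rate N x)"
    by (rule N.square_integrable_imp_integrable[OF _ rate_second_moment(1)[OF N]]) measurable
  then have "integrable N (\<lambda>x. (1 + rate N x) - 1)" by (intro Bochner_Integration.integrable_diff) auto
  then show i: "integrable N (rate N)" by simp
  have "integrable N (\<lambda>x. (1 + rate N x)\<^sup>2 - 2 * rate N x - 1)"
    using i rate_second_moment(1)[OF N] by (intro Bochner_Integration.integrable_diff) auto
  moreover have "(1 + rate N x)\<^sup>2 - 2 * rate N x - 1 = (rate N x)\<^sup>2" for x
    by (simp add: power2_eq_square algebra_simps)
  ultimately show "integrable N (\<lambda>x. (rate N x)\<^sup>2)" by simp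
qed

text \<open>The maximum over \<open>\<tau>\<close> of \<open>\<tau> / 272 - 8 \<tau>\<^sup>2 K\<close> with \<open>K = 68 exp 68\<close>.\<close>

definition rate_low :: real where
  "rate_low = 1 / (544 * (4352 * (68 * exp 68)))"

lemma rate_low_pos: "0 < rate_low"
  by (simp add: rate_low_def)

text \<open>Tests the transform with a small parameter whose sign is that of \<open>x - m\<close>.
  The gain is linear in \<open>\<tau>\<close>, as \<open>\<bar>x - m\<bar>\<close> has mean at least
  \<open>r / 136\<close>; the loss is quadratic, as \<open>m\<close> is the mean. The parameter has
  size \<open>\<tau> / (2 * r)\<close>, so the scale cancels.\<close>

lemma rate_mean_ge:
  assumes N: "has_log_concave_density N"
  shows "rate_low \<le> (\<integral>x. rate N x \<partial>N)"
proof -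
  interpret N: prob_space N using N by (simp add: has_log_concave_density_def)
  have sN[measurable_cong]: "sets N = sets borel" by (rule log_concave_law_sets[OF N])
  define K where "K = 68 * exp (68::real)"
  define \<tau> where "\<tau> = 1 / (4352 * K)"
  have K: "1 \<le> K" unfolding K_def using one_le_exp_iff[of "68::real"] by linarith
  have tau: "0 < \<tau>" "\<tau> \<le> 1 / 2" using K by (auto simp: \<tau>_def field_simps)
  define m where "m = (\<integral>y. y \<partial>N)"
  obtain r where r: "0 < r" and ie: "integrable N (\<lambda>y. exp (1 / (2 * r) * \<bar>y - m\<bar>))"
    and Ie: "(\<integral>y. exp (1 / (2 * r) * \<bar>y - m\<bar>) \<partial>N) \<le> K"
    and low: "r / 136 \<le> (\<integral>y. \<bar>y - m\<bar> \<partial>N)"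
    using log_concave_law_moments[OF N] unfolding m_def[symmetric] K_def[symmetric] by blast
  define a where "a = 1 / (2 * r)"
  have a: "0 < a" using r by (simp add: a_def)
  have intV: "integrable N (\<lambda>y. y - m)"
    by (rule N.mgf_le_quadratic(2)[of _ a 0]) (use a ie in \<open>auto simp: a_def\<close>)
  have inty: "integrable N (\<lambda>y. y)" using Bochner_Integration.integrable_add[OF intV, of "\<lambda>_. m"] by simp
  have EV: "(\<integral>y. y - m \<partial>N) = 0" using inty by (simp add: m_def N.prob_space)
  have mgf: "mgf_at N m s \<le> ennreal (exp (8 * \<tau>\<^sup>2 * K))" if s: "\<bar>s\<bar> = \<tau> * a" for s
  proof -
    have s': "\<bar>s\<bar> \<le> a / 2" using s tau a by simp
    have i: "integrable N (\<lambda>y. exp (s * (y - m)))"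
      by (rule N.mgf_le_quadratic(1)[of _ a]) (use a ie s' in \<open>auto simp: a_def\<close>)
    have "(\<integral>y. exp (s * (y - m)) \<partial>N) \<le> 1 + s * (\<integral>y. y - m \<partial>N) + s\<^sup>2 * (8 / a\<^sup>2 * (\<integral>y. exp (a * \<bar>y - m\<bar>) \<partial>N))"
      by (rule N.mgf_le_quadratic(3)) (use a ie s' in \<open>auto simp: a_def\<close>)
    also have "\<dots> \<le> 1 + s\<^sup>2 * (8 / a\<^sup>2 * K)"
    proof -
      have "s\<^sup>2 * (8 / a\<^sup>2 * (\<integral>y. exp (a * \<bar>y - m\<bar>) \<partial>N)) \<le> s\<^sup>2 * (8 / a\<^sup>2 * K)"
        using Ie by (intro mult_left_mono) (auto simp: a_def)
      then show ?thesis using EV by simp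
    qed
    also have "s\<^sup>2 = \<tau>\<^sup>2 * a\<^sup>2" using s by (metis power2_abs power_mult_distrib)
    also have "1 + \<tau>\<^sup>2 * a\<^sup>2 * (8 / a\<^sup>2 * K) = 1 + 8 * \<tau>\<^sup>2 * K" using a by simp
    also have "\<dots> \<le> exp (8 * \<tau>\<^sup>2 * K)" by simp
    finally show ?thesis
      unfolding mgf_at_def by (subst nn_integral_eq_integral[OF i]) (auto intro: ennreal_leI)
  qed
  have pt: "AE x in N. \<tau> * a * \<bar>x - m\<bar> - 8 * \<tau>\<^sup>2 * K \<le> rate N x"
    using AE_centring_tilt[OF N]
  proof eventually_elim
    case (elim x)
    then obtain \<xi> where xi: "centring_tilt N x \<xi>" by blast
    define s where "s = (if m \<le> x then \<tau> * a else - (\<tau> * a))"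
    have s: "\<bar>s\<bar> = \<tau> * a" using tau a by (simp add: s_def)
    have sx: "s * (m - x) = - (\<tau> * a * \<bar>x - m\<bar>)" by (simp add: s_def algebra_simps)
    have "ennreal (exp (- rate N x)) \<le> mgf_at N x s" by (rule centring_tiltD(3)[OF xi])
    also have "\<dots> = ennreal (exp (s * (m - x))) * mgf_at N m s" by (rule mgf_at_shift[OF sN])
    also have "\<dots> \<le> ennreal (exp (s * (m - x))) * ennreal (exp (8 * \<tau>\<^sup>2 * K))"
      by (intro mult_left_mono mgf[OF s]) simp
    also have "\<dots> = ennreal (exp (s * (m - x) + 8 * \<tau>\<^sup>2 * K))" by (simp add: ennreal_mult[symmetric] exp_add)
    finally have "exp (- rate N x) \<le> exp (s * (m - x) + 8 * \<tau>\<^sup>2 * K)" by (subst (asm) ennreal_le_iff) auto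
    then show ?case unfolding sx by simp
  qed
  have tK: "8 * \<tau>\<^sup>2 * K = \<tau> / 544" using K by (simp add: \<tau>_def power2_eq_square)
  have "rate_low = \<tau> / 272 - 8 * \<tau>\<^sup>2 * K" unfolding tK by (simp add: rate_low_def \<tau>_def K_def)
  also have "\<tau> / 272 = \<tau> * a * (r / 136)" using r by (simp add: a_def)
  also have "\<tau> * a * (r / 136) - 8 * \<tau>\<^sup>2 * K \<le> \<tau> * a * (\<integral>y. \<bar>y - m\<bar> \<partial>N) - 8 * \<tau>\<^sup>2 * K"
    using low tau a by (intro diff_right_mono mult_left_mono) auto
  also have "\<dots> = (\<integral>x. \<tau> * a * \<bar>x - m\<bar> - 8 * \<tau>\<^sup>2 * K \<partial>N)"
    using intV by (simp add: N.prob_space)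
  also have "\<dots> \<le> (\<integral>x. rate N x \<partial>N)"
    using intV rate_integrable(1)[OF N] pt by (intro integral_mono_AE) auto
  finally show ?thesis .
qed

section \<open>Products of log-concave laws\<close>

lemma measurable_exp_affine:
  assumes [measurable_cong]: "sets N = sets borel"
  shows "(\<lambda>y::real. ennreal (exp (c * (y - d)))) \<in> borel_measurable N"
  by measurable

lemma prod_mono_ennreal:
  fixes f g :: "'i \<Rightarrow> ennreal"
  assumes "finite I" "\<And>i. i \<in> I \<Longrightarrow> f i \<le> g i"
  shows "prod f I \<le> prod g I"
  using assms by (induction I) (auto intro!: mult_mono)

lemma PiM_integral_component:
  fixes g :: "'a \<Rightarrow> real"
  assumes M: "\<And>i. i \<in> I \<Longrightarrow> prob_space (M i)" and i: "i \<in> I" and g: "integrable (M i) g"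
  shows "integrable (PiM I M) (\<lambda>x. g (x i))" "(\<integral>x. g (x i) \<partial>PiM I M) = (\<integral>y. g y \<partial>M i)"
proof -
  have m: "(\<lambda>x. x i) \<in> measurable (PiM I M) (M i)" by (rule measurable_component_singleton[OF i])
  have d: "distr (PiM I M) (M i) (\<lambda>x. x i) = M i" by (rule distr_PiM_component[OF M i])
  have gm: "g \<in> borel_measurable (M i)" using g by auto
  show "integrable (PiM I M) (\<lambda>x. g (x i))" using integrable_distr[OF m, of g] g d by simp
  show "(\<integral>x. g (x i) \<partial>PiM I M) = (\<integral>y. g y \<partial>M i)" using integral_distr[OF m gm] d by simp
qed

locale log_concave_product =
  fixes lam :: "nat \<Rightarrow> real measure" and n :: nat
  assumes lc: "has_log_concave_density (lam m)"
begin

definition \<mu> where "\<mu> = prod_meas lam n"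

lemma \<mu>_PiM: "\<mu> = PiM {..<n} lam"
  by (simp add: \<mu>_def prod_meas_def)

lemma prob_lam: "prob_space (lam i)"
  using lc[of i] by (simp add: has_log_concave_density_def)

lemma sets_lam[measurable_cong]: "sets (lam i) = sets borel"
  by (rule log_concave_law_sets[OF lc])

lemma prob_space_\<mu>: "prob_space \<mu>"
  unfolding \<mu>_PiM by (intro prob_space_PiM prob_lam)

lemma sets_\<mu>: "sets \<mu> = sets (PiM {..<n} (\<lambda>_. borel))"
  unfolding \<mu>_PiM by (intro sets_PiM_cong) (auto simp: sets_lam)

sublocale prob_Rn \<mu> n
  using prob_space_\<mu> sets_\<mu> by (simp add: prob_Rn_def prob_Rn_axioms_def)

text \<open>Real-valued, with measurability immediate from the factors; by
  \<open>Lambda_star_eq\<close> it agrees almost everywhere with the Legendre transform of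
  \<open>\<mu>\<close>.\<close>

definition sum_rate :: "(nat \<Rightarrow> real) \<Rightarrow> real" where
  "sum_rate x = (\<Sum>i<n. rate (lam i) (x i))"

definition sum_sq :: "(nat \<Rightarrow> real) \<Rightarrow> real" where
  "sum_sq x = (\<Sum>i<n. (1 + rate (lam i) (x i))\<^sup>2)"

lemma measurable_rate_component[measurable]:
  "i < n \<Longrightarrow> (\<lambda>x. rate (lam i) (x i)) \<in> borel_measurable \<mu>"
  by (rule measurable_compose[OF measurable_M_component borel_measurable_rate[OF sets_lam]])

lemma measurable_sum_rate[measurable]: "sum_rate \<in> borel_measurable \<mu>"
  unfolding sum_rate_def[abs_def] by measurable

lemma measurable_sum_sq[measurable]: "sum_sq \<in> borel_measurable \<mu>"
  unfolding sum_sq_def[abs_def] by measurable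

lemma
  fixes g :: "real \<Rightarrow> real"
  assumes i: "i < n" and g: "integrable (lam i) g"
  shows integrable_component: "integrable \<mu> (\<lambda>x. g (x i))"
    and integral_component: "(\<integral>x. g (x i) \<partial>\<mu>) = (\<integral>y. g y \<partial>lam i)"
  using PiM_integral_component[of "{..<n}" lam i g] i g prob_lam unfolding \<mu>_PiM by auto

definition mean_rate :: real where "mean_rate = (\<Sum>i<n. \<integral>y. rate (lam i) y \<partial>lam i)"

lemma mean_rate_ge: "real n * rate_low \<le> mean_rate"
  using sum_mono[of "{..<n}" "\<lambda>_. rate_low", OF rate_mean_ge[OF lc]] by (simp add: mean_rate_def)

lemma sum_rate_deviation:
  assumes a: "0 < a"
  shows "prob {x\<in>space \<mu>. a \<le> \<bar>sum_rate x - mean_rate\<bar>} \<le> real n * rate_const / a\<^sup>2"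
proof -
  define e where "e i = (\<integral>y. rate (lam i) y \<partial>lam i)" for i
  define W where "W i x = rate (lam i) (x i) - e i" for i and x :: "nat \<Rightarrow> real"
  have ind: "indep_vars (\<lambda>_. borel) W {..<n}"
    unfolding W_def \<mu>_PiM
    by (rule indep_vars_PiM_coordinate_functions) (auto simp: prob_lam intro!: borel_measurable_diff borel_measurable_rate sets_lam
      simp: measurable_cong_sets[OF sets_lam refl])
  have i2: "integrable (lam i) (\<lambda>y. (rate (lam i) y - e i)\<^sup>2)" for i
  proof -
    interpret L: prob_space "lam i" by (rule prob_lam)
    have "integrable (lam i) (\<lambda>y. (rate (lam i) y)\<^sup>2 - 2 * e i * rate (lam i) y + (e i)\<^sup>2)"
      using rate_integrable[OF lc, of i] by auto
    then show ?thesis by (simp add: power2_diff mult_ac) (simp add: algebra_simps)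
  qed
  have W2: "integrable \<mu> (\<lambda>x. (W i x)\<^sup>2)" "expectation (W i) = 0" "expectation (\<lambda>x. (W i x)\<^sup>2) \<le> rate_const"
    if i: "i < n" for i
  proof -
    interpret L: prob_space "lam i" by (rule prob_lam)
    note r = rate_integrable[OF lc, of i]
    show "integrable \<mu> (\<lambda>x. (W i x)\<^sup>2)" unfolding W_def by (rule integrable_component[OF i i2])
    have "expectation (W i) = (\<integral>y. rate (lam i) y - e i \<partial>lam i)"
      unfolding W_def[abs_def] by (rule integral_component[OF i]) (use r in auto)
    then show "expectation (W i) = 0" using r by (simp add: e_def L.prob_space)
    have "expectation (\<lambda>x. (W i x)\<^sup>2) = (\<integral>y. (rate (lam i) y - e i)\<^sup>2 \<partial>lam i)"
      unfolding W_def by (rule integral_component[OF i i2])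
    also have "\<dots> = (\<integral>y. (rate (lam i) y)\<^sup>2 \<partial>lam i) - (e i)\<^sup>2"
      unfolding e_def using r by (intro L.variance_eq)
    also have "\<dots> \<le> (\<integral>y. (rate (lam i) y)\<^sup>2 \<partial>lam i)" by simp
    also have "\<dots> \<le> (\<integral>y. (1 + rate (lam i) y)\<^sup>2 \<partial>lam i)"
    proof (intro integral_mono_AE r rate_second_moment(1)[OF lc])
      show "AE y in lam i. (rate (lam i) y)\<^sup>2 \<le> (1 + rate (lam i) y)\<^sup>2"
        using AE_centring_tilt[OF lc] by eventually_elim (auto intro!: power_mono dest: centring_tiltD(1))
    qed
    also have "\<dots> \<le> rate_const" by (rule rate_second_moment(2)[OF lc])
    finally show "expectation (\<lambda>x. (W i x)\<^sup>2) \<le> rate_const" .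
  qed
  have eq: "(\<Sum>i<n. W i x) = sum_rate x - mean_rate" for x
    by (simp add: W_def sum_rate_def mean_rate_def e_def sum_subtractf)
  have S: "integrable \<mu> (\<lambda>x. (\<Sum>i<n. W i x)\<^sup>2) \<and> expectation (\<lambda>x. \<Sum>i<n. W i x) = 0 \<and>
    expectation (\<lambda>x. (\<Sum>i<n. W i x)\<^sup>2) = (\<Sum>i<n. expectation (\<lambda>x. (W i x)\<^sup>2))"
    by (rule second_moment_sum_indep[OF _ ind]) (use W2 in auto)
  have "prob {x\<in>space \<mu>. a \<le> \<bar>sum_rate x - mean_rate\<bar>} \<le> expectation (\<lambda>x. (sum_rate x - mean_rate)\<^sup>2) / a\<^sup>2"
    using S unfolding eq by (intro second_moment_method a) auto
  also have "expectation (\<lambda>x. (sum_rate x - mean_rate)\<^sup>2) \<le> real n * rate_const"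
    using S W2(3) sum_mono[of "{..<n}" "\<lambda>i. expectation (\<lambda>x. (W i x)\<^sup>2)" "\<lambda>_. rate_const"] unfolding eq by simp
  finally show ?thesis using a by (simp add: divide_right_mono)
qed

lemma sum_sq_large:
  assumes q: "0 < q"
  shows "prob {x\<in>space \<mu>. q \<le> sum_sq x} \<le> real n * rate_const / q"
proof -
  note r = rate_second_moment[OF lc]
  have i: "integrable \<mu> (\<lambda>x. (1 + rate (lam i) (x i))\<^sup>2)" if "i < n" for i
    by (rule integrable_component[OF that r(1)])
  have int: "integrable \<mu> sum_sq" unfolding sum_sq_def[abs_def] by (rule Bochner_Integration.integrable_sum) (use i in auto)
  have nn: "0 \<le> sum_sq x" for x by (simp add: sum_sq_def sum_nonneg)
  have "expectation sum_sq = (\<Sum>i<n. expectation (\<lambda>x. (1 + rate (lam i) (x i))\<^sup>2))"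
    unfolding sum_sq_def[abs_def] by (rule Bochner_Integration.integral_sum) (use i in auto)
  also have "\<dots> = (\<Sum>i<n. \<integral>y. (1 + rate (lam i) y)\<^sup>2 \<partial>lam i)"
    using integral_component[OF _ r(1)] by (intro sum.cong) auto
  also have "\<dots> \<le> (\<Sum>i<n. rate_const)" by (intro sum_mono r(2))
  finally have E: "expectation sum_sq \<le> real n * rate_const" by simp
  have "prob {x\<in>space \<mu>. q \<le> sum_sq x} \<le> expectation sum_sq / q"
    by (rule integral_Markov_inequality_measure[where A = "{}"])
      (use q int nn in auto)
  also have "\<dots> \<le> real n * rate_const / q" using E q by (intro divide_right_mono) auto
  finally show ?thesis .
qed

lemma AE_good: "AE x in \<mu>. \<forall>i<n. \<exists>\<xi>. centring_tilt (lam i) (x i) \<xi>"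
proof -
  have "AE x in \<mu>. \<exists>\<xi>. centring_tilt (lam i) (x i) \<xi>" if "i < n" for i
    unfolding \<mu>_PiM by (rule AE_PiM_component) (use that prob_lam AE_centring_tilt[OF lc] in auto)
  then have "AE x in \<mu>. \<forall>i\<in>{..<n}. \<exists>\<xi>. centring_tilt (lam i) (x i) \<xi>"
    by (intro AE_finite_allI) auto
  then show ?thesis by (simp add: Ball_def)
qed

section \<open>The Legendre transform of the product law\<close>

lemma nn_integral_exp_inner:
  "(\<integral>\<^sup>+y. ennreal (exp (\<Sum>i<n. \<zeta> i * (y i - x i))) \<partial>\<mu>) = (\<Prod>i<n. mgf_at (lam i) (x i) (\<zeta> i))"
proof -
  interpret PS: product_sigma_finite lam
    by (simp add: product_sigma_finite_def prob_space_imp_sigma_finite prob_lam)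
  have m: "(\<lambda>y. ennreal (exp (c * (y - d)))) \<in> borel_measurable (lam i)" for c d i
    by (rule measurable_exp_affine[OF sets_lam])
  have "(\<integral>\<^sup>+y. ennreal (exp (\<Sum>i<n. \<zeta> i * (y i - x i))) \<partial>\<mu>) =
      (\<integral>\<^sup>+y. (\<Prod>i<n. ennreal (exp (\<zeta> i * (y i - x i)))) \<partial>\<mu>)"
    by (simp add: exp_sum prod_ennreal)
  also have "\<dots> = (\<Prod>i<n. mgf_at (lam i) (x i) (\<zeta> i))"
    unfolding \<mu>_PiM mgf_at_def by (rule PS.product_nn_integral_prod) (simp, rule m)
  finally show ?thesis .
qed

lemma prod_mgf_ge:
  assumes x: "\<forall>i<n. \<exists>\<xi>. centring_tilt (lam i) (x i) \<xi>"
  shows "ennreal (exp (- sum_rate x)) \<le> (\<Prod>i<n. mgf_at (lam i) (x i) (\<zeta> i))"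
proof -
  have "ennreal (exp (- sum_rate x)) = (\<Prod>i<n. ennreal (exp (- rate (lam i) (x i))))"
    by (simp add: sum_rate_def exp_sum prod_ennreal flip: sum_negf)
  also have "\<dots> \<le> (\<Prod>i<n. mgf_at (lam i) (x i) (\<zeta> i))"
    using x centring_tiltD(3) by (intro prod_mono_ennreal) auto
  finally show ?thesis .
qed

lemma prod_mgf_eq:
  assumes x: "\<forall>i<n. centring_tilt (lam i) (x i) (\<xi> i)"
  shows "(\<Prod>i<n. mgf_at (lam i) (x i) (\<xi> i)) = ennreal (exp (- sum_rate x))"
proof -
  have "ennreal (exp (- sum_rate x)) = (\<Prod>i<n. ennreal (exp (- rate (lam i) (x i))))"
    by (simp add: sum_rate_def exp_sum prod_ennreal flip: sum_negf)
  also have "\<dots> = (\<Prod>i<n. mgf_at (lam i) (x i) (\<xi> i))"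
    using x centring_tiltD(2) by (intro prod.cong) auto
  finally show ?thesis by simp
qed

text \<open>The centred generating function factorises, so each coordinate is optimised on its own,
  and the vector of one-dimensional minimisers attains the supremum.\<close>

lemma Lambda_star_eq:
  assumes x: "\<forall>i<n. \<exists>\<xi>. centring_tilt (lam i) (x i) \<xi>"
  shows "Lambda_star n \<mu> x = ereal (sum_rate x)"
proof -
  define m where "m \<zeta> = (\<integral>\<^sup>+y. ennreal (exp (inner_n n y \<zeta>)) \<partial>\<mu>)" for \<zeta>
  have shift: "(\<Prod>i<n. mgf_at (lam i) (x i) (\<zeta> i)) = ennreal (exp (- inner_n n x \<zeta>)) * m \<zeta>" for \<zeta>
  proof -
    have "(\<Prod>i<n. mgf_at (lam i) (x i) (\<zeta> i)) = (\<integral>\<^sup>+y. ennreal (exp (- inner_n n x \<zeta>)) * ennreal (exp (inner_n n y \<zeta>)) \<partial>\<mu>)"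
      unfolding nn_integral_exp_inner[symmetric]
      by (intro nn_integral_cong)
        (simp add: inner_n_def ennreal_mult[symmetric] exp_add[symmetric] sum_subtractf right_diff_distrib mult.commute)
    also have "\<dots> = ennreal (exp (- inner_n n x \<zeta>)) * m \<zeta>"
      unfolding m_def by (rule nn_integral_cmult) (unfold inner_n_def, measurable)
    finally show ?thesis .
  qed
  have le: "ereal (inner_n n x \<zeta>) - Lambda n \<mu> \<zeta> \<le> ereal (sum_rate x)" for \<zeta>
  proof (cases "m \<zeta> = \<infinity>")
    case True
    \<comment> \<open>Here \<open>Lambda\<close> is infinite, and the difference is minus
      infinity.\<close>
    then show ?thesis by (simp add: Lambda_def m_def)
  next
    case False
    then obtain c where c: "0 \<le> c" "m \<zeta> = ennreal c" by (cases "m \<zeta>") auto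
    have "ennreal (exp (- sum_rate x)) \<le> ennreal (exp (- inner_n n x \<zeta>) * c)"
      using prod_mgf_ge[OF x, of \<zeta>] unfolding shift c(2) ennreal_mult[OF exp_ge_zero c(1)] .
    then have le: "exp (- sum_rate x) \<le> exp (- inner_n n x \<zeta>) * c"
      using c(1) by (subst (asm) ennreal_le_iff) auto
    then have "c \<noteq> 0" by auto
    then have "0 < c" using c(1) by simp
    with le have "ln (exp (- sum_rate x)) \<le> ln (exp (- inner_n n x \<zeta>) * c)" by (subst ln_le_cancel_iff) auto
    then have "inner_n n x \<zeta> - ln c \<le> sum_rate x" using \<open>0 < c\<close> by (simp add: ln_mult)
    then show ?thesis using False c unfolding Lambda_def m_def[symmetric] by simp
  qed
  obtain \<xi> where xi: "\<forall>i<n. centring_tilt (lam i) (x i) (\<xi> i)" using x by metis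
  have e: "ennreal (exp (- inner_n n x \<xi>)) * m \<xi> = ennreal (exp (- sum_rate x))"
    using prod_mgf_eq[OF xi] shift by simp
  have "m \<xi> \<noteq> \<infinity>" using e by (auto simp: ennreal_mult_eq_top_iff)
  then obtain c where c: "0 \<le> c" "m \<xi> = ennreal c" by (cases "m \<xi>") auto
  have "exp (- inner_n n x \<xi>) * c = exp (- sum_rate x)"
    using e c by (simp add: ennreal_mult[symmetric])
  then have "c = exp (inner_n n x \<xi> - sum_rate x)" by (simp add: exp_diff exp_minus field_simps)
  then have "ereal (inner_n n x \<xi>) - Lambda n \<mu> \<xi> = ereal (sum_rate x)"
    using c unfolding Lambda_def m_def[symmetric] by simp
  moreover have "ereal (inner_n n x \<xi>) - Lambda n \<mu> \<xi> \<le> Lambda_star n \<mu> x"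
    unfolding Lambda_star_def by (rule SUP_upper) simp
  moreover have "Lambda_star n \<mu> x \<le> ereal (sum_rate x)"
    unfolding Lambda_star_def by (intro SUP_least le)
  ultimately show ?thesis by (metis antisym)
qed

text \<open>A supremum of affine functions of \<open>x\<close> is lower semicontinuous. With this
  measurability, almost everywhere equality with \<open>sum_rate\<close> transfers the Bochner
  integral.\<close>

lemma measurable_Lambda_star: "Lambda_star n \<mu> \<in> borel_measurable \<mu>"
proof -
  have "Lambda_star n \<mu> \<in> borel_measurable borel"
  proof (rule borel_measurableI_greater)
    fix t :: ereal
    have "open {x. t < ereal (inner_n n x \<zeta>) - Lambda n \<mu> \<zeta>}" for \<zeta>
    proof (cases "Lambda n \<mu> \<zeta>")
      case (real r)
      have "continuous_on UNIV (\<lambda>x. inner_n n x \<zeta>)"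
        unfolding inner_n_def
        by (intro continuous_on_sum continuous_on_mult continuous_on_const continuous_on_product_coordinates)
      then have "open {x. t < ereal (inner_n n x \<zeta> - r)}"
        by (intro open_Collect_less continuous_on_const continuous_on_ereal continuous_on_diff)
      then show ?thesis by (simp add: real)
    qed (auto simp: Lambda_def Let_def split: if_splits)
    then have "open (\<Union>\<zeta>. {x. t < ereal (inner_n n x \<zeta>) - Lambda n \<mu> \<zeta>})" by blast
    moreover have "{x. t < Lambda_star n \<mu> x} = (\<Union>\<zeta>. {x. t < ereal (inner_n n x \<zeta>) - Lambda n \<mu> \<zeta>})"
      by (auto simp: Lambda_star_def less_SUP_iff)
    ultimately show "{x \<in> space borel. t < Lambda_star n \<mu> x} \<in> sets borel" by simp
  qed
  \<comment> \<open>Points of \<open>\<mu>\<close> are extensional; padding with zeros maps them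
    measurably into the space of all sequences, where openness was shown.\<close>
  moreover have "(\<lambda>x i. if i < n then x i else 0) \<in> measurable \<mu> borel"
  proof (rule measurable_coordinatewise_then_product)
    fix i show "(\<lambda>x. if i < n then x i else 0) \<in> borel_measurable \<mu>" by (cases "i < n") auto
  qed
  ultimately have "(\<lambda>x. Lambda_star n \<mu> (\<lambda>i. if i < n then x i else 0)) \<in> borel_measurable \<mu>"
    by (rule measurable_compose[rotated])
  moreover have "Lambda_star n \<mu> (\<lambda>i. if i < n then x i else 0) = Lambda_star n \<mu> x" for x
    by (simp add: Lambda_star_def inner_n_def)
  ultimately show ?thesis by simp
qed

lemma E_Lambda_star_eq: "E_Lambda_star n \<mu> = mean_rate"
proof -
  have 1: "AE x in \<mu>. real_of_ereal (Lambda_star n \<mu> x) = sum_rate x"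
    using AE_good by eventually_elim (simp add: Lambda_star_eq)
  have i: "integrable \<mu> (\<lambda>x. rate (lam i) (x i))" if "i < n" for i
    by (rule integrable_component[OF that rate_integrable(1)[OF lc]])
  have 2: "integrable \<mu> sum_rate" unfolding sum_rate_def[abs_def] by (rule Bochner_Integration.integrable_sum) (use i in auto)
  have "E_Lambda_star n \<mu> = expectation sum_rate"
    unfolding E_Lambda_star_def using 1 measurable_Lambda_star
    by (intro integral_cong_AE) auto
  also have "\<dots> = (\<Sum>i<n. expectation (\<lambda>x. rate (lam i) (x i)))"
    unfolding sum_rate_def[abs_def] by (rule Bochner_Integration.integral_sum) (use i in auto)
  also have "\<dots> = mean_rate"
    unfolding mean_rate_def using integral_component[OF _ rate_integrable(1)[OF lc]] by (intro sum.cong) auto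
  finally show ?thesis .
qed

end

section \<open>Half-space depth of product laws\<close>

lemma tilt_const_pos: "0 < tilt_const"
proof -
  have "1 < 16 * kurt" using kurt_ge by simp
  then have "0 < ln (16 * kurt)" by (rule ln_gt_zero)
  then show ?thesis using kurt_ge by (simp add: tilt_const_def)
qed

text \<open>Chebyshev's inequality at \<open>depth_const * sqrt (sum_sq x)\<close> leaves an
  exceptional mass of \<open>1 / (32 * kurt)\<close>, half of the Paley-Zygmund mass.\<close>

definition depth_const :: real where "depth_const = sqrt (32 * kurt * tilt_const)"

lemma depth_const_pos: "0 < depth_const"
  using tilt_const_pos kurt_ge by (simp add: depth_const_def)

context log_concave_product
begin

text \<open>Chernoff's bound for the half-space whose normal is the optimal tilt at
  \<open>x\<close>; points with \<open>sum_rate x \<le> t\<close> form the exceptional set.\<close>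

lemma E_meas_K_upper:
  assumes N: "0 < N"
  shows "E_meas_K n N \<mu> \<le> prob {x\<in>space \<mu>. sum_rate x \<le> t} + real N * exp (- t)"
proof (rule E_meas_K_le[OF N])
  show "AE x in \<mu>. x \<notin> {x\<in>space \<mu>. sum_rate x \<le> t} \<longrightarrow>
    (\<exists>\<theta>. prob {y\<in>space \<mu>. 0 \<le> (\<Sum>i<n. \<theta> i * (y i - x i))} \<le> exp (- t))"
    using AE_good AE_space
  proof eventually_elim
    case (elim x)
    then obtain \<xi> where xi: "\<forall>i<n. centring_tilt (lam i) (x i) (\<xi> i)" by metis
    define H where "H = {y\<in>space \<mu>. 0 \<le> (\<Sum>i<n. \<xi> i * (y i - x i))}"
    have H[measurable]: "H \<in> sets \<mu>" unfolding H_def by measurable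
    show ?case
    proof (intro impI exI[of _ \<xi>])
      assume "x \<notin> {x\<in>space \<mu>. sum_rate x \<le> t}"
      then have t: "t < sum_rate x" using elim by auto
      have "emeasure \<mu> H = (\<integral>\<^sup>+y. indicator H y \<partial>\<mu>)" by simp
      also have "\<dots> \<le> (\<integral>\<^sup>+y. ennreal (exp (\<Sum>i<n. \<xi> i * (y i - x i))) \<partial>\<mu>)"
        by (intro nn_integral_mono) (auto split: split_indicator simp: H_def)
      also have "\<dots> = ennreal (exp (- sum_rate x))"
        unfolding nn_integral_exp_inner by (rule prod_mgf_eq[OF xi])
      also have "\<dots> \<le> ennreal (exp (- t))" using t by (intro ennreal_leI) simp
      finally show "prob {y\<in>space \<mu>. 0 \<le> (\<Sum>i<n. \<xi> i * (y i - x i))} \<le> exp (- t)"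
        unfolding H_def[symmetric] by (simp add: emeasure_eq_measure)
    qed
  qed
qed auto

text \<open>Under the product of the tilted laws the point \<open>x\<close> is the barycentre, so every half-space
  through it keeps a constant mass, and the logarithm of the density with respect to \<open>\<mu>\<close> is
  \<open>\<Lambda>\<^sup>*(x)\<close> up to a fluctuation of variance at most \<open>tilt_const * sum_sq x\<close>.\<close>

lemma half_space_prob_ge:
  assumes n: "0 < n" and x: "\<forall>i<n. \<exists>\<xi>. centring_tilt (lam i) (x i) \<xi>"
  shows "exp (- sum_rate x - depth_const * sqrt (sum_sq x)) / (32 * kurt)
    \<le> prob {y\<in>space \<mu>. (\<Sum>i<n. \<theta> i * (y i - x i)) \<le> 0}"
proof -
  obtain \<xi> where xi: "\<And>i. i < n \<Longrightarrow> centring_tilt (lam i) (x i) (\<xi> i)" using x by metis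
  define L where "L i = rate (lam i) (x i)" for i
  define h where "h i y = ennreal (exp (\<xi> i * (y - x i) + L i))" for i y
  \<comment> \<open>Outside the index range \<open>T\<close> is \<open>lam\<close>, so that every
    member of the family is a probability law, as the product locale requires.\<close>
  define T where "T i = (if i < n then density (lam i) (h i) else lam i)" for i
  define v where "v i = (\<integral>y. (y - x i)\<^sup>2 \<partial>T i)" for i
  have hm: "h i \<in> borel_measurable (lam i)" for i
    unfolding h_def exp_add ennreal_mult[OF exp_ge_zero exp_ge_zero]
    by (intro borel_measurable_times_ennreal measurable_exp_affine[OF sets_lam] borel_measurable_const)
  have T: "prob_space (T i)" "integrable (T i) (\<lambda>y. (y - x i) ^ 4)" "(\<integral>y. y - x i \<partial>T i) = 0"
      "(\<integral>y. (y - x i) ^ 4 \<partial>T i) \<le> kurt * (v i)\<^sup>2" "(\<xi> i)\<^sup>2 * v i \<le> tilt_const * (1 + L i)\<^sup>2"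
    if "i < n" for i
    using xi[OF that] that unfolding centring_tilt_def Let_def v_def T_def h_def L_def by auto
  have sT: "sets (T i) = sets borel" for i by (simp add: T_def sets_lam)
  have prob_T: "prob_space (T i)" for i using T(1)[of i] prob_lam[of i] by (cases "i < n") (auto simp: T_def)
  define \<nu> where "\<nu> = PiM {..<n} T"
  interpret V: prob_space \<nu> unfolding \<nu>_def by (rule prob_space_PiM) (rule prob_T)
  have sV: "sets \<nu> = sets \<mu>"
    unfolding \<nu>_def \<mu>_PiM by (intro sets_PiM_cong) (auto simp: sT sets_lam)
  have spV: "space \<nu> = space \<mu>" by (rule sets_eq_imp_space_eq[OF sV])
  interpret PT: product_sigma_finite T
    by (simp add: product_sigma_finite_def prob_space_imp_sigma_finite prob_T)
  interpret PL: product_sigma_finite lam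
    by (simp add: product_sigma_finite_def prob_space_imp_sigma_finite prob_lam)
  define h' where "h' y = (\<Prod>i<n. h i (y i))" for y
  have hc: "(\<lambda>y. h i (y i)) \<in> borel_measurable \<mu>" if "i < n" for i
    unfolding \<mu>_PiM by (rule measurable_compose[OF measurable_component_singleton[where M = lam] hm]) (use that in simp)
  have h'm: "h' \<in> borel_measurable \<mu>" unfolding h'_def[abs_def] by (intro borel_measurable_prod_ennreal hc) simp
  \<comment> \<open>The product of the densities is a density of the product law: checked on boxes,
    which determine a finite product measure.\<close>
  have dens: "\<nu> = density \<mu> h'" unfolding \<nu>_def
  proof (rule PT.PiM_eqI[symmetric])
    show "sets (density \<mu> h') = sets (PiM {..<n} T)" using sV by (simp add: \<nu>_def)
    fix A assume A: "\<And>i. i \<in> {..<n} \<Longrightarrow> A i \<in> sets (T i)"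
    have A': "A i \<in> sets (lam i)" if "i < n" for i using A[of i] that by (simp add: sT sets_lam)
    have PA: "Pi\<^sub>E {..<n} A \<in> sets \<mu>" unfolding \<mu>_PiM using A' by (intro sets_PiM_I_finite) auto
    have "emeasure (density \<mu> h') (Pi\<^sub>E {..<n} A) = (\<integral>\<^sup>+y. h' y * indicator (Pi\<^sub>E {..<n} A) y \<partial>\<mu>)"
      by (rule emeasure_density[OF h'm PA])
    also have "\<dots> = (\<integral>\<^sup>+y. (\<Prod>i<n. h i (y i) * indicator (A i) (y i)) \<partial>\<mu>)"
    proof (rule nn_integral_cong)
      fix y assume "y \<in> space \<mu>"
      then have y: "y \<in> extensional {..<n}" by (simp add: space_M PiE_def)
      have "indicator (Pi\<^sub>E {..<n} A) y = (\<Prod>i<n. indicator (A i) (y i) :: ennreal)"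
      proof (cases "y \<in> Pi\<^sub>E {..<n} A")
        case False
        then obtain i where "i < n" "y i \<notin> A i" using y by (auto simp: PiE_iff)
        then have "(\<Prod>i<n. indicator (A i) (y i) :: ennreal) = 0"
            by (intro prod_zero) (auto intro!: bexI[of _ i])
        then show ?thesis using False by simp
      qed (auto simp: PiE_iff)
      then show "h' y * indicator (Pi\<^sub>E {..<n} A) y = (\<Prod>i<n. h i (y i) * indicator (A i) (y i))"
        by (simp add: h'_def prod.distrib)
    qed
    also have "\<dots> = (\<Prod>i<n. \<integral>\<^sup>+y. h i y * indicator (A i) y \<partial>lam i)"
      unfolding \<mu>_PiM
    proof (rule PL.product_nn_integral_prod)
      fix i assume "i \<in> {..<n}"
      then show "(\<lambda>y. h i y * indicator (A i) y) \<in> borel_measurable (lam i)"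
        using A'[of i] by (intro borel_measurable_times_ennreal hm borel_measurable_indicator) auto
    qed simp
    also have "\<dots> = (\<Prod>i<n. emeasure (T i) (A i))"
      using A' by (intro prod.cong refl) (simp add: T_def emeasure_density[OF hm])
    finally show "emeasure (density \<mu> h') (Pi\<^sub>E {..<n} A) = (\<Prod>i<n. emeasure (T i) (A i))" .
  qed simp
  \<comment> \<open>Arbitrary coefficients \<open>c\<close>, because these facts serve twice: with
    \<open>- \<theta>\<close> for the half-space and with \<open>\<xi>\<close> for the
    log-likelihood ratio.\<close>
  have lin: "\<And>(c :: nat \<Rightarrow> real) i. i < n \<Longrightarrow> integrable \<nu> (\<lambda>y. (c i * (y i - x i)) ^ 4)"
    "\<And>c i. i < n \<Longrightarrow> V.expectation (\<lambda>y. c i * (y i - x i)) = 0"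
    "\<And>c i. i < n \<Longrightarrow> V.expectation (\<lambda>y. (c i * (y i - x i))\<^sup>2) = (c i)\<^sup>2 * v i"
    "\<And>c i. i < n \<Longrightarrow> integrable \<nu> (\<lambda>y. (c i * (y i - x i))\<^sup>2)"
    "\<And>c i. i < n \<Longrightarrow> V.expectation (\<lambda>y. (c i * (y i - x i)) ^ 4) \<le> kurt * (V.expectation (\<lambda>y. (c i * (y i - x i))\<^sup>2))\<^sup>2"
    "\<And>c. V.indep_vars (\<lambda>_. borel) (\<lambda>i y. c i * (y i - x i)) {..<n}"
  proof -
    fix c :: "nat \<Rightarrow> real" and i assume i: "i < n"
    interpret Ti: prob_space "T i" by (rule T(1)[OF i])
    have [measurable]: "(\<lambda>y. y - x i) \<in> borel_measurable (T i)"
      unfolding measurable_cong_sets[OF sT refl] by simp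
    have int: "integrable (T i) (\<lambda>y. (y - x i) ^ k)" if "k \<le> 4" for k
      by (rule Ti.integrable_power_le[OF _ T(2)[OF i] that]) auto
    have int1: "integrable (T i) (\<lambda>y. y - x i)" using int[of 1] by simp
    note comp = PiM_integral_component[of "{..<n}" T i, folded \<nu>_def, OF prob_T]
    show 4: "integrable \<nu> (\<lambda>y. (c i * (y i - x i)) ^ 4)"
      by (rule comp(1)[of "\<lambda>y. (c i * (y - x i)) ^ 4"]) (use i int[of 4] in \<open>auto simp: power_mult_distrib\<close>)
    show "integrable \<nu> (\<lambda>y. (c i * (y i - x i))\<^sup>2)"
      by (rule comp(1)[of "\<lambda>y. (c i * (y - x i))\<^sup>2"]) (use i int[of 2] in \<open>auto simp: power_mult_distrib\<close>)
    have "V.expectation (\<lambda>y. c i * (y i - x i)) = (\<integral>y. c i * (y - x i) \<partial>T i)"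
      by (rule comp(2)[of "\<lambda>y. c i * (y - x i)"]) (use i int1 in auto)
    then show "V.expectation (\<lambda>y. c i * (y i - x i)) = 0" using T(3)[OF i] by simp
    have "V.expectation (\<lambda>y. (c i * (y i - x i))\<^sup>2) = (\<integral>y. (c i * (y - x i))\<^sup>2 \<partial>T i)"
      by (rule comp(2)[of "\<lambda>y. (c i * (y - x i))\<^sup>2"]) (use i int[of 2] in \<open>auto simp: power_mult_distrib\<close>)
    then show e2: "V.expectation (\<lambda>y. (c i * (y i - x i))\<^sup>2) = (c i)\<^sup>2 * v i"
      by (simp add: power_mult_distrib v_def)
    have "V.expectation (\<lambda>y. (c i * (y i - x i)) ^ 4) = (\<integral>y. (c i * (y - x i)) ^ 4 \<partial>T i)"
      by (rule comp(2)[of "\<lambda>y. (c i * (y - x i)) ^ 4"]) (use i int[of 4] in \<open>auto simp: power_mult_distrib\<close>)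
    also have "\<dots> = c i ^ 4 * (\<integral>y. (y - x i) ^ 4 \<partial>T i)" by (simp add: power_mult_distrib)
    also have "\<dots> \<le> c i ^ 4 * (kurt * (v i)\<^sup>2)" by (intro mult_left_mono T(4)[OF i]) simp
    also have "\<dots> = kurt * ((c i)\<^sup>2 * v i)\<^sup>2" by (simp add: power_mult_distrib flip: power_mult)
    finally show "V.expectation (\<lambda>y. (c i * (y i - x i)) ^ 4) \<le> kurt * (V.expectation (\<lambda>y. (c i * (y i - x i))\<^sup>2))\<^sup>2"
      unfolding e2 .
  next
    fix c :: "nat \<Rightarrow> real"
    have "(\<lambda>y. c i * (y - x i)) \<in> borel_measurable (T i)" for i
      unfolding measurable_cong_sets[OF sT refl] by simp
    then show "V.indep_vars (\<lambda>_. borel) (\<lambda>i y. c i * (y i - x i)) {..<n}"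
      unfolding \<nu>_def by (intro indep_vars_PiM_coordinate_functions[where g = "\<lambda>i y. c i * (y - x i)"] prob_T)
  qed
  have linm: "(\<lambda>y. \<Sum>i<n. c i * (y i - x i)) \<in> borel_measurable \<nu>" for c :: "nat \<Rightarrow> real"
    unfolding measurable_cong_sets[OF sV refl] by measurable
  define Z where "Z y = (\<Sum>i<n. \<xi> i * (y i - x i))" for y
  define W where "W y = (\<Sum>i<n. - \<theta> i * (y i - x i))" for y
  have [measurable]: "Z \<in> borel_measurable \<nu>" "W \<in> borel_measurable \<nu>"
    unfolding Z_def[abs_def] W_def[abs_def] by (rule linm)+
  define s where "s = depth_const * sqrt (sum_sq x)"
  \<comment> \<open>Every summand is at least \<open>1\<close>, so \<open>s\<close> is positive and
    Chebyshev's inequality applies.\<close>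
  have "real n * 1 \<le> sum_sq x"
  proof -
    have "1 \<le> (1 + rate (lam i) (x i))\<^sup>2" if "i < n" for i
      using centring_tiltD(1)[OF xi[OF that]] by (intro one_le_power) simp
    then have "(\<Sum>i<n. 1) \<le> sum_sq x" unfolding sum_sq_def by (intro sum_mono) simp
    then show ?thesis by simp
  qed
  then have Q: "0 < sum_sq x" using n by simp
  have s: "0 < s" using depth_const_pos Q by (simp add: s_def)
  note lin\<theta> = lin(1-5)[of _ "\<lambda>i. - \<theta> i"] and lin\<xi> = lin(1-5)[of _ \<xi>]
  have PW: "1 / (16 * kurt) \<le> V.prob {y\<in>space \<nu>. 0 \<le> W y}"
  proof -
    have F: "integrable \<nu> (\<lambda>y. W y ^ 4) \<and> V.expectation (\<lambda>y. W y ^ 4) \<le> kurt * (V.expectation (\<lambda>y. (W y)\<^sup>2))\<^sup>2"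
      unfolding W_def
      by (rule V.fourth_moment_sum_indep[OF _ lin(6)]) (use lin\<theta>(1,2,5) kurt_ge in auto)
    have "integrable \<nu> (\<lambda>y. (W y)\<^sup>2) \<and> V.expectation (\<lambda>y. W y) = 0 \<and>
        V.expectation (\<lambda>y. (W y)\<^sup>2) = (\<Sum>i<n. V.expectation (\<lambda>y. (- \<theta> i * (y i - x i))\<^sup>2))"
      unfolding W_def
      by (rule V.second_moment_sum_indep[OF _ lin(6)]) (use lin\<theta>(2,4) in auto)
    then have E0: "V.expectation W = 0" by simp
    have "1 / (16 * kurt) \<le> V.prob {w\<in>space \<nu>. sqrt (V.expectation (\<lambda>w. (W w)\<^sup>2)) / (8 * sqrt kurt) \<le> W w}"
      by (rule V.paley_zygmund_centered) (use F E0 kurt_ge in auto)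
    also have "\<dots> \<le> V.prob {y\<in>space \<nu>. 0 \<le> W y}"
    proof (intro V.finite_measure_mono subsetI)
      fix y assume y: "y \<in> {w\<in>space \<nu>. sqrt (V.expectation (\<lambda>w. (W w)\<^sup>2)) / (8 * sqrt kurt) \<le> W w}"
      have "0 \<le> sqrt (V.expectation (\<lambda>w. (W w)\<^sup>2)) / (8 * sqrt kurt)" using kurt_ge by simp
      then show "y \<in> {y\<in>space \<nu>. 0 \<le> W y}" using y by auto
    qed measurable
    finally show ?thesis .
  qed
  have PZ: "V.prob {y\<in>space \<nu>. s \<le> \<bar>Z y\<bar>} \<le> 1 / (32 * kurt)"
  proof -
    have E: "integrable \<nu> (\<lambda>y. (Z y)\<^sup>2) \<and> V.expectation (\<lambda>y. Z y) = 0 \<and>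
        V.expectation (\<lambda>y. (Z y)\<^sup>2) = (\<Sum>i<n. V.expectation (\<lambda>y. (\<xi> i * (y i - x i))\<^sup>2))"
      unfolding Z_def
      by (rule V.second_moment_sum_indep[OF _ lin(6)]) (use lin\<xi>(2,4) in auto)
    then have "V.expectation (\<lambda>y. (Z y)\<^sup>2) = (\<Sum>i<n. (\<xi> i)\<^sup>2 * v i)" using lin\<xi>(3) by simp
    also have "\<dots> \<le> (\<Sum>i<n. tilt_const * (1 + L i)\<^sup>2)" by (intro sum_mono T(5)) simp
    also have "\<dots> = tilt_const * sum_sq x" by (simp add: sum_sq_def L_def sum_distrib_left)
    finally have EZ: "V.expectation (\<lambda>y. (Z y)\<^sup>2) \<le> tilt_const * sum_sq x" .
    have "V.prob {y\<in>space \<nu>. s \<le> \<bar>Z y\<bar>} \<le> V.expectation (\<lambda>y. (Z y)\<^sup>2) / s\<^sup>2"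
      by (rule V.second_moment_method) (use E s in auto)
    also have "\<dots> \<le> tilt_const * sum_sq x / s\<^sup>2" by (intro divide_right_mono EZ) simp
    also have "\<dots> = 1 / (32 * kurt)"
      using Q kurt_ge tilt_const_pos by (simp add: s_def depth_const_def power_mult_distrib field_simps)
    finally show ?thesis .
  qed
  define G where "G = {y\<in>space \<nu>. 0 \<le> W y \<and> \<bar>Z y\<bar> < s}"
  have G[measurable]: "G \<in> sets \<nu>" unfolding G_def by measurable
  have "V.prob {y\<in>space \<nu>. 0 \<le> W y} \<le> V.prob (G \<union> {y\<in>space \<nu>. s \<le> \<bar>Z y\<bar>})"
    by (intro V.finite_measure_mono) (auto simp: G_def)
  also have "\<dots> \<le> V.prob G + V.prob {y\<in>space \<nu>. s \<le> \<bar>Z y\<bar>}" by (intro measure_Un_le) measurable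
  finally have "1 / (16 * kurt) \<le> V.prob G + 1 / (32 * kurt)" using PW PZ by linarith
  moreover have "1 / (16 * kurt) = 2 * (1 / (32 * kurt))" by simp
  ultimately have PG: "1 / (32 * kurt) \<le> V.prob G" by linarith
  have G\<mu>: "G \<in> sets \<mu>" using G sV by simp
  \<comment> \<open>Back to \<open>\<mu>\<close>: on \<open>G\<close> the density of
    \<open>\<nu>\<close> is at most \<open>exp (s + sum_rate x)\<close>, so the constant tilted mass
    of \<open>G\<close> loses only this factor.\<close>
  have "emeasure \<nu> G = (\<integral>\<^sup>+y. h' y * indicator G y \<partial>\<mu>)"
    unfolding dens by (rule emeasure_density[OF h'm G\<mu>])
  also have "\<dots> \<le> (\<integral>\<^sup>+y. ennreal (exp (s + sum_rate x)) * indicator G y \<partial>\<mu>)"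
  proof (rule nn_integral_mono)
    fix y
    have "h' y = ennreal (exp (Z y + sum_rate x))"
      by (simp add: h'_def h_def prod_ennreal exp_sum[symmetric] Z_def sum_rate_def L_def sum.distrib)
    then show "h' y * indicator G y \<le> ennreal (exp (s + sum_rate x)) * indicator G y"
      by (auto simp: G_def split: split_indicator intro!: ennreal_leI)
  qed
  also have "\<dots> = ennreal (exp (s + sum_rate x)) * emeasure \<mu> G"
    using G\<mu> by (rule nn_integral_cmult_indicator)
  finally have "V.prob G \<le> exp (s + sum_rate x) * prob G"
    by (simp add: V.emeasure_eq_measure emeasure_eq_measure ennreal_mult[symmetric])
  also have "prob G \<le> prob {y\<in>space \<mu>. (\<Sum>i<n. \<theta> i * (y i - x i)) \<le> 0}"
    by (rule finite_measure_mono) (auto simp: G_def W_def spV sum_negf)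
  finally have "1 / (32 * kurt) \<le> exp (s + sum_rate x) * prob {y\<in>space \<mu>. (\<Sum>i<n. \<theta> i * (y i - x i)) \<le> 0}"
    using PG by simp
  then have "exp (- (s + sum_rate x)) * (1 / (32 * kurt)) \<le>
      exp (- (s + sum_rate x)) * (exp (s + sum_rate x) * prob {y\<in>space \<mu>. (\<Sum>i<n. \<theta> i * (y i - x i)) \<le> 0})"
    by (intro mult_left_mono) auto
  also have "\<dots> = prob {y\<in>space \<mu>. (\<Sum>i<n. \<theta> i * (y i - x i)) \<le> 0}"
    by (simp add: mult.assoc[symmetric] exp_add[symmetric])
  finally show ?thesis by (simp add: s_def algebra_simps)
qed

section \<open>Quantitative bounds for the expected mass of the hull\<close>

lemma E_meas_K_lower_tail:
  assumes N: "0 < N" and a: "0 < a"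
  shows "E_meas_K n N \<mu> \<le> real n * rate_const / a\<^sup>2 + real N * exp (a - mean_rate)"
proof -
  have "E_meas_K n N \<mu> \<le> prob {x\<in>space \<mu>. sum_rate x \<le> mean_rate - a} + real N * exp (- (mean_rate - a))"
    by (rule E_meas_K_upper[OF N])
  also have "prob {x\<in>space \<mu>. sum_rate x \<le> mean_rate - a} \<le> prob {x\<in>space \<mu>. a \<le> \<bar>sum_rate x - mean_rate\<bar>}"
    by (intro finite_measure_mono) auto
  also have "\<dots> \<le> real n * rate_const / a\<^sup>2" by (rule sum_rate_deviation[OF a])
  finally show ?thesis by simp
qed

text \<open>Restricts to points with \<open>sum_rate\<close> near its mean (Chebyshev) and
  \<open>sum_sq\<close> below \<open>q\<close> (Markov). \<open>a\<close> and \<open>q\<close> stay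
  free because the limit, the threshold window and \<open>exists_E_meas_K_gt\<close> use different
  scales.\<close>

lemma E_meas_K_upper_tail:
  assumes n: "0 < n" and N: "n < N" and a: "0 < a" and q: "0 < q"
  shows "1 - real n * rate_const / a\<^sup>2 - real n * rate_const / q
      - 32 * kurt * (real n + 1) * exp (mean_rate + a + depth_const * sqrt q) / real N \<le> E_meas_K n N \<mu>"
proof -
  define p where "p = exp (- mean_rate - a - depth_const * sqrt q) / (32 * kurt)"
  have p: "0 < p" using kurt_ge by (simp add: p_def)
  define A where "A = {x\<in>space \<mu>. \<bar>sum_rate x - mean_rate\<bar> < a \<and> sum_sq x < q}"
  have A: "A \<in> sets \<mu>" unfolding A_def by measurable
  have "prob A - (real n + 1) / (real N * p) \<le> E_meas_K n N \<mu>"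
  proof (rule E_meas_K_ge[OF _ p A])
    show "2 \<le> N" using n N by simp
    show "AE x in \<mu>. x \<in> A \<longrightarrow> (\<forall>\<theta>. p \<le> prob {y\<in>space \<mu>. (\<Sum>i<n. \<theta> i * (y i - x i)) \<le> 0})"
      using AE_good
    proof eventually_elim
      case (elim x)
      show ?case
      proof (intro impI allI)
        fix \<theta> :: "nat \<Rightarrow> real" assume "x \<in> A"
        then have x: "sum_rate x \<le> mean_rate + a" "sum_sq x \<le> q" by (auto simp: A_def)
        have "depth_const * sqrt (sum_sq x) \<le> depth_const * sqrt q"
          using x depth_const_pos by (intro mult_left_mono) auto
        then have "- mean_rate - a - depth_const * sqrt q \<le> - sum_rate x - depth_const * sqrt (sum_sq x)"
          using x by linarith
        then have "p \<le> exp (- sum_rate x - depth_const * sqrt (sum_sq x)) / (32 * kurt)"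
          unfolding p_def using kurt_ge by (intro divide_right_mono) auto
        also have "\<dots> \<le> prob {y\<in>space \<mu>. (\<Sum>i<n. \<theta> i * (y i - x i)) \<le> 0}"
          by (rule half_space_prob_ge[OF n elim])
        finally show "p \<le> prob {y\<in>space \<mu>. (\<Sum>i<n. \<theta> i * (y i - x i)) \<le> 0}" .
      qed
    qed
  qed
  moreover have "1 - real n * rate_const / a\<^sup>2 - real n * rate_const / q \<le> prob A"
  proof -
    have "1 = prob (space \<mu>)" by (simp add: prob_space)
    also have "\<dots> \<le> prob (A \<union> ({x\<in>space \<mu>. a \<le> \<bar>sum_rate x - mean_rate\<bar>} \<union> {x\<in>space \<mu>. q \<le> sum_sq x}))"
      using A by (intro finite_measure_mono) (auto simp: A_def)
    also have "\<dots> \<le> prob A + prob ({x\<in>space \<mu>. a \<le> \<bar>sum_rate x - mean_rate\<bar>} \<union> {x\<in>space \<mu>. q \<le> sum_sq x})"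
      using A by (intro measure_Un_le) auto
    also have "\<dots> \<le> prob A + (prob {x\<in>space \<mu>. a \<le> \<bar>sum_rate x - mean_rate\<bar>} + prob {x\<in>space \<mu>. q \<le> sum_sq x})"
      by (intro add_left_mono measure_Un_le) auto
    finally show ?thesis using sum_rate_deviation[OF a] sum_sq_large[OF q] by linarith
  qed
  moreover have "(real n + 1) / (real N * p) = 32 * kurt * (real n + 1) * exp (mean_rate + a + depth_const * sqrt q) / real N"
  proof -
    have "1 / p = 32 * kurt * exp (mean_rate + a + depth_const * sqrt q)"
      using kurt_ge by (simp add: p_def exp_diff exp_minus exp_add field_simps)
    moreover have "(real n + 1) / (real N * p) = (real n + 1) / real N * (1 / p)" by simp
    ultimately show ?thesis by (simp add: mult_ac)
  qed
  ultimately show ?thesis by linarith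
qed

end

section \<open>Thresholds\<close>

lemma (in prob_Rn) E_meas_K_le_1:
  assumes "0 < N"
  shows "E_meas_K n N M \<le> 1"
  using E_meas_K_le[OF assms, of 0 "space M"] by (auto simp: prob_space)

lemma
  assumes lc: "\<And>m. has_log_concave_density (lam m)"
  defines "T \<equiv> \<lambda>n. E_Lambda_star n (prod_meas lam n)" and "E \<equiv> \<lambda>n N. E_meas_K n N (prod_meas lam n)"
  shows E_Lambda_star_ge: "rate_low * real n \<le> T n"
    and E_meas_K_prod_nonneg: "0 \<le> E n N"
    and E_meas_K_prod_le_1: "0 < N \<Longrightarrow> E n N \<le> 1"
    and E_meas_K_prod_le: "0 < N \<Longrightarrow> 0 < a \<Longrightarrow> E n N \<le> real n * rate_const / a\<^sup>2 + real N * exp (a - T n)"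
    and E_meas_K_prod_ge: "0 < n \<Longrightarrow> n < N \<Longrightarrow> 0 < a \<Longrightarrow> 0 < q \<Longrightarrow>
      1 - real n * rate_const / a\<^sup>2 - real n * rate_const / q
        - 32 * kurt * (real n + 1) * exp (T n + a + depth_const * sqrt q) / real N \<le> E n N"
proof -
  interpret log_concave_product lam n by standard (rule lc)
  have "T n = mean_rate" unfolding T_def using E_Lambda_star_eq by (simp add: \<mu>_def)
  moreover have "E n N = E_meas_K n N \<mu>" for N by (simp add: E_def \<mu>_def)
  ultimately show "rate_low * real n \<le> T n" "0 \<le> E n N" "0 < N \<Longrightarrow> E n N \<le> 1"
    "0 < N \<Longrightarrow> 0 < a \<Longrightarrow> E n N \<le> real n * rate_const / a\<^sup>2 + real N * exp (a - T n)"
    "0 < n \<Longrightarrow> n < N \<Longrightarrow> 0 < a \<Longrightarrow> 0 < q \<Longrightarrow>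
      1 - real n * rate_const / a\<^sup>2 - real n * rate_const / q
        - 32 * kurt * (real n + 1) * exp (T n + a + depth_const * sqrt q) / real N \<le> E n N"
    using mean_rate_ge E_meas_K_nonneg E_meas_K_le_1 E_meas_K_lower_tail E_meas_K_upper_tail
    by (simp_all add: mult.commute)
qed

text \<open>With deviation \<open>\<epsilon> * T / 2\<close> around the mean transform
  \<open>T\<close>, Chebyshev's error is \<open>O(1 / n)\<close> since \<open>T\<close> grows at
  least linearly, and the union bound keeps the factor
  \<open>exp (- (\<epsilon> / 2 * T))\<close>.\<close>

lemma E_meas_K_tendsto_0:
  assumes lc: "\<And>m. has_log_concave_density (lam m)" and N: "\<And>n. n < N n" and eps: "0 < \<epsilon>"
    and le: "\<And>n. 1 \<le> n \<Longrightarrow> real (N n) \<le> exp ((1 - \<epsilon>) * E_Lambda_star n (prod_meas lam n))"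
  shows "(\<lambda>n. E_meas_K n (N n) (prod_meas lam n)) \<longlonglongrightarrow> 0"
proof (rule tendsto_sandwich[where f = "\<lambda>_. 0"])
  define b where "b = 4 * rate_const / (\<epsilon> * rate_low)\<^sup>2"
  define e where "e = \<epsilon> * rate_low / 2"
  have e: "0 < e" using eps rate_low_pos by (simp add: e_def)
  show "(\<lambda>n. b / real n + exp (- e * real n)) \<longlonglongrightarrow> 0" using e by real_asymp
  show "eventually (\<lambda>n. E_meas_K n (N n) (prod_meas lam n) \<le> b / real n + exp (- e * real n)) sequentially"
    using eventually_ge_at_top[of 1]
  proof eventually_elim
    case (elim n)
    define T where "T = E_Lambda_star n (prod_meas lam n)"
    have n: "0 < real n" using elim by simp
    have T: "rate_low * real n \<le> T" using E_Lambda_star_ge[OF lc] by (simp add: T_def)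
    have T0: "0 < rate_low * real n" using n rate_low_pos by simp
    then have "0 < T" using T by linarith
    have N0: "0 < N n" using N[of n] by simp
    have "E_meas_K n (N n) (prod_meas lam n) \<le> real n * rate_const / (\<epsilon> * T / 2)\<^sup>2 + real (N n) * exp (\<epsilon> * T / 2 - T)"
      unfolding T_def by (rule E_meas_K_prod_le[OF lc N0]) (use \<open>0 < T\<close> eps T_def in simp)
    also have "real n * rate_const / (\<epsilon> * T / 2)\<^sup>2 \<le> real n * rate_const / (\<epsilon> * (rate_low * real n) / 2)\<^sup>2"
      using n T T0 eps rate_const_pos rate_low_pos \<open>0 < T\<close>
      by (intro divide_left_mono power_mono divide_right_mono mult_left_mono) auto
    also have "\<dots> = b / real n" using n eps rate_low_pos by (simp add: b_def field_simps power2_eq_square)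
    also have "real (N n) * exp (\<epsilon> * T / 2 - T) \<le> exp ((1 - \<epsilon>) * T) * exp (\<epsilon> * T / 2 - T)"
      using le[OF elim] by (intro mult_right_mono) (auto simp: T_def)
    also have "\<dots> = exp (- (\<epsilon> / 2 * T))" by (simp add: exp_add[symmetric] algebra_simps)
    also have "\<dots> \<le> exp (- e * real n)"
      using mult_left_mono[OF T, of "\<epsilon> / 2"] eps by (simp add: e_def mult_ac)
    finally show ?case by simp
  qed
qed (use E_meas_K_prod_nonneg[of lam, OF lc] in auto)

lemma E_meas_K_tendsto_1:
  assumes lc: "\<And>m. has_log_concave_density (lam m)" and N: "\<And>n. n < N n" and eps: "0 < \<epsilon>"
    and ge: "\<And>n. 1 \<le> n \<Longrightarrow> exp ((1 + \<epsilon>) * E_Lambda_star n (prod_meas lam n)) \<le> real (N n)"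
  shows "(\<lambda>n. E_meas_K n (N n) (prod_meas lam n)) \<longlonglongrightarrow> 1"
proof (rule tendsto_sandwich[where h = "\<lambda>_. 1"])
  define D where "D = depth_const"
  have D: "0 < D" using depth_const_pos by (simp add: D_def)
  define b where "b = 16 * rate_const / (\<epsilon> * rate_low)\<^sup>2"
  define e where "e = \<epsilon> * rate_low / 2"
  define k where "k = 32 * kurt"
  have k: "0 < k" using kurt_ge by (simp add: k_def)
  have e: "0 < e" using eps rate_low_pos by (simp add: e_def)
  show "(\<lambda>n. 1 - b / real n - D\<^sup>2 * b / real n - k * (real n + 1) * exp (- e * real n)) \<longlonglongrightarrow> 1"
    using e by real_asymp
  show "eventually (\<lambda>n. 1 - b / real n - D\<^sup>2 * b / real n - k * (real n + 1) * exp (- e * real n)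
      \<le> E_meas_K n (N n) (prod_meas lam n)) sequentially"
    using eventually_ge_at_top[of 1]
  proof eventually_elim
    case (elim n)
    define T where "T = E_Lambda_star n (prod_meas lam n)"
    have n: "0 < real n" "0 < n" using elim by auto
    have T: "rate_low * real n \<le> T" using E_Lambda_star_ge[OF lc] by (simp add: T_def)
    have T0: "0 < rate_low * real n" using n rate_low_pos by simp
    then have Tp: "0 < T" using T by linarith
    have N0: "0 < N n" using N[of n] by simp
    \<comment> \<open>With \<open>q = (a / D)\<^sup>2\<close> both losses in the exponent equal
      \<open>a\<close> and use up half of the margin \<open>\<epsilon> * T\<close>; the other half
      beats the factor \<open>n + 1\<close>.\<close>
    define a where "a = \<epsilon> * T / 4"
    have a: "0 < a" using Tp eps by (simp add: a_def)
    have bn: "real n * rate_const / a\<^sup>2 \<le> b / real n"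
    proof -
      have "real n * rate_const / a\<^sup>2 \<le> real n * rate_const / (\<epsilon> * (rate_low * real n) / 4)\<^sup>2"
        unfolding a_def using n T T0 Tp eps rate_const_pos rate_low_pos
        by (intro divide_left_mono power_mono divide_right_mono mult_left_mono) auto
      also have "\<dots> = b / real n" using n eps rate_low_pos by (simp add: b_def field_simps power2_eq_square)
      finally show ?thesis .
    qed
    have "1 - real n * rate_const / a\<^sup>2 - real n * rate_const / (a / D)\<^sup>2
        - 32 * kurt * (real n + 1) * exp (T + a + depth_const * sqrt ((a / D)\<^sup>2)) / real (N n)
        \<le> E_meas_K n (N n) (prod_meas lam n)"
      unfolding T_def by (rule E_meas_K_prod_ge[OF lc n(2) N a]) (use a D in simp)
    moreover have "real n * rate_const / (a / D)\<^sup>2 = D\<^sup>2 * (real n * rate_const / a\<^sup>2)"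
      using D by (simp add: power_divide)
    moreover have "D\<^sup>2 * (real n * rate_const / a\<^sup>2) \<le> D\<^sup>2 * (b / real n)"
      by (intro mult_left_mono bn) simp
    moreover have "32 * kurt * (real n + 1) * exp (T + a + depth_const * sqrt ((a / D)\<^sup>2)) / real (N n)
      \<le> k * (real n + 1) * exp (- e * real n)"
    proof -
      have "depth_const * sqrt ((a / D)\<^sup>2) = a" using a D by (simp add: D_def)
      then have "32 * kurt * (real n + 1) * exp (T + a + depth_const * sqrt ((a / D)\<^sup>2)) / real (N n)
        = k * (real n + 1) * (exp (T + 2 * a) / real (N n))" by (simp add: k_def)
      also have "exp (T + 2 * a) / real (N n) \<le> exp (T + 2 * a) / exp ((1 + \<epsilon>) * T)"
        using ge[OF elim] N0 by (intro divide_left_mono) (auto simp: T_def)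
      also have "\<dots> = exp (- (\<epsilon> / 2 * T))" by (simp add: exp_diff[symmetric] a_def algebra_simps)
      also have "\<dots> \<le> exp (- e * real n)"
        using mult_left_mono[OF T, of "\<epsilon> / 2"] eps by (simp add: e_def mult_ac)
      finally show ?thesis using k n by (simp add: mult_left_mono)
    qed
    ultimately show ?case using bn by simp
  qed
  have "0 < N n" for n using N[of n] by simp
  then show "eventually (\<lambda>n. E_meas_K n (N n) (prod_meas lam n) \<le> 1) sequentially"
    by (intro always_eventually allI E_meas_K_prod_le_1[of lam, OF lc])
qed simp

text \<open>For fixed \<open>n\<close> the hull of many points captures almost all mass. This bounds
  the set in \<open>rho1\<close> from above, so that its supremum is meaningful.\<close>

lemma exists_E_meas_K_gt:
  assumes lc: "\<And>m. has_log_concave_density (lam m)" and n: "0 < n" and d: "\<delta> < 1"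
  shows "\<exists>N>n. \<delta> < E_meas_K n N (prod_meas lam n)"
proof -
  \<comment> \<open>Three error terms of at most \<open>(1 - \<delta>) / 4\<close> each leave
    \<open>1 - 3 * ((1 - \<delta>) / 4)\<close>, which exceeds \<open>\<delta>\<close>.\<close>
  define q where "q = 4 * real n * rate_const / (1 - \<delta>)"
  have q: "0 < q" using n d rate_const_pos by (simp add: q_def)
  have nq: "real n * rate_const / q = (1 - \<delta>) / 4"
    using n d rate_const_pos by (simp add: q_def)
  define B where "B = 32 * kurt * (real n + 1) * exp (E_Lambda_star n (prod_meas lam n) + sqrt q + depth_const * sqrt q)"
  obtain M :: nat where M: "4 * B / (1 - \<delta>) \<le> real M" using real_arch_simple by blast
  define N where "N = max M (Suc n)"
  have N: "n < N" "0 < N" by (auto simp: N_def)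
  have "B * 4 \<le> real M * (1 - \<delta>)" using M d by (simp add: field_simps)
  also have "\<dots> \<le> real N * (1 - \<delta>)" using d by (intro mult_right_mono) (auto simp: N_def)
  finally have BN: "B / real N \<le> (1 - \<delta>) / 4" using N by (simp add: field_simps)
  have ge: "1 - real n * rate_const / (sqrt q)\<^sup>2 - real n * rate_const / q - B / real N \<le> E_meas_K n N (prod_meas lam n)"
    unfolding B_def by (rule E_meas_K_prod_ge[OF lc n N(1)]) (use q in auto)
  have "real n * rate_const / (sqrt q)\<^sup>2 = (1 - \<delta>) / 4" using nq q by simp
  then have "1 - (1 - \<delta>) / 4 - (1 - \<delta>) / 4 - B / real N \<le> E_meas_K n N (prod_meas lam n)"
    using ge by (simp only: nq)
  with BN have "1 - 3 * ((1 - \<delta>) / 4) \<le> E_meas_K n N (prod_meas lam n)" by argo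
  then show ?thesis using N d by (intro exI[of _ N] conjI) argo+
qed

text \<open>Membership of \<open>r2\<close> and \<open>r1\<close> in the two defining sets bounds
  \<open>rho2\<close> above and \<open>rho1\<close> below, and the mean transform cancels in the
  difference. The value of \<open>a\<close> makes each Chebyshev or Markov error equal to
  \<open>\<delta> / 4\<close>.\<close>

lemma rho_bounds:
  assumes lc: "\<And>m. has_log_concave_density (lam m)" and n: "1 \<le> n" and d: "0 < \<delta>" "\<delta> < 1"
    and a: "a = 2 * sqrt (rate_const * real n / \<delta>)"
    and big: "32 * kurt * (real n + 1) / real n ^ 3 \<le> \<delta> / 2" "1 / real n \<le> \<delta> / 2"
      "0 < rate_low * real n - a - ln (real n)"
  shows "rho n (prod_meas lam n) \<delta> \<le> (2 + depth_const) * a + 4 * ln (real n)"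
proof -
  let ?R1 = "{r. r > 0 \<and> (\<forall>N. n < N \<and> real N \<le> exp r \<longrightarrow> E_meas_K n N (prod_meas lam n) \<le> \<delta>)}"
  let ?R2 = "{r. r > 0 \<and> (\<forall>N. n < N \<and> real N \<ge> exp r \<longrightarrow> E_meas_K n N (prod_meas lam n) \<ge> 1 - \<delta>)}"
  define T where "T = E_Lambda_star n (prod_meas lam n)"
  have n0: "0 < n" "0 < real n" using n by auto
  have T: "rate_low * real n \<le> T" using E_Lambda_star_ge[OF lc] by (simp add: T_def)
  have a0: "0 < a" using n d rate_const_pos by (simp add: a)
  have a2: "a\<^sup>2 = 4 * (rate_const * real n / \<delta>)" using n0 d rate_const_pos by (simp add: a power_mult_distrib)
  have na: "real n * rate_const / a\<^sup>2 = \<delta> / 4" unfolding a2 using n0 d rate_const_pos by simp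
  have ln0: "0 \<le> ln (real n)" using n by simp
  \<comment> \<open>The summand \<open>3 * ln n\<close> divides the factor \<open>n + 1\<close> by
    \<open>n ^ 3\<close>, which \<open>big(1)\<close> makes small enough.\<close>
  define r2 where "r2 = T + a + depth_const * a + 3 * ln (real n)"
  have r2: "0 < r2"
    using mult_pos_pos[OF rate_low_pos n0(2)] mult_pos_pos[OF depth_const_pos a0] T a0 ln0 unfolding r2_def by linarith
  have "rho2 n (prod_meas lam n) \<delta> \<le> r2"
    unfolding rho2_def
  proof (rule cInf_lower)
    show "bdd_below ?R2"
      by (rule bdd_belowI[of _ 0]) auto
    have "1 - \<delta> \<le> E_meas_K n N (prod_meas lam n)" if N: "n < N" "exp r2 \<le> real N" for N
    proof -
      have "1 - real n * rate_const / a\<^sup>2 - real n * rate_const / a\<^sup>2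
        - 32 * kurt * (real n + 1) * exp (T + a + depth_const * sqrt (a\<^sup>2)) / real N
        \<le> E_meas_K n N (prod_meas lam n)"
        unfolding T_def by (rule E_meas_K_prod_ge[OF lc n0(1) N(1) a0]) (use a0 in simp)
      moreover have "32 * kurt * (real n + 1) * exp (T + a + depth_const * sqrt (a\<^sup>2)) / real N \<le> \<delta> / 2"
      proof -
        have "exp (T + a + depth_const * sqrt (a\<^sup>2)) / real N \<le> exp (T + a + depth_const * a) / exp r2"
          using N a0 by (intro frac_le) auto
        also have "\<dots> = exp (- (3 * ln (real n)))" by (simp add: exp_diff[symmetric] r2_def)
        also have "\<dots> = 1 / real n ^ 3"
          using n0 by (simp add: exp_minus exp_of_nat_mult[of 3, simplified] inverse_eq_divide)
        finally have "32 * kurt * (real n + 1) * (exp (T + a + depth_const * sqrt (a\<^sup>2)) / real N)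
            \<le> 32 * kurt * (real n + 1) * (1 / real n ^ 3)"
          using kurt_ge by (intro mult_left_mono) auto
        then show ?thesis using big(1) by simp
      qed
      ultimately show ?thesis unfolding na by linarith
    qed
    then show "r2 \<in> ?R2"
      using r2 by auto
  qed
  \<comment> \<open>Subtracting \<open>ln n\<close> reduces the union bound to \<open>1 / n\<close>;
    positivity of \<open>r1\<close> is what \<open>big(3)\<close> secures.\<close>
  define r1 where "r1 = T - a - ln (real n)"
  have r1: "0 < r1" using T big(3) unfolding r1_def by linarith
  have "r1 \<le> rho1 n (prod_meas lam n) \<delta>"
    unfolding rho1_def
  proof (rule cSup_upper)
    have "E_meas_K n N (prod_meas lam n) \<le> \<delta>" if N: "n < N" "real N \<le> exp r1" for N
    proof -
      have N0: "0 < N" using N by simp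
      have "E_meas_K n N (prod_meas lam n) \<le> real n * rate_const / a\<^sup>2 + real N * exp (a - T)"
        unfolding T_def by (rule E_meas_K_prod_le[OF lc N0 a0])
      moreover have "real N * exp (a - T) \<le> exp r1 * exp (a - T)" using N by (intro mult_right_mono) auto
      moreover have "exp r1 * exp (a - T) = 1 / real n"
        using n0 by (simp add: exp_add[symmetric] r1_def exp_minus inverse_eq_divide)
      ultimately show ?thesis unfolding na using big(2) d by linarith
    qed
    then show "r1 \<in> ?R1"
      using r1 by auto
    have "\<exists>N>n. \<delta> < E_meas_K n N (prod_meas lam n)" by (rule exists_E_meas_K_gt[OF lc n0(1) d(2)])
    then obtain N where N: "n < N" "\<delta> < E_meas_K n N (prod_meas lam n)" by auto
    show "bdd_above ?R1"
    proof (rule bdd_aboveI[of _ "ln (real N)"])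
      fix r assume "r \<in> ?R1"
      then have "\<not> real N \<le> exp r" using N by fastforce
      then show "r \<le> ln (real N)" using N(1) by (subst ln_ge_iff) auto
    qed
  qed
  then show ?thesis using \<open>rho2 n (prod_meas lam n) \<delta> \<le> r2\<close>
    unfolding rho_def r1_def r2_def by (simp add: algebra_simps)
qed

definition threshold_const :: real where
  "threshold_const = (2 + depth_const) * (2 * sqrt rate_const) / rate_low + 4 / rate_low"

text \<open>How large \<open>n\<close> has to be is decided here by \<open>\<delta>\<close> alone,
  uniformly in the laws; the constant depends on neither.\<close>

lemma rho_quotient_bound:
  assumes lc: "\<And>m. has_log_concave_density (lam m)" and d: "0 < \<delta>" "\<delta> < 1"
  shows "\<forall>\<^sub>F n in sequentially. rho n (prod_meas lam n) \<delta> / E_Lambda_star n (prod_meas lam n)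
    \<le> threshold_const * max ((\<delta> * real n) powr (-1/2)) (ln (real n) / real n)"
proof -
  define k where "k = 32 * kurt"
  define c where "c = rate_low"
  define A where "A = 2 * sqrt (rate_const / \<delta>)"
  have c: "0 < c" using rate_low_pos by (simp add: c_def)
  have "(\<lambda>n. k * (real n + 1) / real n ^ 3) \<longlonglongrightarrow> 0" by real_asymp
  then have 1: "\<forall>\<^sub>F n in sequentially. k * (real n + 1) / real n ^ 3 < \<delta> / 2"
    using d by (intro order_tendstoD(2)) auto
  have "(\<lambda>n. 1 / real n) \<longlonglongrightarrow> 0" by real_asymp
  then have 2: "\<forall>\<^sub>F n in sequentially. 1 / real n < \<delta> / 2" using d by (intro order_tendstoD(2)) auto
  have "filterlim (\<lambda>n. c * real n - A * sqrt (real n) - ln (real n)) at_top sequentially"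
    using c by real_asymp
  then have 3: "\<forall>\<^sub>F n in sequentially. 0 < c * real n - A * sqrt (real n) - ln (real n)"
    by (rule filterlim_at_top_dense[THEN iffD1, rule_format])
  show ?thesis using 1 2 3 eventually_ge_at_top[of 1]
  proof eventually_elim
    case (elim n)
    define T where "T = E_Lambda_star n (prod_meas lam n)"
    define a where "a = 2 * sqrt (rate_const * real n / \<delta>)"
    define \<Psi> where "\<Psi> = max ((\<delta> * real n) powr (-1/2)) (ln (real n) / real n)"
    have n: "0 < real n" using elim by simp
    have T: "c * real n \<le> T" using E_Lambda_star_ge[OF lc] by (simp add: T_def c_def)
    have T0: "0 < c * real n" using n c by simp
    have aA: "a = A * sqrt (real n)" by (simp add: a_def A_def real_sqrt_mult[symmetric])
    have "rho n (prod_meas lam n) \<delta> \<le> (2 + depth_const) * a + 4 * ln (real n)"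
      by (rule rho_bounds[OF lc elim(4) d a_def]) (use elim aA in \<open>auto simp: k_def c_def\<close>)
    \<comment> \<open>The numerator must be nonnegative before \<open>T\<close> is replaced by its
      lower bound in the denominator.\<close>
    moreover have pos: "0 \<le> (2 + depth_const) * a + 4 * ln (real n)"
      using depth_const_pos rate_const_pos n d elim by (simp add: a_def)
    ultimately have "rho n (prod_meas lam n) \<delta> / T \<le> ((2 + depth_const) * a + 4 * ln (real n)) / (c * real n)"
      using T T0 by (intro order_trans[OF divide_right_mono divide_left_mono]) (auto intro: mult_pos_pos)
    also have "\<dots> = (2 + depth_const) * (a / real n) / c + 4 / c * (ln (real n) / real n)"
      by (simp add: add_divide_distrib)
    also have "a / real n = 2 * sqrt rate_const * (\<delta> * real n) powr (-1/2)"
    proof -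
      have "(\<delta> * real n) powr (-1/2) = 1 / sqrt (\<delta> * real n)"
        using d n by (simp add: powr_minus_divide powr_half_sqrt)
      moreover have "sqrt (real n) / real n = 1 / sqrt (real n)"
        using n by (simp add: field_simps)
      moreover have "a / real n = 2 * sqrt rate_const / sqrt \<delta> * (sqrt (real n) / real n)"
        by (simp add: a_def real_sqrt_mult real_sqrt_divide)
      ultimately show ?thesis by (simp add: real_sqrt_mult)
    qed
    also have "(2 + depth_const) * (2 * sqrt rate_const * (\<delta> * real n) powr (-1/2)) / c + 4 / c * (ln (real n) / real n)
      \<le> (2 + depth_const) * (2 * sqrt rate_const * \<Psi>) / c + 4 / c * \<Psi>"
      using depth_const_pos rate_const_pos c unfolding \<Psi>_def
      by (intro add_mono divide_right_mono mult_left_mono) auto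
    also have "\<dots> = threshold_const * \<Psi>"
      by (simp add: threshold_const_def c_def algebra_simps)
    finally show ?case by (simp add: T_def \<Psi>_def)
  qed
qed

theorem theorem2p4:
  shows "(\<forall>(lam :: nat \<Rightarrow> real measure) (N :: nat \<Rightarrow> nat) (\<epsilon> :: real).
            (\<forall>m. has_log_concave_density (lam m)) \<and> (\<forall>n. n < N n) \<and> 0 < \<epsilon> \<and> \<epsilon> < 1 \<longrightarrow>
            ((\<forall>n\<ge>1. real (N n) \<le> exp ((1 - \<epsilon>) * E_Lambda_star n (prod_meas lam n))) \<longrightarrow>
                (\<lambda>n. E_meas_K n (N n) (prod_meas lam n)) \<longlonglongrightarrow> 0) \<and>
            ((\<forall>n\<ge>1. real (N n) \<ge> exp ((1 + \<epsilon>) * E_Lambda_star n (prod_meas lam n))) \<longrightarrow>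
                (\<lambda>n. E_meas_K n (N n) (prod_meas lam n)) \<longlonglongrightarrow> 1))
       \<and> (\<exists>C > 0. \<forall>lam :: nat \<Rightarrow> real measure. (\<forall>m. has_log_concave_density (lam m)) \<longrightarrow>
            (\<forall>\<delta>. 0 < \<delta> \<and> \<delta> < 1 \<longrightarrow>
               (\<forall>\<^sub>F n in sequentially.
                  rho n (prod_meas lam n) \<delta> / E_Lambda_star n (prod_meas lam n)
                    \<le> C * max ((\<delta> * real n) powr (-1/2)) (ln (real n) / real n))))"
proof (intro conjI exI[of _ threshold_const])
  show "0 < threshold_const"
    using depth_const_pos rate_const_pos rate_low_pos by (simp add: threshold_const_def add_pos_pos)
qed (blast intro: E_meas_K_tendsto_0 E_meas_K_tendsto_1 rho_quotient_bound)+

end
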